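(* Let $q\in(0,1)$ and fix any $p>0$. Let $\mathfrak h$ be the height function of the $q$-PNG with intensity $\Lambda=2(1-q)$ and droplet initial condition. Then $$\lim_{t\to\infty}\frac1t\log\mathbb E\big[e^{p\,\mathfrak h(0,t)}\big]=4\sinh(p/2).$$
   Context: **$q$-PNG with droplet initial condition.** Fix $q\in(0,1)$ and $\Lambda>0$. On the cone $\mathcal C=\{(x,t)\in\mathbb R\times\mathbb R_+: |x|\le t\}$ sample a Poisson point process $\mathcal P$ of intensity $\Lambda$ (with respect to Lebesgue measure). From every point of $\mathcal P$ two rays emanate, one directed north-eastward (angle $45^\circ$) and one directed north-westward (angle $135^\circ$), the second coordinate $t$ being the upward direction. Whenever two rays emanating from different points meet, independently of everything else, with probability $1-q$ both terminate at the intersection point, and with probability $q$ they cross each other and both continue along their trajectories. For $(x,t)\in\mathcal C$ the height $\mathfrak h(x,t)$ is the number of rays that intersect the straight segment from $(x,t)$ to $(0,0)$; $\mathfrak h(x,t)=-\infty$ if $(x,t)\notin\mathcal C$. *)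

theory Defs
  imports "HOL-Probability.Probability"
begin

section \<open>Poisson point process\<close>

definition forward_cone :: "(real \<times> real) set" where
  "forward_cone = {(x, t). \<bar>x\<bar> \<le> t}"

definition point_count :: "(nat \<Rightarrow> 'w \<Rightarrow> real \<times> real) \<Rightarrow> (real \<times> real) set \<Rightarrow> 'w \<Rightarrow> nat" where
  "point_count X A \<omega> = card {i. X i \<omega> \<in> A}"

text \<open>
  Poisson process of intensity \<open>\<Lambda>\<close> on the cone, given by an enumeration \<open>X 0, X 1, \<dots>\<close>
  of its points: the cone has infinite area, so almost surely there are infinitely many points.
  As usual for point processes, every realisation is a locally finite configuration.
  The probabilities are written out because the library's \<open>poisson_pmf\<close> requires a positive
  rate, whereas \<open>A\<close> may be a null set.
\<close>

definition poisson_process_on_cone ::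
    "'w measure \<Rightarrow> real \<Rightarrow> (nat \<Rightarrow> 'w \<Rightarrow> real \<times> real) \<Rightarrow> bool" where
  "poisson_process_on_cone M \<Lambda> X \<longleftrightarrow>
     (\<forall>i. X i \<in> borel_measurable M) \<and>
     (\<forall>\<omega>\<in>space M. \<forall>i. X i \<omega> \<in> forward_cone) \<and>
     (\<forall>\<omega>\<in>space M. \<forall>A. bounded A \<longrightarrow> finite {i. X i \<omega> \<in> A}) \<and>
     (\<forall>A\<in>sets borel. bounded A \<longrightarrow>
        (\<forall>k. measure M {\<omega>\<in>space M. point_count X A \<omega> = k} =
          (\<Lambda> * measure lborel (A \<inter> forward_cone)) ^ k / fact k
            * exp (- (\<Lambda> * measure lborel (A \<inter> forward_cone))))) \<and>
     (\<forall>(A :: nat \<Rightarrow> (real \<times> real) set) I.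
        disjoint_family_on A I \<and> (\<forall>n\<in>I. A n \<in> sets borel \<and> bounded (A n)) \<longrightarrow>
        prob_space.indep_vars M (\<lambda>_. count_space UNIV) (\<lambda>n. point_count X (A n)) I)"


section \<open>Ray dynamics for a fixed configuration\<close>

datatype direction = NE | NW

fun ray :: "direction \<Rightarrow> real \<times> real \<Rightarrow> real \<Rightarrow> real \<times> real" where
  "ray NE z r = z + (r, r)"
| "ray NW z r = z + (- r, r)"

definition rays_meet :: "real \<times> real \<Rightarrow> real \<times> real \<Rightarrow> bool" where
  "rays_meet a b \<longleftrightarrow> (\<exists>r\<ge>0. \<exists>s\<ge>0. ray NE a r = ray NW b s)"

text \<open>
  The time coordinate of the intersection of the north-east ray from \<open>a\<close> with the north-west
  ray from \<open>b\<close>; see \<open>meet_time_eq\<close> below.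
\<close>

definition meet_time :: "real \<times> real \<Rightarrow> real \<times> real \<Rightarrow> real" where
  "meet_time a b = (snd a + snd b + fst b - fst a) / 2"

lemma meet_time_eq:
  assumes "ray NE a r = ray NW b s"
  shows "snd (ray NE a r) = meet_time a b" "snd (ray NW b s) = meet_time a b"
  using assms by (auto simp: meet_time_def prod_eq_iff)

text \<open>
  Points are \<open>x 0, x 1, \<dots>\<close>, and \<open>c (i, j)\<close> says that the north-east ray of \<open>x i\<close> and the
  north-west ray of \<open>x j\<close> cross if they ever both reach their intersection point. Rays with the
  same direction are parallel and do not interact. \<open>K\<close> is the set of pairs \<open>(i, j)\<close> whose rays
  terminate each other: they have an intersection point, neither has been terminated strictly
  before it, and the coin is not in favour of crossing.
\<close>

definition termination_rule ::
    "(nat \<Rightarrow> real \<times> real) \<Rightarrow> (nat \<times> nat \<Rightarrow> bool) \<Rightarrow> (nat \<times> nat) set \<Rightarrow> bool" where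
  "termination_rule x c K \<longleftrightarrow>
     (\<forall>i j. (i, j) \<in> K \<longleftrightarrow>
        i \<noteq> j \<and> rays_meet (x i) (x j) \<and> \<not> c (i, j) \<and>
        (\<forall>j'. (i, j') \<in> K \<longrightarrow> meet_time (x i) (x j) \<le> meet_time (x i) (x j')) \<and>
        (\<forall>i'. (i', j) \<in> K \<longrightarrow> meet_time (x i) (x j) \<le> meet_time (x i') (x j)))"

text \<open>
  Well defined on locally finite configurations in the cone; see \<open>ex1_termination_rule\<close> below.
\<close>

definition terminations ::
    "(nat \<Rightarrow> real \<times> real) \<Rightarrow> (nat \<times> nat \<Rightarrow> bool) \<Rightarrow> (nat \<times> nat) set" where
  "terminations x c = (THE K. termination_rule x c K)"

fun trajectory ::
    "(nat \<Rightarrow> real \<times> real) \<Rightarrow> (nat \<times> nat \<Rightarrow> bool) \<Rightarrow> direction \<Rightarrow> nat \<Rightarrow> (real \<times> real) set" where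
  "trajectory x c NE i = {ray NE (x i) r | r. 0 \<le> r \<and>
     (\<forall>j. (i, j) \<in> terminations x c \<longrightarrow> snd (ray NE (x i) r) \<le> meet_time (x i) (x j))}"
| "trajectory x c NW j = {ray NW (x j) r | r. 0 \<le> r \<and>
     (\<forall>i. (i, j) \<in> terminations x c \<longrightarrow> snd (ray NW (x j) r) \<le> meet_time (x i) (x j))}"

definition height ::
    "(nat \<Rightarrow> real \<times> real) \<Rightarrow> (nat \<times> nat \<Rightarrow> bool) \<Rightarrow> real \<times> real \<Rightarrow> ereal" where
  "height x c z =
     (if z \<in> forward_cone
      then ereal (card {(d, i). trajectory x c d i \<inter> closed_segment z (0, 0) \<noteq> {}})
      else - \<infinity>)"

lemma finite_early_points:
  assumes cone: "\<And>i. x i \<in> forward_cone"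
    and lf: "\<And>A. bounded A \<Longrightarrow> finite {i. x i \<in> A}"
  shows "finite {i. snd (x i) \<le> (T::real)}"
proof -
  have "bounded ({-T..T} \<times> {0..T})"
    by (intro bounded_Times bounded_closed_interval)
  then have "finite {i. x i \<in> {-T..T} \<times> {0..T}}" by (rule lf)
  moreover have "{i. snd (x i) \<le> T} \<subseteq> {i. x i \<in> {-T..T} \<times> {0..T}}"
  proof safe
    fix i assume "snd (x i) \<le> T"
    with cone[of i] show "x i \<in> {-T..T} \<times> {0..T}"
      by (cases "x i") (auto simp: forward_cone_def)
  qed
  ultimately show ?thesis by (rule finite_subset[rotated])
qed

lemma rays_meet_time:
  assumes "rays_meet a b"
  shows "snd a \<le> meet_time a b" "snd b \<le> meet_time a b"
proof -
  from assms obtain r s where rs: "0 \<le> r" "0 \<le> s" "ray NE a r = ray NW b s"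
    by (auto simp: rays_meet_def)
  from meet_time_eq[OF rs(3)] rs(1,2)
  show "snd a \<le> meet_time a b" "snd b \<le> meet_time a b" by auto
qed

lemma ex1_termination_rule:
  assumes cone: "\<And>i. x i \<in> forward_cone"
    and lf: "\<And>A. bounded A \<Longrightarrow> finite {i. x i \<in> A}"
  shows "\<exists>!K. termination_rule x c K"
proof -
  define T where "T = (\<lambda>(i, j). meet_time (x i) (x j))"
  define P where "P = (\<lambda>(i, j). i \<noteq> j \<and> rays_meet (x i) (x j) \<and> \<not> c (i, j))"
  define R where "R = {(a, b). P a \<and> P b \<and> T a < T b}"
  have fin: "finite {a. P a \<and> T a < t}" for t
  proof (rule finite_subset)
    show "{a. P a \<and> T a < t} \<subseteq> {i. snd (x i) \<le> t} \<times> {i. snd (x i) \<le> t}"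
    proof
      fix a assume a: "a \<in> {a. P a \<and> T a < t}"
      obtain i j where ij: "a = (i, j)" by (cases a)
      with a have "rays_meet (x i) (x j)" "meet_time (x i) (x j) < t"
        by (simp_all add: P_def T_def)
      with rays_meet_time[of "x i" "x j"]
      show "a \<in> {i. snd (x i) \<le> t} \<times> {i. snd (x i) \<le> t}" by (simp add: ij)
    qed
  qed (intro finite_cartesian_product finite_early_points cone lf)
  have "wf R"
  proof (rule wf_subset)
    show "R \<subseteq> Wellfounded.measure (\<lambda>b. card {a. P a \<and> T a < T b})"
    proof clarify
      fix a b assume ab: "(a, b) \<in> R"
      have "card {d. P d \<and> T d < T a} < card {d. P d \<and> T d < T b}"
        by (rule psubset_card_mono[OF fin]) (use ab in \<open>auto simp: R_def\<close>)
      then show "(a, b) \<in> Wellfounded.measure (\<lambda>b. card {a. P a \<and> T a < T b})" by simp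
    qed
  qed simp
  define Q where "Q = (\<lambda>a b :: nat \<times> nat. fst a = fst b \<or> snd a = snd b)"
  have pairs: "termination_rule x c K \<longleftrightarrow> (\<forall>b. b \<in> K \<longleftrightarrow> P b \<and> (\<forall>a\<in>K. Q a b \<longrightarrow> T b \<le> T a))" for K
  proof -
    have "(\<forall>a\<in>K. Q a (i, j) \<longrightarrow> T (i, j) \<le> T a) \<longleftrightarrow>
        (\<forall>j'. (i, j') \<in> K \<longrightarrow> meet_time (x i) (x j) \<le> meet_time (x i) (x j')) \<and>
        (\<forall>i'. (i', j) \<in> K \<longrightarrow> meet_time (x i) (x j) \<le> meet_time (x i') (x j))" for i j
      unfolding Q_def T_def by auto
    then show ?thesis
      unfolding termination_rule_def split_paired_All by (simp add: P_def)
  qed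
  have rule: "termination_rule x c K \<longleftrightarrow>
      (\<forall>b. b \<in> K \<longleftrightarrow> P b \<and> (\<forall>a. (a, b) \<in> R \<and> Q a b \<longrightarrow> a \<notin> K))" (is "_ \<longleftrightarrow> ?r") for K
  proof -
    have eq: "(\<forall>a\<in>K. Q a b \<longrightarrow> T b \<le> T a) \<longleftrightarrow> (\<forall>a. (a, b) \<in> R \<and> Q a b \<longrightarrow> a \<notin> K)"
      if "K \<subseteq> {a. P a}" "P b" for b
      unfolding R_def mem_Collect_eq case_prod_conv using that not_less by blast
    show ?thesis
    proof
      assume "termination_rule x c K"
      then have *: "\<forall>b. b \<in> K \<longleftrightarrow> P b \<and> (\<forall>a\<in>K. Q a b \<longrightarrow> T b \<le> T a)" unfolding pairs .
      then have "K \<subseteq> {a. P a}" by blast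
      from * eq[OF this] show ?r by metis
    next
      assume *: ?r
      then have "K \<subseteq> {a. P a}" by blast
      from * eq[OF this] show "termination_rule x c K" unfolding pairs by metis
    qed
  qed
  define F where "F = (\<lambda>f b. P b \<and> (\<forall>a. (a, b) \<in> R \<and> Q a b \<longrightarrow> \<not> f a))"
  define g where "g = wfrec R F"
  have "adm_wf R F"
    unfolding adm_wf_def F_def by blast
  with \<open>wf R\<close> have "g = F g"
    unfolding g_def by (rule wfrec_fixpoint)
  then have g: "g b = F g b" for b by (rule fun_cong)
  show ?thesis
  proof (rule ex1I)
    show "termination_rule x c {b. g b}"
      unfolding rule mem_Collect_eq using g unfolding F_def by blast
  next
    fix K assume K: "termination_rule x c K"
    have "b \<in> K \<longleftrightarrow> g b" for b
      using \<open>wf R\<close>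
    proof (induction b)
      case (less b)
      with K[unfolded rule] g[of b] show ?case unfolding F_def by blast
    qed
    then show "K = {b. g b}" by blast
  qed
qed

lemma finite_rays_hitting_segment:
  assumes cone: "\<And>i. x i \<in> forward_cone"
    and lf: "\<And>A. bounded A \<Longrightarrow> finite {i. x i \<in> A}"
    and z: "z \<in> forward_cone"
  shows "finite {(d, i). trajectory x c d i \<inter> closed_segment z (0, 0) \<noteq> {}}"
proof (rule finite_subset)
  have z0: "0 \<le> snd z" using z by (auto simp: forward_cone_def)
  have seg: "snd w \<le> snd z" if "w \<in> closed_segment z (0, 0)" for w
  proof -
    from that obtain u where "0 \<le> u" "u \<le> 1" "w = (1 - u) *\<^sub>R z + u *\<^sub>R (0, 0)"
      by (auto simp: closed_segment_def)
    with z0 show ?thesis by (simp add: mult_left_le_one_le)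
  qed
  have traj: "snd (x i) \<le> snd w" if "w \<in> trajectory x c d i" for w d i
    using that by (cases d) auto
  show "{(d, i). trajectory x c d i \<inter> closed_segment z (0, 0) \<noteq> {}}
      \<subseteq> {NE, NW} \<times> {i. snd (x i) \<le> snd z}"
  proof
    fix p assume "p \<in> {(d, i). trajectory x c d i \<inter> closed_segment z (0, 0) \<noteq> {}}"
    then obtain d i w where "p = (d, i)" "w \<in> trajectory x c d i" "w \<in> closed_segment z (0, 0)"
      by blast
    moreover from this have "snd (x i) \<le> snd z" using seg traj order_trans by blast
    ultimately show "p \<in> {NE, NW} \<times> {i. snd (x i) \<le> snd z}" by (cases d) simp_all
  qed
qed (intro finite_cartesian_product finite_early_points cone lf; simp)


section \<open>The \<open>q\<close>-PNG with droplet initial condition\<close>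

text \<open>
  \<open>B (i, j)\<close> is the coin tossed if the north-east ray of point \<open>i\<close> meets the north-west ray of
  point \<open>j\<close>. Tossing a coin also for the pairs that never meet does not affect the dynamics.
\<close>

locale q_png = prob_space M
  for M :: "'w measure" and q \<Lambda> :: real
    and X :: "nat \<Rightarrow> 'w \<Rightarrow> real \<times> real" and B :: "nat \<times> nat \<Rightarrow> 'w \<Rightarrow> bool" +
  assumes q_pos: "0 < q" and q_less_1: "q < 1" and intensity_pos: "0 < \<Lambda>"
    and points: "poisson_process_on_cone M \<Lambda> X"
    and coins_prob: "\<And>e. prob {\<omega>\<in>space M. B e \<omega>} = q"
    and coins_indep: "indep_vars (\<lambda>_. count_space UNIV) B UNIV"
    and coins_indep_points:
      "indep_set {(\<lambda>\<omega> i. X i \<omega>) -` S \<inter> space M | S. S \<in> sets (Pi\<^sub>M UNIV (\<lambda>_. borel))}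
                 {(\<lambda>\<omega> e. B e \<omega>) -` S \<inter> space M | S. S \<in> sets (Pi\<^sub>M UNIV (\<lambda>_. count_space UNIV))}"

definition png_height ::
    "(nat \<Rightarrow> 'w \<Rightarrow> real \<times> real) \<Rightarrow> (nat \<times> nat \<Rightarrow> 'w \<Rightarrow> bool) \<Rightarrow> real \<times> real \<Rightarrow> 'w \<Rightarrow> ereal" where
  "png_height X B z \<omega> = height (\<lambda>i. X i \<omega>) (\<lambda>e. B e \<omega>) z"

end

theory Submission
  imports Defs "HOL-Real_Asymp.Real_Asymp"
begin

text \<open>
  In the coordinates \<open>u = t + x\<close>, \<open>v = t - x\<close> the north-east rays are horizontal and the north-west rays
  vertical lines. On a fine \<open>n\<close> by \<open>n\<close> grid the dynamics becomes a vertex model: a cell without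
  incoming lines emits a horizontal and a vertical one with a small probability \<open>d\<close>, and two lines
  meeting in a cell die with probability \<open>1 - q\<close>. Write \<open>z\<close> for the exponential of \<open>p\<close>.

  Upper bound: let additional lines enter independently through the lower and the left side, with
  odds \<open>a\<close> and \<open>b\<close>. Such sources only increase the height. If \<open>z a b = d / (1 - q)\<close>, then weighting by
  \<open>z\<close> to the number of lower sources turns the odds \<open>a\<close> into \<open>z a\<close>, for which the model is stationary,
  and the exponential moment of the height with sources is an explicit product. With \<open>a = b\<close> it
  grows at rate \<open>2 (z - 1) / sqrt z\<close>, which is \<open>4 sinh (p / 2)\<close>.

  Lower bound: remove the sources one by one. Let \<open>h\<close> be the height without the last source and \<open>h'\<close>
  the height if no line from the left of that source gets past it. Up to a constant factor, the
  source raises \<open>h\<close> with probability at most \<open>Q ^ (h - h')\<close>, \<open>Q = q / (1 - d)\<close>. Hence it changes the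
  exponential moment by a factor close to \<open>1\<close> unless \<open>h\<close> is close to \<open>h'\<close>, and \<open>h'\<close> is the height of a
  droplet in a smaller rectangle. For sources far from the corner the upper bound makes this second
  contribution exponentially small compared with the explicit product; near the corner it is
  bounded by the droplet itself, whose moment therefore carries the full growth rate.
\<close>

section \<open>Finite expectations and sweeps of a grid\<close>

text \<open>The intensity is tuned so that \<open>d / (1 - q)\<close> is about
  \<open>(t / n)\<^sup>2\<close>; \<open>q\<close> then drops out of the odds and of the rate.

  The odds may be skewed to \<open>l * a\<close> and \<open>a / l\<close>. The best \<open>l\<close>
  would show that a droplet whose rectangle has one side shortened by the factor
  \<open>1 - x\<close> has at most \<open>sqrt (1 - x)\<close> times the rate of the full square. A
  source at the fraction \<open>x\<close> of a side, together with the weight of the sources before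
  it, thus contributes at the relative rate \<open>x / 2 + sqrt (1 - x)\<close>, which is strictly
  below 1 for \<open>x > 0\<close>. This strict inequality confines the relevant sources to the
  corner; \<open>l = 1 + e / 2\<close> is close enough to the optimum to retain it.

  The obstacle is that about \<open>t / sqrt z\<close> sources per side have to be removed, so the
  trivial factor \<open>z\<close> for each would cost an exponential in \<open>t\<close>. The
  geometric decay in \<open>h - h'\<close> makes the loss per source as small as desired.

  The grid approximates the height for one \<open>t\<close> at a time, so \<open>n\<close> tends to
  infinity first, and \<open>t\<close> only in the resulting inequalities.\<close>

text \<open>Expectations with respect to finitely supported distributions, as functionals.\<close>

inductive fexp :: "(('a \<Rightarrow> real) \<Rightarrow> real) \<Rightarrow> bool" where
  fexp_ret: "fexp (\<lambda>f. f x)"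
| fexp_mix: "0 \<le> p \<Longrightarrow> p \<le> 1 \<Longrightarrow> fexp L \<Longrightarrow> fexp K \<Longrightarrow> fexp (\<lambda>f. p * L f + (1 - p) * K f)"

lemma fexp_bind:
  assumes "fexp L" "\<And>x. fexp (K x)"
  shows "fexp (\<lambda>f. L (\<lambda>x. K x f))"
  using assms(1) by induction (auto intro: assms(2) fexp_mix)

lemma fexp_map: "fexp L \<Longrightarrow> fexp (\<lambda>f. L (\<lambda>x. f (g x)))"
  by (rule fexp_bind) (auto intro: fexp_ret)

lemma fexp_add: "fexp L \<Longrightarrow> L (\<lambda>x. f x + g x) = L f + L g"
  by (induction rule: fexp.induct) (simp_all add: algebra_simps)

lemma fexp_cmult: "fexp L \<Longrightarrow> L (\<lambda>x. c * f x) = c * L f"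
  by (induction rule: fexp.induct) (simp_all add: algebra_simps)

lemma fexp_const: "fexp L \<Longrightarrow> L (\<lambda>x. c) = c"
  by (induction rule: fexp.induct) (simp_all add: algebra_simps)

lemma fexp_mono: "fexp L \<Longrightarrow> (\<And>x. f x \<le> g x) \<Longrightarrow> L f \<le> L g"
  by (induction rule: fexp.induct) (auto intro!: add_mono mult_left_mono)

lemma fexp_nonneg: "fexp L \<Longrightarrow> (\<And>x. 0 \<le> f x) \<Longrightarrow> 0 \<le> L f"
  using fexp_mono[of L "\<lambda>_. 0" f] fexp_const[of L 0] by simp

text \<open>Fubini: cells that do not feed each other may be processed in either order.\<close>

lemma fexp_commute:
  assumes "fexp L" "fexp K"
  shows "L (\<lambda>x. K (\<lambda>y. g x y)) = K (\<lambda>y. L (\<lambda>x. g x y))"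
  using assms(1)
  by induction (simp_all add: fexp_add[OF assms(2)] fexp_cmult[OF assms(2)])

abbreviation ones :: "bool list \<Rightarrow> nat" where "ones l \<equiv> count_list l True"
abbreviation falses :: "nat \<Rightarrow> bool list" where "falses n \<equiv> replicate n False"

text \<open>
  A vertex maps the incoming vertical and horizontal line states to the expectation over the
  outgoing ones. A sweep takes the states \<open>hs\<close> on the left side (bottom to top) and \<open>vs\<close> on the lower
  side (left to right) to the expectation over the states on the right and upper sides.
\<close>

type_synonym ('v, 'h) vertex = "'v \<Rightarrow> 'h \<Rightarrow> ('v \<times> 'h \<Rightarrow> real) \<Rightarrow> real"

fun sweep_row :: "('v, 'h) vertex \<Rightarrow> 'h \<Rightarrow> 'v list \<Rightarrow> ('h \<times> 'v list \<Rightarrow> real) \<Rightarrow> real" where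
  "sweep_row vt h [] f = f (h, [])"
| "sweep_row vt h (v # vs) f =
     vt v h (\<lambda>(v', h'). sweep_row vt h' vs (\<lambda>(h'', vs'). f (h'', v' # vs')))"

fun sweep :: "('v, 'h) vertex \<Rightarrow> 'h list \<Rightarrow> 'v list \<Rightarrow> ('h list \<times> 'v list \<Rightarrow> real) \<Rightarrow> real" where
  "sweep vt [] vs f = f ([], vs)"
| "sweep vt (h # hs) vs f =
     sweep_row vt h vs (\<lambda>(h', vs'). sweep vt hs vs' (\<lambda>(hs', vs''). f (h' # hs', vs'')))"

lemma fexp_sweep_row:
  assumes "\<And>v h. fexp (vt v h)"
  shows "fexp (sweep_row vt h vs)"
proof (induction vs arbitrary: h)
  case Nil
  then show ?case by (simp add: fexp_ret)
next
  case (Cons v vs)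
  have "fexp (\<lambda>f. vt v h (\<lambda>x. (case x of (v', h') \<Rightarrow>
      \<lambda>f. sweep_row vt h' vs (\<lambda>y. f (case y of (h'', vs') \<Rightarrow> (h'', v' # vs')))) f))"
    by (rule fexp_bind[OF assms]) (auto split: prod.split intro: fexp_map[OF Cons.IH])
  then show ?case by (simp add: case_prod_beta')
qed

lemma fexp_sweep:
  assumes "\<And>v h. fexp (vt v h)"
  shows "fexp (sweep vt hs vs)"
proof (induction hs arbitrary: vs)
  case Nil
  then show ?case by (simp add: fexp_ret)
next
  case (Cons h hs)
  have "fexp (\<lambda>f. sweep_row vt h vs (\<lambda>x. (case x of (h', vs') \<Rightarrow>
      \<lambda>f. sweep vt hs vs' (\<lambda>y. f (case y of (hs', vs'') \<Rightarrow> (h' # hs', vs'')))) f))"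
    by (rule fexp_bind[OF fexp_sweep_row[OF assms]])
      (auto split: prod.split intro: fexp_map[OF Cons.IH])
  then show ?case by (simp add: case_prod_beta')
qed

lemma sweep_row_append:
  "sweep_row vt h (vs @ ws) f = sweep_row vt h vs (\<lambda>(h', vs').
     sweep_row vt h' ws (\<lambda>(h'', ws'). f (h'', vs' @ ws')))"
  by (induction vs arbitrary: h f) (simp_all add: case_prod_beta')

text \<open>In a sweep by rows the columns \<open>ws\<close> of the first row precede the columns
  \<open>vs\<close> of the later rows. Neither part feeds the other, so \<open>fexp_commute\<close>
  exchanges them.\<close>

lemma sweep_append_cols:
  assumes "\<And>v h. fexp (vt v h)"
  shows "sweep vt hs (vs @ ws) f = sweep vt hs vs (\<lambda>(hs', vs').
     sweep vt hs' ws (\<lambda>(hs'', ws'). f (hs'', vs' @ ws')))"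
proof (induction hs arbitrary: vs ws f)
  case Nil
  then show ?case by simp
next
  case (Cons h hs)
  have "sweep_row vt h' ws (\<lambda>(h'', ws'). sweep vt hs vs' (\<lambda>(hs', vs'').
        sweep vt hs' ws' (\<lambda>(hs'', ws''). f (h'' # hs'', vs'' @ ws'')))) =
      sweep vt hs vs' (\<lambda>(hs', vs''). sweep_row vt h' ws (\<lambda>(h'', ws').
        sweep vt hs' ws' (\<lambda>(hs'', ws''). f (h'' # hs'', vs'' @ ws''))))" for h' vs'
    unfolding case_prod_beta'
    by (rule fexp_commute) (intro fexp_sweep fexp_sweep_row assms)+
  then show ?case
    by (simp add: sweep_row_append Cons.IH case_prod_beta')
qed

lemma sweep_append_rows:
  "sweep vt (hs @ ks) vs f = sweep vt hs vs (\<lambda>(hs', vs').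
     sweep vt ks vs' (\<lambda>(ks', vs''). f (hs' @ ks', vs'')))"
  by (induction hs arbitrary: vs f) (simp_all add: case_prod_beta')

text \<open>Lumping, by which a coupled model is reduced to its marginals: the state handed on to
  the next cell is again projected, so the property of one vertex propagates.\<close>

lemma sweep_row_project:
  assumes "\<And>v h g. vt v h (\<lambda>(v', h'). g (pv v', ph h')) = vt' (pv v) (ph h) g"
  shows "sweep_row vt h vs (\<lambda>(h', vs'). f (ph h', map pv vs')) =
    sweep_row vt' (ph h) (map pv vs) f"
proof (induction vs arbitrary: h f)
  case Nil
  then show ?case by simp
next
  case (Cons v vs)
  have "sweep_row vt h (v # vs) (\<lambda>(h', vs'). f (ph h', map pv vs')) =
      vt v h (\<lambda>(v', h'). sweep_row vt h' vs (\<lambda>(h'', vs'). (\<lambda>(k, ws). f (k, pv v' # ws)) (ph h'', map pv vs')))"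
    by (simp add: case_prod_beta')
  also have "\<dots> = vt v h (\<lambda>(v', h'). (\<lambda>(a, b). sweep_row vt' b (map pv vs) (\<lambda>(k, ws). f (k, a # ws))) (pv v', ph h'))"
    by (subst Cons.IH) simp
  also have "\<dots> = vt' (pv v) (ph h) (\<lambda>(a, b). sweep_row vt' b (map pv vs) (\<lambda>(k, ws). f (k, a # ws)))"
    by (rule assms)
  finally show ?case by simp
qed

lemma sweep_project:
  assumes "\<And>v h g. vt v h (\<lambda>(v', h'). g (pv v', ph h')) = vt' (pv v) (ph h) g"
  shows "sweep vt hs vs (\<lambda>(hs', vs'). f (map ph hs', map pv vs')) =
    sweep vt' (map ph hs) (map pv vs) f"
proof (induction hs arbitrary: vs f)
  case Nil
  then show ?case by simp
next
  case (Cons h hs)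
  have "sweep vt (h # hs) vs (\<lambda>(hs', vs'). f (map ph hs', map pv vs')) =
      sweep_row vt h vs (\<lambda>(h', vs'). sweep vt hs vs' (\<lambda>(hs', vs''). (\<lambda>(ks, ws). f (ph h' # ks, ws)) (map ph hs', map pv vs'')))"
    by (simp add: case_prod_beta')
  also have "\<dots> = sweep_row vt h vs (\<lambda>(h', vs'). (\<lambda>(a, b). sweep vt' (map ph hs) b (\<lambda>(ks, ws). f (a # ks, ws))) (ph h', map pv vs'))"
    by (subst Cons.IH) simp
  also have "\<dots> = sweep_row vt' (ph h) (map pv vs) (\<lambda>(a, b). sweep vt' (map ph hs) b (\<lambda>(ks, ws). f (a # ks, ws)))"
    by (rule sweep_row_project[where vt = vt and vt' = vt' and pv = pv and ph = ph, OF assms])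
  finally show ?case by simp
qed

lemma sweep_transpose_single:
  assumes "\<And>v h g. vt v h g = vt' h v (\<lambda>(b, a). g (a, b))"
  shows "sweep vt hs [v] f = sweep_row vt' v hs (\<lambda>(v', hs'). f (hs', [v']))"
proof (induction hs arbitrary: v f)
  case Nil
  then show ?case by simp
next
  case (Cons h hs)
  have "sweep vt (h # hs) [v] f = vt v h (\<lambda>(v', h'). sweep vt hs [v'] (\<lambda>(hs', vs''). f (h' # hs', vs'')))"
    by (simp add: case_prod_beta')
  also have "\<dots> = sweep_row vt' v (h # hs) (\<lambda>(v', hs'). f (hs', [v']))"
    unfolding Cons.IH by (subst assms) (simp add: case_prod_beta')
  finally show ?case .
qed

lemma sweep_transpose:
  assumes "\<And>v h. fexp (vt v h)"
    and sym: "\<And>v h g. vt v h g = vt' h v (\<lambda>(b, a). g (a, b))"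
  shows "sweep vt hs vs f = sweep vt' vs hs (\<lambda>(vs', hs'). f (hs', vs'))"
proof (induction vs arbitrary: hs f)
  case Nil
  have "sweep vt hs [] f = f (hs, [])" for f
    by (induction hs arbitrary: f) auto
  then show ?case by simp
next
  case (Cons v vs)
  have "sweep vt hs (v # vs) f = sweep vt hs [v] (\<lambda>(hs', vs'). sweep vt hs' vs (\<lambda>(hs'', ws'). f (hs'', vs' @ ws')))"
    using sweep_append_cols[OF assms(1), where vs = "[v]" and ws = vs] by simp
  also have "\<dots> = sweep vt' (v # vs) hs (\<lambda>(vs', hs'). f (hs', vs'))"
    by (simp add: sweep_transpose_single[where vt = vt and vt' = vt', OF sym] Cons.IH case_prod_beta')
  finally show ?case .
qed

section \<open>The vertex model\<close>

definition coin_exp :: "real \<Rightarrow> (bool \<Rightarrow> real) \<Rightarrow> real" where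
  "coin_exp p f = p * f True + (1 - p) * f False"

fun bits_exp :: "real \<Rightarrow> nat \<Rightarrow> (bool list \<Rightarrow> real) \<Rightarrow> real" where
  "bits_exp p 0 f = f []"
| "bits_exp p (Suc n) f = coin_exp p (\<lambda>b. bits_exp p n (\<lambda>bs. f (b # bs)))"

lemma fexp_coin: "0 \<le> p \<Longrightarrow> p \<le> 1 \<Longrightarrow> fexp (coin_exp p)"
  unfolding coin_exp_def by (intro fexp_mix fexp_ret)

lemma fexp_bits:
  assumes "0 \<le> p" "p \<le> 1"
  shows "fexp (bits_exp p n)"
proof (induction n)
  case 0
  then show ?case by (simp add: fexp_ret)
next
  case (Suc n)
  then show ?case
    using fexp_bind[OF fexp_coin[OF assms], of "\<lambda>b f. bits_exp p n (\<lambda>bs. f (b # bs))"]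
    by (simp add: fexp_map)
qed

lemma bits_exp_snoc:
  assumes "0 \<le> p" "p \<le> 1"
  shows "bits_exp p (Suc n) f = bits_exp p n (\<lambda>bs. coin_exp p (\<lambda>b. f (bs @ [b])))"
proof (induction n arbitrary: f)
  case (Suc n)
  have "bits_exp p (Suc (Suc n)) f = coin_exp p (\<lambda>b. bits_exp p (Suc n) (\<lambda>bs. f (b # bs)))"
    by (rule bits_exp.simps(2))
  also have "\<dots> = coin_exp p (\<lambda>c. bits_exp p n (\<lambda>bs. coin_exp p (\<lambda>b. f (c # bs @ [b]))))"
    by (simp only: Suc.IH append_Cons)
  also have "\<dots> = bits_exp p (Suc n) (\<lambda>bs. coin_exp p (\<lambda>b. f (bs @ [b])))"
    by (simp only: bits_exp.simps(2) append_Cons)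
  finally show ?case .
qed simp

text \<open>Exponential change of measure: the odds of each bit are multiplied by \<open>z\<close>,
  and \<open>1 - p + z * p\<close> is the normalisation of one bit.\<close>

lemma bits_exp_tilt:
  fixes z :: real
  assumes "0 \<le> p" "p \<le> 1" "0 \<le> z" "1 - p + z * p \<noteq> 0"
  shows "bits_exp p n (\<lambda>bs. z ^ ones bs * f bs) =
    (1 - p + z * p) ^ n * bits_exp (z * p / (1 - p + z * p)) n f"
proof (induction n arbitrary: f)
  case 0
  then show ?case by simp
next
  case (Suc n)
  let ?w = "1 - p + z * p" and ?B = "bits_exp (z * p / (1 - p + z * p)) n"
  have "bits_exp p n (\<lambda>bs. z ^ ones (True # bs) * f (True # bs)) =
      z * bits_exp p n (\<lambda>bs. z ^ ones bs * f (True # bs))"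
    by (subst fexp_cmult[OF fexp_bits[OF assms(1,2)], symmetric]) (simp add: mult.assoc)
  then have A: "bits_exp p (Suc n) (\<lambda>bs. z ^ ones bs * f bs) =
      ?w ^ n * (p * z * ?B (\<lambda>bs. f (True # bs)) + (1 - p) * ?B (\<lambda>bs. f (False # bs)))"
    using Suc[of "\<lambda>bs. f (True # bs)"] Suc[of "\<lambda>bs. f (False # bs)"]
    by (simp add: coin_exp_def distrib_left mult_ac)
  have "p * z * x + (1 - p) * y = ?w * (z * p / ?w * x + (1 - z * p / ?w) * y)" for x y
  proof -
    have "?w * (z * p / ?w * x + (1 - z * p / ?w) * y) = (?w * (z * p / ?w)) * x + (?w - ?w * (z * p / ?w)) * y"
      by (simp add: algebra_simps)
    also have "?w * (z * p / ?w) = z * p" using assms(4) by simp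
    finally show ?thesis by (simp add: algebra_simps)
  qed
  then show ?case unfolding A by (simp only: bits_exp.simps(2) coin_exp_def power_Suc2 mult.assoc)
qed

lemma bits_exp_count:
  fixes z :: real
  assumes "0 \<le> p" "p \<le> 1"
  shows "bits_exp p n (\<lambda>bs. z ^ ones bs) = (1 - p + z * p) ^ n"
proof (induction n)
  case 0
  then show ?case by simp
next
  case (Suc n)
  have "bits_exp p n (\<lambda>bs. z * z ^ ones bs) = z * bits_exp p n (\<lambda>bs. z ^ ones bs)"
    by (rule fexp_cmult[OF fexp_bits[OF assms]])
  then show ?case by (simp add: coin_exp_def Suc algebra_simps)
qed

section \<open>One vertex: stationary product measure and conservation of lines\<close>

definition vtx :: "real \<Rightarrow> real \<Rightarrow> (bool, bool) vertex" where
  "vtx q d v h f = (if v \<noteq> h then f (v, h)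
     else if v then q * f (True, True) + (1 - q) * f (False, False)
     else d * f (True, True) + (1 - d) * f (False, False))"

lemma vtx_simps:
  "vtx q d True True f = q * f (True, True) + (1 - q) * f (False, False)"
  "vtx q d False False f = d * f (True, True) + (1 - d) * f (False, False)"
  "vtx q d True False f = f (True, False)"
  "vtx q d False True f = f (False, True)"
  by (simp_all add: vtx_def)

text \<open>A vertex only exchanges the state of two lines with the state of none, so the product
  measure is invariant as soon as the flow between these two states balances.\<close>

lemma vtx_stationary:
  assumes "a * b * (1 - q) = (1 - a) * (1 - b) * d"
  shows "coin_exp a (\<lambda>v. coin_exp b (\<lambda>h. vtx q d v h f)) =
    coin_exp a (\<lambda>v. coin_exp b (\<lambda>h. f (v, h)))"
proof -
  have "coin_exp a (\<lambda>v. coin_exp b (\<lambda>h. vtx q d v h f)) -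
      coin_exp a (\<lambda>v. coin_exp b (\<lambda>h. f (v, h))) =
      (f (True, True) - f (False, False)) * ((1 - a) * (1 - b) * d - a * b * (1 - q))"
    by (simp add: coin_exp_def vtx_def algebra_simps)
  then show ?thesis using assms by simp
qed

lemma vtx_sym: "vtx q d v h f = vtx q d h v (\<lambda>(b, a). f (a, b))"
  by (auto simp: vtx_def)

context
  fixes q d :: real
  assumes q: "0 \<le> q" "q \<le> 1" and d: "0 \<le> d" "d \<le> 1"
begin

lemma fexp_vtx: "fexp (vtx q d v h)"
  unfolding vtx_def using q d by (cases v; cases h) (simp_all add: fexp_mix fexp_ret)

text \<open>A Burke property: the two lines leaving the first vertex are again independent with the
  old parameters, so the upper one can be set aside while the right one enters the rest of the row
  like a fresh source.\<close>

lemma sweep_row_stationary: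
  assumes ab: "0 \<le> a" "a \<le> 1" "0 \<le> b" "b \<le> 1" and
    bal: "a * b * (1 - q) = (1 - a) * (1 - b) * d"
  shows "bits_exp a m (\<lambda>vs. coin_exp b (\<lambda>h. sweep_row (vtx q d) h vs f)) =
    bits_exp a m (\<lambda>vs. coin_exp b (\<lambda>h. f (h, vs)))"
proof (induction m arbitrary: f)
  case 0
  then show ?case by simp
next
  case (Suc m)
  note fa = fexp_bits[OF ab(1,2), of m] and fb = fexp_coin[OF ab(3,4)]
  have 1: "bits_exp a m (\<lambda>vs. coin_exp b (\<lambda>h. sweep_row (vtx q d) h (v # vs) f)) =
      coin_exp b (\<lambda>h. vtx q d v h (\<lambda>x. bits_exp a m (\<lambda>vs.
        sweep_row (vtx q d) (snd x) vs (\<lambda>y. f (fst y, fst x # snd y)))))" for v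
    by (simp add: case_prod_beta' fexp_commute[OF fa fb] fexp_commute[OF fa fexp_vtx])
  have 2: "coin_exp b (\<lambda>h. bits_exp a m (\<lambda>vs.
        sweep_row (vtx q d) h vs (\<lambda>y. f (fst y, v # snd y)))) =
      bits_exp a m (\<lambda>vs. coin_exp b (\<lambda>h. f (h, v # vs)))" for v
    using Suc.IH[of "\<lambda>y. f (fst y, v # snd y)"] by (simp add: fexp_commute[OF fb fa])
  show ?case
    using vtx_stationary[OF bal, of "\<lambda>x. bits_exp a m (\<lambda>vs.
        sweep_row (vtx q d) (snd x) vs (\<lambda>y. f (fst y, fst x # snd y)))"]
    by (simp only: bits_exp.simps 1 2 fst_conv snd_conv)
qed

lemma sweep_stationary:
  assumes ab: "0 \<le> a" "a \<le> 1" "0 \<le> b" "b \<le> 1" and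
    bal: "a * b * (1 - q) = (1 - a) * (1 - b) * d"
  shows "bits_exp a m (\<lambda>vs. bits_exp b n (\<lambda>hs. sweep (vtx q d) hs vs f)) =
    bits_exp a m (\<lambda>vs. bits_exp b n (\<lambda>hs. f (hs, vs)))"
proof (induction n arbitrary: f)
  case 0
  then show ?case by simp
next
  case (Suc n)
  note fa = fexp_bits[OF ab(1,2), of m] and fb = fexp_coin[OF ab(3,4)]
    and fn = fexp_bits[OF ab(3,4), of n] and fr = fexp_sweep_row[of "vtx q d", OF fexp_vtx]
  have "bits_exp a m (\<lambda>vs. bits_exp b (Suc n) (\<lambda>hs. sweep (vtx q d) hs vs f)) =
      bits_exp a m (\<lambda>vs. coin_exp b (\<lambda>h. sweep_row (vtx q d) h vs (\<lambda>x.
        bits_exp b n (\<lambda>hs. sweep (vtx q d) hs (snd x) (\<lambda>y. f (fst x # fst y, snd y))))))"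
    by (simp add: case_prod_beta' fexp_commute[OF fn fr])
  also have "\<dots> = coin_exp b (\<lambda>h. bits_exp a m (\<lambda>vs.
        bits_exp b n (\<lambda>hs. sweep (vtx q d) hs vs (\<lambda>y. f (h # fst y, snd y)))))"
    by (simp add: sweep_row_stationary[OF ab bal] fexp_commute[OF fa fb])
  also have "\<dots> = bits_exp a m (\<lambda>vs. bits_exp b (Suc n) (\<lambda>hs. f (hs, vs)))"
    by (simp add: Suc.IH fexp_commute[OF fa fb])
  finally show ?case .
qed

text \<open>Each vertex changes its vertical and its horizontal line by the same amount. A
  functional does not display its support; this form of the conservation law supplies what is needed
  of it, and the sums avoid subtraction of natural numbers.\<close>

lemma sweep_row_cong:
  assumes "\<And>h' vs'. ones vs + of_bool h' = ones vs' + of_bool h \<Longrightarrow>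
      f (h', vs') = g (h', vs')"
  shows "sweep_row (vtx q d) h vs f = sweep_row (vtx q d) h vs g"
  using assms
proof (induction vs arbitrary: h f g)
  case Nil
  then show ?case by simp
next
  case (Cons v vs)
  have *: "sweep_row (vtx q d) h' vs (\<lambda>(h'', vs'). f (h'', v' # vs')) =
      sweep_row (vtx q d) h' vs (\<lambda>(h'', vs'). g (h'', v' # vs'))"
    if "of_bool v + of_bool h' = (of_bool v' + of_bool h :: nat)" for v' h'
  proof (rule Cons.IH)
    fix h'' vs'
    assume *: "ones vs + of_bool h'' = ones vs' + of_bool h'"
    have "ones (v # vs) = of_bool v + ones vs"
      "ones (v' # vs') = of_bool v' + ones vs'"
      by simp_all
    with * that have "f (h'', v' # vs') = g (h'', v' # vs')"
      by (intro Cons.prems) linarith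
    then show "(case (h'', vs') of (h'', vs') \<Rightarrow> f (h'', v' # vs')) =
        (case (h'', vs') of (h'', vs') \<Rightarrow> g (h'', v' # vs'))" by simp
  qed
  show ?case
    by (cases v; cases h) (simp_all add: vtx_simps *)
qed

lemma sweep_cong:
  assumes "\<And>hs' vs'. length hs' = length hs \<Longrightarrow> ones vs + ones hs' =
      ones vs' + ones hs \<Longrightarrow> f (hs', vs') = g (hs', vs')"
  shows "sweep (vtx q d) hs vs f = sweep (vtx q d) hs vs g"
  using assms
proof (induction hs arbitrary: vs f g)
  case Nil
  then show ?case by simp
next
  case (Cons h hs)
  show ?case unfolding sweep.simps
  proof (rule sweep_row_cong, unfold prod.case, rule Cons.IH, unfold prod.case, rule Cons.prems)
    fix h' vs' hs' vs''
    have "ones (h # hs) = of_bool h + ones hs"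
      "ones (h' # hs') = of_bool h' + ones hs'"
      by simp_all
    moreover assume "ones vs + of_bool h' = ones vs' + of_bool h"
      "ones vs' + ones hs' = ones vs'' + ones hs"
    ultimately show "ones vs + ones (h' # hs') =
        ones vs'' + ones (h # hs)" by linarith
  qed simp
qed

lemma sweep_conservation:
  fixes z :: real
  shows "z ^ ones vs * sweep (vtx q d) hs vs (\<lambda>(hs', vs'). z ^ ones hs') =
    z ^ ones hs * sweep (vtx q d) hs vs (\<lambda>(hs', vs'). z ^ ones vs')"
  unfolding fexp_cmult[OF fexp_sweep[of "vtx q d", OF fexp_vtx], symmetric]
  by (rule sweep_cong) (simp add: power_add[symmetric] add.commute)

end

section \<open>Coupling of two systems and a third one between them\<close>

text \<open>
  Two coupled systems, the upper one having more vertical and fewer horizontal lines than the lower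
  one. A \<open>Single\<close> vertical line exists only in the upper system, a \<open>Single\<close> horizontal line only in
  the lower one.
\<close>

datatype cls = Absent | Both | Single

text \<open>Both systems use the same coins as far as possible. When a shared line dies in one
  system only, it survives in the other as a \<open>Single\<close> line, and the
  \<open>Single\<close> line that it met is used up: the discrepancy turns into the other direction.
  In every case the number of \<open>Single\<close> lines is preserved.\<close>

fun tvtx :: "real \<Rightarrow> real \<Rightarrow> (cls, cls) vertex" where
  "tvtx q d Absent Absent = (\<lambda>f. d * f (Both, Both) + (1 - d) * f (Absent, Absent))"
| "tvtx q d Both Both = (\<lambda>f. q * f (Both, Both) + (1 - q) * f (Absent, Absent))"
| "tvtx q d Both Absent = (\<lambda>f. f (Both, Absent))"
| "tvtx q d Absent Both = (\<lambda>f. f (Absent, Both))"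
| "tvtx q d Both Single = (\<lambda>f. q * f (Both, Single) + (1 - q) * f (Single, Absent))"
| "tvtx q d Single Both = (\<lambda>f. q * f (Single, Both) + (1 - q) * f (Absent, Single))"
| "tvtx q d Absent Single = (\<lambda>f. d * f (Single, Both) + (1 - d) * f (Absent, Single))"
| "tvtx q d Single Absent = (\<lambda>f. d * f (Both, Single) + (1 - d) * f (Single, Absent))"
| "tvtx q d Single Single = (\<lambda>f. f (Single, Single))"

abbreviation is_both :: "cls \<Rightarrow> bool" where "is_both c \<equiv> c = Both"
abbreviation present :: "cls \<Rightarrow> bool" where "present c \<equiv> c \<noteq> Absent"

lemma tvtx_lower:
  "tvtx q d v h (\<lambda>(v', h'). g (is_both v', present h')) = vtx q d (is_both v) (present h) g"
  by (cases v; cases h) (simp_all add: vtx_def algebra_simps)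

lemma tvtx_upper:
  "tvtx q d v h (\<lambda>(v', h'). g (present v', is_both h')) = vtx q d (present v) (is_both h) g"
  by (cases v; cases h) (simp_all add: vtx_def algebra_simps)

lemmas sweep_lower = sweep_project[where vt = "tvtx q d" and vt' = "vtx q d" and pv = is_both
    and ph = present for q d, OF tvtx_lower]
lemmas sweep_upper = sweep_project[where vt = "tvtx q d" and vt' = "vtx q d" and pv = present
    and ph = is_both for q d, OF tvtx_upper]

text \<open>
  A third system between the two, sampled along a down-right path read from its lower right end.
  The flag says whether the height of the third system still exceeds that of the lower one by one;
  at each \<open>Single\<close> line it is cleared with probability \<open>1 - Q\<close>, and everywhere else the third system
  has the lines of the lower one.
\<close>

definition scan_v :: "real \<Rightarrow> cls \<Rightarrow> bool \<Rightarrow> (bool \<times> bool \<Rightarrow> real) \<Rightarrow> real" where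
  "scan_v Q v e f = (case v of Absent \<Rightarrow> f (e, False) | Both \<Rightarrow> f (e, True)
     | Single \<Rightarrow> if e then Q * f (True, False) + (1 - Q) * f (False, True) else f (False, False))"

definition scan_h :: "real \<Rightarrow> cls \<Rightarrow> bool \<Rightarrow> (bool \<times> bool \<Rightarrow> real) \<Rightarrow> real" where
  "scan_h Q h e f = (case h of Absent \<Rightarrow> f (e, False) | Both \<Rightarrow> f (e, True)
     | Single \<Rightarrow> if e then Q * f (True, True) + (1 - Q) * f (False, False) else f (False, True))"

text \<open>The path is read from its lower right end: horizontal sides from the last entry of the
  list, vertical sides from the first. Hence the recursion comes before the head here, and after it
  in \<open>scan_hs\<close>.\<close>

fun scan_vs :: "real \<Rightarrow> cls list \<Rightarrow> bool \<Rightarrow> (bool \<times> bool list \<Rightarrow> real) \<Rightarrow> real" where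
  "scan_vs Q [] e f = f (e, [])"
| "scan_vs Q (v # vs) e f = scan_vs Q vs e (\<lambda>(e', l). scan_v Q v e' (\<lambda>(e'', b). f (e'', b # l)))"

fun scan_hs :: "real \<Rightarrow> cls list \<Rightarrow> bool \<Rightarrow> (bool \<times> bool list \<Rightarrow> real) \<Rightarrow> real" where
  "scan_hs Q [] e f = f (e, [])"
| "scan_hs Q (h # hs) e f = scan_h Q h e (\<lambda>(e', b). scan_hs Q hs e' (\<lambda>(e'', l). f (e'', b # l)))"

text \<open>
  Sampling the third system and then applying its own dynamics is the same as applying the coupled
  dynamics and sampling afterwards. All cases are immediate except that of two \<open>Single\<close> lines, which
  ignore each other in the coupled dynamics but may meet in the third system; it requires
  \<open>q + Q d = Q\<close>.
\<close>

lemma scan_vertex: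
  assumes "Q * (1 - d) = q"
  shows "scan_v Q V e (\<lambda>(e', v). scan_h Q H e' (\<lambda>(e'', h). vtx q d v h (\<lambda>(v', h'). f e'' v' h'))) =
    tvtx q d V H (\<lambda>(V', H'). scan_h Q H' e (\<lambda>(e', h'). scan_v Q V' e' (\<lambda>(e'', v'). f e'' v' h')))"
  unfolding assms[symmetric]
  by (cases V; cases H; cases e) (simp_all add: scan_v_def scan_h_def vtx_def algebra_simps)

context
  fixes q d Q :: real
  assumes q: "0 \<le> q" "q \<le> 1" and d: "0 \<le> d" "d \<le> 1" and Q: "0 \<le> Q" "Q \<le> 1"
    and Qd: "Q * (1 - d) = q"
begin

lemma fexp_tvtx: "fexp (tvtx q d v h)"
  using q d by (cases v; cases h) (simp_all add: fexp_mix fexp_ret)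

lemma fexp_scan_v: "fexp (scan_v Q v e)"
  unfolding scan_v_def using Q by (cases v; cases e) (simp_all add: fexp_mix fexp_ret)

lemma fexp_scan_h: "fexp (scan_h Q v e)"
  unfolding scan_h_def using Q by (cases v; cases e) (simp_all add: fexp_mix fexp_ret)

lemma fexp_scan_vs: "fexp (scan_vs Q vs e)"
proof (induction vs arbitrary: e)
  case Nil
  then show ?case by (simp add: fexp_ret)
next
  case (Cons v vs)
  have "fexp (\<lambda>f. scan_vs Q vs e (\<lambda>x. (\<lambda>f. scan_v Q v (fst x) (\<lambda>y. f (fst y, snd y # snd x))) f))"
    by (rule fexp_bind[OF Cons]) (rule fexp_map[OF fexp_scan_v])
  then show ?case by (simp add: case_prod_beta')
qed

lemma fexp_scan_hs: "fexp (scan_hs Q hs e)"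
proof (induction hs arbitrary: e)
  case Nil
  then show ?case by (simp add: fexp_ret)
next
  case (Cons h hs)
  have "fexp (\<lambda>f. scan_h Q h e (\<lambda>x. (\<lambda>f. scan_hs Q hs (fst x) (\<lambda>y. f (fst y, snd x # snd y))) f))"
    by (rule fexp_bind[OF fexp_scan_h]) (rule fexp_map[OF Cons])
  then show ?case by (simp add: case_prod_beta')
qed

lemmas fexps = fexp_scan_v fexp_scan_h fexp_scan_vs fexp_scan_hs fexp_tvtx fexp_vtx[OF q d]
  fexp_sweep_row[of "vtx q d", OF fexp_vtx[OF q d]] fexp_sweep_row[of "tvtx q d", OF fexp_tvtx]
  fexp_sweep[of "vtx q d", OF fexp_vtx[OF q d]] fexp_sweep[of "tvtx q d", OF fexp_tvtx]

text \<open>\<open>scan_vertex\<close> moves the scanned path across one cell. Repeated along the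
  row it moves the path across the whole row; all other steps commute independent draws.\<close>

lemma scan_sweep_row:
  "scan_vs Q Vs e (\<lambda>(e1, vs). scan_h Q H e1 (\<lambda>(e2, h).
      sweep_row (vtx q d) h vs (\<lambda>(h', vs'). f e2 h' vs'))) =
    sweep_row (tvtx q d) H Vs (\<lambda>(H', Vs'). scan_h Q H' e (\<lambda>(e1, h').
      scan_vs Q Vs' e1 (\<lambda>(e2, vs'). f e2 h' vs')))"
proof (induction Vs arbitrary: H f)
  case Nil
  then show ?case by (simp add: case_prod_beta')
next
  case (Cons V Vs)
  have "scan_vs Q (V # Vs) e (\<lambda>(e1, vs). scan_h Q H e1 (\<lambda>(e2, h).
      sweep_row (vtx q d) h vs (\<lambda>(h', vs'). f e2 h' vs'))) =
    scan_vs Q Vs e (\<lambda>(e1, vs). scan_v Q V e1 (\<lambda>(e2, v). scan_h Q H e2 (\<lambda>(e3, h).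
      vtx q d v h (\<lambda>(v', h'). sweep_row (vtx q d) h' vs
        (\<lambda>(h'', vs''). f e3 h'' (v' # vs''))))))"
    by (simp add: case_prod_beta')
  also have "\<dots> = scan_vs Q Vs e (\<lambda>(e1, vs). tvtx q d V H (\<lambda>(V', H'). scan_h Q H' e1 (\<lambda>(e2, h').
      scan_v Q V' e2 (\<lambda>(e3, v'). sweep_row (vtx q d) h' vs (\<lambda>(h'', vs''). f e3 h'' (v' # vs''))))))"
    by (subst scan_vertex[OF Qd]) (rule refl)
  also have "\<dots> = tvtx q d V H (\<lambda>(V', H'). scan_vs Q Vs e (\<lambda>(e1, vs). scan_h Q H' e1 (\<lambda>(e2, h').
      sweep_row (vtx q d) h' vs (\<lambda>(h'', vs''). scan_v Q V' e2 (\<lambda>(e3, v').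
        f e3 h'' (v' # vs''))))))"
    unfolding case_prod_beta'
    by (subst fexp_commute[OF fexp_scan_vs fexp_tvtx], subst fexp_commute[OF fexp_scan_v fexps(7)])
      (rule refl)
  also have "\<dots> = tvtx q d V H (\<lambda>(V', H'). sweep_row (tvtx q d) H' Vs (\<lambda>(H'', Vs'). scan_h Q H'' e
      (\<lambda>(e1, h'). scan_vs Q Vs' e1 (\<lambda>(e2, vs'). scan_v Q V' e2 (\<lambda>(e3, v'). f e3 h' (v' # vs'))))))"
    by (subst Cons.IH) (rule refl)
  also have "\<dots> = sweep_row (tvtx q d) H (V # Vs) (\<lambda>(H', Vs'). scan_h Q H' e (\<lambda>(e1, h').
      scan_vs Q Vs' e1 (\<lambda>(e2, vs'). f e2 h' vs')))"
    by (simp add: case_prod_beta')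
  finally show ?case .
qed

lemma scan_sweep:
  "scan_vs Q Vs e (\<lambda>(e1, vs). scan_hs Q Hs e1 (\<lambda>(e2, hs).
      sweep (vtx q d) hs vs (\<lambda>(hs', vs'). f e2 hs' vs'))) =
    sweep (tvtx q d) Hs Vs (\<lambda>(Hs', Vs'). scan_hs Q Hs' e (\<lambda>(e1, hs').
      scan_vs Q Vs' e1 (\<lambda>(e2, vs'). f e2 hs' vs')))"
proof (induction Hs arbitrary: Vs e f)
  case Nil
  then show ?case by (simp add: case_prod_beta')
next
  case (Cons H Hs)
  have "scan_vs Q Vs e (\<lambda>(e1, vs). scan_hs Q (H # Hs) e1 (\<lambda>(e2, hs).
      sweep (vtx q d) hs vs (\<lambda>(hs', vs'). f e2 hs' vs'))) =
    scan_vs Q Vs e (\<lambda>(e1, vs). scan_h Q H e1 (\<lambda>(e2, h). scan_hs Q Hs e2 (\<lambda>(e3, hs).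
      sweep_row (vtx q d) h vs (\<lambda>(h', vs').
        sweep (vtx q d) hs vs' (\<lambda>(hs', vs''). f e3 (h' # hs') vs'')))))"
    by (simp add: case_prod_beta')
  also have "\<dots> = scan_vs Q Vs e (\<lambda>(e1, vs). scan_h Q H e1 (\<lambda>(e2, h). sweep_row (vtx q d) h vs (\<lambda>(h', vs').
      scan_hs Q Hs e2 (\<lambda>(e3, hs). sweep (vtx q d) hs vs' (\<lambda>(hs', vs''). f e3 (h' # hs') vs'')))))"
    unfolding case_prod_beta'
    by (subst fexp_commute[OF fexp_scan_hs fexps(7)]) (rule refl)
  also have "\<dots> = sweep_row (tvtx q d) H Vs (\<lambda>(H', Vs'). scan_h Q H' e (\<lambda>(e1, h').
      scan_vs Q Vs' e1 (\<lambda>(e2, vs'). scan_hs Q Hs e2 (\<lambda>(e3, hs). sweep (vtx q d) hs vs'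
        (\<lambda>(hs', vs''). f e3 (h' # hs') vs'')))))"
    by (rule scan_sweep_row)
  also have "\<dots> = sweep_row (tvtx q d) H Vs (\<lambda>(H', Vs'). scan_h Q H' e (\<lambda>(e1, h').
      sweep (tvtx q d) Hs Vs' (\<lambda>(Hs', Vs''). scan_hs Q Hs' e1 (\<lambda>(e2, hs').
        scan_vs Q Vs'' e2 (\<lambda>(e3, vs'). f e3 (h' # hs') vs')))))"
    by (subst Cons.IH) (rule refl)
  also have "\<dots> = sweep_row (tvtx q d) H Vs (\<lambda>(H', Vs'). sweep (tvtx q d) Hs Vs' (\<lambda>(Hs', Vs'').
      scan_h Q H' e (\<lambda>(e1, h'). scan_hs Q Hs' e1 (\<lambda>(e2, hs').
        scan_vs Q Vs'' e2 (\<lambda>(e3, vs'). f e3 (h' # hs') vs')))))"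
    unfolding case_prod_beta'
    by (subst fexp_commute[OF fexp_scan_h fexps(10)]) (rule refl)
  also have "\<dots> = sweep (tvtx q d) (H # Hs) Vs (\<lambda>(Hs', Vs'). scan_hs Q Hs' e (\<lambda>(e1, hs').
      scan_vs Q Vs' e1 (\<lambda>(e2, vs'). f e2 hs' vs')))"
    by (simp add: case_prod_beta')
  finally show ?case .
qed

end

section \<open>Source bounds\<close>

definition exit_weight :: "real \<Rightarrow> bool list \<times> bool list \<Rightarrow> real" where
  "exit_weight z = (\<lambda>(hs, vs). z ^ ones hs)"

definition droplet :: "real \<Rightarrow> real \<Rightarrow> real \<Rightarrow> nat \<Rightarrow> nat \<Rightarrow> real" where
  "droplet q d z m n = sweep (vtx q d) (falses n) (falses m) (exit_weight z)"

lemma scan_vs_Absent: "scan_vs Q (replicate k Absent) e f = f (e, falses k)"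
  by (induction k arbitrary: f) (simp_all add: scan_v_def)

abbreviation single_of :: "bool \<Rightarrow> cls" where "single_of b \<equiv> if b then Single else Absent"
abbreviation both_of :: "bool \<Rightarrow> cls" where "both_of b \<equiv> if b then Both else Absent"

lemma scan_hs_False: "scan_hs Q Hs False f = f (False, map present Hs)"
proof (induction Hs arbitrary: f)
  case (Cons H Hs)
  then show ?case by (cases H) (simp_all add: scan_h_def)
qed simp

lemma map_single_of:
  "map present (map single_of hs) = hs" "map is_both (map single_of hs) = falses (length hs)"
  by (induction hs) auto

lemma map_both_of:
  "map present (map both_of hs) = hs" "map is_both (map both_of hs) = hs"
  by (induction hs) auto

lemma count_list_cls:
  "ones (map present Hs) = count_list Hs Both + count_list Hs Single"
  "ones (map is_both Hs) = count_list Hs Both"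
proof (induction Hs)
  case (Cons a Hs)
  case 1 with Cons show ?case by (cases a) auto
  case 2 with Cons show ?case by (cases a) auto
qed simp_all

lemma count_list_replicate_False [simp]: "ones (falses n) = 0"
  by (induction n) auto

text \<open>The flag survives all the \<open>Single\<close> lines with probability
  \<open>Q ^ count_list Hs Single\<close>, and then no line is missing; otherwise exactly one is, at
  the place where the flag was cleared.\<close>

lemma scan_hs_weight_True:
  fixes z :: real
  assumes "0 < z" "0 \<le> Q" "Q \<le> 1"
  shows "scan_hs Q Hs True (\<lambda>(e, hs). z ^ ones hs) =
    z ^ (count_list Hs Both + count_list Hs Single) *
      (Q ^ count_list Hs Single + (1 - Q ^ count_list Hs Single) / z)"
proof (induction Hs)
  case (Cons H Hs)
  have lin: "scan_hs Q Hs True (\<lambda>(e, hs). z * z ^ ones hs) =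
    z * scan_hs Q Hs True (\<lambda>(e, hs). z ^ ones hs)"
    using fexp_cmult[OF fexp_scan_hs[of 0 1 Q Hs True], of z "\<lambda>(e, hs). z ^ ones hs"]
      assms by (simp add: case_prod_beta')
  have "Q * (z * (c * (u + (1 - u) / z))) + (1 - Q) * c = z * c * (Q * u + (1 - Q * u) / z)" for c u
    using assms by (simp add: field_simps)
  with Cons lin show ?case
    by (cases H) (simp_all add: scan_h_def scan_hs_False count_list_cls case_prod_beta' mult.assoc)
qed simp

text \<open>The value of \<open>Q\<close> is forced by \<open>scan_vertex\<close>. The condition
  \<open>Q < 1\<close> means \<open>q + d < 1\<close> and holds on fine grids.\<close>

locale grid =
  fixes q d z Q :: real
  assumes q: "0 < q" "q < 1" and d: "0 \<le> d" "d < 1" and z: "1 < z"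
    and Q: "Q < 1" "Q * (1 - d) = q"
begin

lemma Q_nonneg: "0 \<le> Q"
  using Q(2) d q by (metis diff_gt_0_iff_gt less_eq_real_def zero_less_mult_pos2)

lemma q': "0 \<le> q" "q \<le> 1" and d': "0 \<le> d" "d \<le> 1" and Q': "0 \<le> Q" "Q \<le> 1"
  using q d Q Q_nonneg by auto

abbreviation "V \<equiv> vtx q d"
abbreviation "D \<equiv> droplet q d z"
abbreviation "exits hs vs \<equiv> sweep V hs vs (exit_weight z)"

lemmas fs = fexp_sweep[of V, OF fexp_vtx[OF q' d']]
lemmas ft = fexp_sweep[of "tvtx q d", OF fexp_tvtx[OF q' d' Q' Q(2)]]

lemma sweep_mono:
  assumes "\<And>hs' vs'. length hs' = length hs \<Longrightarrow> f (hs', vs') \<le> g (hs', vs')"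
  shows "sweep V hs vs f \<le> sweep V hs vs g"
proof -
  have "sweep V hs vs f = sweep V hs vs (\<lambda>x. if length (fst x) = length hs then f x else g x)"
    by (rule sweep_cong[OF q' d']) simp
  also have "\<dots> \<le> sweep V hs vs g"
    by (rule fexp_mono[OF fs]) (use assms in auto)
  finally show ?thesis .
qed

lemma exit_weight_nonneg: "0 \<le> exit_weight z x"
  using z by (simp add: exit_weight_def split: prod.split)

lemma D_nonneg: "0 \<le> D m n"
  unfolding droplet_def by (intro fexp_nonneg[OF fs] exit_weight_nonneg)

lemma sweep_exit_weight_lower:
  "sweep (tvtx q d) Hs Vs (\<lambda>(Hs', Vs'). z ^ (count_list Hs' Both + count_list Hs' Single)) =
    exits (map present Hs) (map is_both Vs)"
  unfolding sweep_lower[symmetric] by (simp add: exit_weight_def count_list_cls)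

lemma sweep_exit_weight_upper:
  "sweep (tvtx q d) Hs Vs (\<lambda>(Hs', Vs'). z ^ count_list Hs' Both) =
    exits (map is_both Hs) (map present Vs)"
  unfolding sweep_upper[symmetric] by (simp add: exit_weight_def count_list_cls)

text \<open>All lines on the left are declared discrepancies, present in the lower system only. That
  system then has every exit on the right that the upper one has.\<close>

lemma sweep_mono_left:
  "exits (falses (length hs)) vs \<le> exits hs vs"
proof -
  let ?H = "map single_of hs" and ?V = "map both_of vs"
  have "sweep (tvtx q d) ?H ?V (\<lambda>(Hs', Vs'). z ^ count_list Hs' Both) \<le>
    sweep (tvtx q d) ?H ?V (\<lambda>(Hs', Vs'). z ^ (count_list Hs' Both + count_list Hs' Single))"
    using z by (intro fexp_mono[OF ft]) (auto intro!: power_increasing split: prod.split)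
  then show ?thesis
    unfolding sweep_exit_weight_lower sweep_exit_weight_upper map_single_of map_both_of .
qed

text \<open>A cell with a vertical and no horizontal line neither emits nor absorbs, so the line
  runs up its whole column and the remaining columns receive nothing from the left.\<close>

lemma sweep_True_column:
  "sweep V (falses n) (True # vs) (\<lambda>(hs, vs). f hs) =
    sweep V (falses n) vs (\<lambda>(hs, vs). f hs)"
proof (induction n arbitrary: vs f)
  case 0
  then show ?case by simp
next
  case (Suc n)
  show ?case
    using Suc[of _ "\<lambda>hs. f (_ # hs)"] by (simp add: vtx_simps case_prod_beta')
qed

text \<open>
  The upper system has a line in the first column and receives nothing from the left. The scanned
  system either has the source in the first column or lacks at most one of the incoming horizontal
  lines; the latter part is estimated from below by comparison with the case of no line in the
  first column.
\<close>

lemma source_bound: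
  "z * exits hs (True # falses k) \<le>
    (1 + (z - 1) / (1 - Q) * Q ^ M) * exits hs (falses (Suc k)) +
    (z - 1) / (1 - Q) * z ^ M * D k (length hs)"
proof -
  let ?H = "map single_of hs" and ?f = "\<lambda>(e :: bool) hs (vs :: bool list). z ^ ones hs"
  define E1 where "E1 = exits hs (True # falses k)"
  define E0 where "E0 = exits hs (falses (Suc k))"
  define R where "R = scan_hs Q ?H True (\<lambda>(e, hs). exits hs (falses (Suc k)))"
  define W where "W = (\<lambda>(Hs, Vs :: cls list). z ^ (count_list Hs Both + count_list Hs Single) *
      (Q ^ count_list Hs Single + (1 - Q ^ count_list Hs Single) / z))"
  have final: "sweep (tvtx q d) ?H Vs (\<lambda>(Hs', Vs'). scan_hs Q Hs' True (\<lambda>(e1, hs').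
      scan_vs Q Vs' e1 (\<lambda>(e2, vs'). z ^ ones hs'))) = sweep (tvtx q d) ?H Vs W" for Vs
    using z Q' by (simp add: W_def case_prod_beta' fexp_const[OF fexp_scan_vs[OF q' d' Q' Q(2)]]
      scan_hs_weight_True[unfolded case_prod_beta'])
  \<comment> \<open>The flag is still set at the first column. With probability \<open>1 - Q\<close>
    the line is sampled there, the flag is cleared and all of \<open>hs\<close> enters, which gives
    \<open>E1\<close>. Otherwise the column stays empty and the flag goes on to \<open>hs\<close>,
    which gives \<open>R\<close>.\<close>
  have A: "(1 - Q) * E1 + Q * R = sweep (tvtx q d) ?H (Single # replicate k Absent) W"
    unfolding final[symmetric] scan_sweep[OF q' d' Q' Q(2), of _ _ _ ?f, symmetric]
    by (simp add: scan_vs_Absent scan_v_def scan_hs_False map_single_of E1_def R_def exit_weight_def del: map_map)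
  have B: "R = sweep (tvtx q d) ?H (replicate (Suc k) Absent) W"
    unfolding final[symmetric] scan_sweep[OF q' d' Q' Q(2), of _ _ _ ?f, symmetric] scan_vs_Absent
    by (simp add: R_def exit_weight_def)
  have low: "sweep (tvtx q d) ?H Vs (\<lambda>(Hs', Vs'). z ^ (count_list Hs' Both + count_list Hs' Single)) = E0"
    if "Vs = Single # replicate k Absent \<or> Vs = replicate (Suc k) Absent" for Vs
    unfolding sweep_exit_weight_lower map_single_of E0_def using that by auto
  \<comment> \<open>In the upper system the line fills the first column and nothing enters from the
    left, which leaves a droplet in the other \<open>k\<close> columns.\<close>
  have up: "sweep (tvtx q d) ?H (Single # replicate k Absent) (\<lambda>(Hs', Vs'). z ^ count_list Hs' Both) = D k (length hs)"
    unfolding sweep_exit_weight_upper map_single_of droplet_def exit_weight_def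
    using sweep_True_column[of "length hs" "falses k" "\<lambda>hs. z ^ ones hs"] by simp
  have Qp: "0 \<le> Q ^ s" "Q ^ s \<le> 1" for s using Q' by (auto simp: power_le_one)
  \<comment> \<open>The scanned system lacks at most one exit of the lower one, at the cost of at
    most one factor \<open>z\<close>.\<close>
  have "E0 \<le> z * R"
  proof -
    have "E0 \<le> sweep (tvtx q d) ?H (replicate (Suc k) Absent) (\<lambda>x. z * W x)"
      unfolding low[OF disjI2[OF refl], symmetric]
    proof (rule fexp_mono[OF ft], clarify)
      fix Hs' Vs'
      have "1 \<le> z * (Q ^ count_list Hs' Single + (1 - Q ^ count_list Hs' Single) / z)"
        using z Qp[of "count_list Hs' Single"] mult_right_mono[of 1 z "Q ^ count_list Hs' Single"]
        by (simp add: field_simps)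
      then show "z ^ (count_list Hs' Both + count_list Hs' Single) \<le> z * W (Hs', Vs')"
        unfolding W_def using z mult_left_mono[of 1 "z * (Q ^ count_list Hs' Single + (1 - Q ^ count_list Hs' Single) / z)"
           "z ^ (count_list Hs' Both + count_list Hs' Single)"] by (simp add: mult_ac)
    qed
    then show ?thesis by (simp add: B fexp_cmult[OF ft])
  qed
  moreover have "z * sweep (tvtx q d) ?H (Single # replicate k Absent) W \<le>
      (1 + (z - 1) * Q ^ M) * E0 + (z - 1) * z ^ M * D k (length hs)"
  proof -
    have "sweep (tvtx q d) ?H (Single # replicate k Absent) (\<lambda>x. z * W x) \<le>
      sweep (tvtx q d) ?H (Single # replicate k Absent) (\<lambda>x.
        (1 + (z - 1) * Q ^ M) * (case x of (Hs', Vs') \<Rightarrow> z ^ (count_list Hs' Both + count_list Hs' Single)) +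
        (z - 1) * z ^ M * (case x of (Hs', Vs') \<Rightarrow> z ^ count_list Hs' Both))"
    proof (rule fexp_mono[OF ft], unfold split_paired_all prod.case)
      fix Hs' :: "cls list" and Vs' :: "cls list"
      define b where "b = count_list Hs' Both"
      define s where "s = count_list Hs' Single"
      \<comment> \<open>The number \<open>s\<close> of \<open>Single\<close> exits is the difference
        of the two heights. If \<open>s\<close> is at least \<open>M\<close>, the source is noticed
        with probability at most \<open>Q ^ M\<close>; otherwise the lower system exceeds the upper
        one by less than the factor \<open>z ^ M\<close>.\<close>
      have "z ^ (b + s) * Q ^ s \<le> Q ^ M * z ^ (b + s) + z ^ M * z ^ b"
      proof (cases "M \<le> s")
        case True
        then have "Q ^ s \<le> Q ^ M" using Q' by (intro power_decreasing) auto
        moreover have "0 \<le> z ^ M * z ^ b" using z by simp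
        ultimately show ?thesis using z
          by (smt (verit) mult.commute mult_right_mono zero_le_power)
      next
        case False
        then have "z ^ (b + s) \<le> z ^ M * z ^ b" using z
          by (simp add: power_add[symmetric])
        moreover have "z ^ (b + s) * Q ^ s \<le> z ^ (b + s)" using z Qp[of s]
          by (simp add: mult_left_le)
        moreover have "0 \<le> Q ^ M * z ^ (b + s)" using z Q' by simp
        ultimately show ?thesis by linarith
      qed
      then have "(z - 1) * (z ^ (b + s) * Q ^ s) \<le> (z - 1) * (Q ^ M * z ^ (b + s) + z ^ M * z ^ b)"
        using z by (intro mult_left_mono) auto
      moreover have "z * W (Hs', Vs') = z ^ (b + s) + (z - 1) * (z ^ (b + s) * Q ^ s)"
        using z by (simp add: W_def b_def[symmetric] s_def[symmetric] field_simps)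
      ultimately show "z * W (Hs', Vs') \<le> (1 + (z - 1) * Q ^ M) * z ^ (count_list Hs' Both + count_list Hs' Single) +
          (z - 1) * z ^ M * z ^ count_list Hs' Both"
        unfolding b_def[symmetric] s_def[symmetric] by (simp add: algebra_simps)
    qed
    also have "\<dots> = (1 + (z - 1) * Q ^ M) * E0 + (z - 1) * z ^ M * D k (length hs)"
      unfolding fexp_add[OF ft] fexp_cmult[OF ft] using up low by simp
    finally show ?thesis by (simp only: fexp_cmult[OF ft])
  qed
  \<comment> \<open>Only \<open>E1\<close> is wanted. Subtracting the lower bound of the
    \<open>R\<close> part leaves \<open>1 - Q\<close> times \<open>E0\<close> in the main term, so
    that division by \<open>1 - Q\<close> gives it a coefficient close to 1.\<close>
  moreover have "z * ((1 - Q) * E1 + Q * R) = (1 - Q) * (z * E1) + Q * (z * R)"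
    by (simp add: algebra_simps)
  moreover have "Q * E0 \<le> Q * (z * R)" using \<open>E0 \<le> z * R\<close> Q' by (rule_tac mult_left_mono)
  ultimately have "(1 - Q) * (z * E1) \<le> (1 - Q) * E0 + (z - 1) * Q ^ M * E0 + (z - 1) * z ^ M * D k (length hs)"
    unfolding A[symmetric] by (simp add: algebra_simps)
  then have "z * E1 \<le> ((1 - Q) * E0 + (z - 1) * Q ^ M * E0 + (z - 1) * z ^ M * D k (length hs)) / (1 - Q)"
    using Q(1) by (simp add: pos_le_divide_eq mult.commute)
  also have "\<dots> = (1 + (z - 1) / (1 - Q) * Q ^ M) * E0 + (z - 1) / (1 - Q) * z ^ M * D k (length hs)"
    using Q(1) by (simp add: add_divide_distrib distrib_right)
  finally show ?thesis unfolding E0_def E1_def .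
qed

text \<open>By conservation, right exits plus lower sources are as many as upper exits plus left
  sources. Reflection in the diagonal then turns the upper exits into right exits.\<close>

lemma weighted_sweep_transpose:
  "z ^ ones vs * exits hs vs =
    z ^ ones hs * exits vs hs"
proof -
  have "z ^ ones vs * exits hs vs =
      z ^ ones hs * sweep V hs vs (\<lambda>(hs', vs'). z ^ ones vs')"
    unfolding exit_weight_def by (rule sweep_conservation[OF q' d'])
  also have "sweep V hs vs (\<lambda>(hs', vs'). z ^ ones vs') = exits vs hs"
    by (subst sweep_transpose[of V V, OF fexp_vtx[OF q' d'] vtx_sym])
      (simp add: exit_weight_def)
  finally show ?thesis .
qed

lemma D_commute: "D m n = D n m"
  using weighted_sweep_transpose[of "falses m" "falses n"] by (simp add: droplet_def)

text \<open>Weighting by the number of lower sources multiplies their odds by \<open>z\<close>, which makes them stationary.\<close>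

lemma two_sided_source:
  assumes a: "0 \<le> a" "a \<le> 1" and b: "0 \<le> b" "b \<le> 1"
    and bal: "z * a * b * (1 - q) = (1 - a) * (1 - b) * d"
  shows "bits_exp a m (\<lambda>vs. bits_exp b n (\<lambda>hs. z ^ ones vs * exits hs vs)) =
    (1 - a + z * a) ^ m * (1 - b + z * b) ^ n"
proof -
  define w where "w = 1 - a + z * a"
  have w: "0 < w" "a * z \<le> w" "1 - z * a / w = (1 - a) / w"
  proof -
    have "w = 1 + (z - 1) * a" by (simp add: w_def algebra_simps)
    moreover have "0 \<le> (z - 1) * a" using z a by simp
    ultimately show "0 < w" by linarith
    then show "1 - z * a / w = (1 - a) / w" by (simp add: w_def field_simps)
  qed (use a in \<open>simp add: w_def mult.commute\<close>)
  have a': "0 \<le> z * a / w" "z * a / w \<le> 1"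
    using w a z by (auto simp: field_simps)
  have bal': "(z * a / w) * b * (1 - q) = (1 - z * a / w) * (1 - b) * d"
    unfolding w(3) using arg_cong[OF bal, of "\<lambda>x. x / w"] by simp
  have "bits_exp a m (\<lambda>vs. bits_exp b n (\<lambda>hs. z ^ ones vs * exits hs vs)) =
    bits_exp a m (\<lambda>vs. z ^ ones vs * bits_exp b n (\<lambda>hs. exits hs vs))"
    by (simp add: fexp_cmult[OF fexp_bits[OF b]])
  also have "\<dots> = w ^ m * bits_exp (z * a / w) m (\<lambda>vs. bits_exp b n (\<lambda>hs. exits hs vs))"
    unfolding w_def by (rule bits_exp_tilt) (use a z w in \<open>auto simp: w_def\<close>)
  also have "\<dots> = w ^ m * bits_exp (z * a / w) m (\<lambda>vs. bits_exp b n (\<lambda>hs. z ^ ones hs))"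
    by (subst sweep_stationary[OF q' d' a' b bal']) (simp add: exit_weight_def)
  also have "\<dots> = w ^ m * (1 - b + z * b) ^ n"
    by (simp add: bits_exp_count[OF b] fexp_const[OF fexp_bits[OF a']])
  finally show ?thesis by (simp add: w_def)
qed

text \<open>Every single configuration of sources dominates the droplet, hence so does their
  average. Lower sources are compared by reflecting them to the left side, which uses up the weight
  \<open>z ^ ones vs\<close>.\<close>

lemma droplet_upper:
  assumes a: "0 \<le> a" "a \<le> 1" and b: "0 \<le> b" "b \<le> 1"
    and bal: "z * a * b * (1 - q) = (1 - a) * (1 - b) * d"
  shows "D m n \<le> (1 - a + z * a) ^ m * (1 - b + z * b) ^ n"
proof -
  have 1: "D m n \<le> z ^ ones vs * exits hs vs"
    if "length hs = n" "length vs = m" for hs vs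
  proof -
    have "D m n \<le> exits vs (falses n)"
      using sweep_mono_left[of vs "falses n"] that(2)
      by (subst D_commute) (simp add: droplet_def)
    also have "\<dots> = z ^ ones vs * exits (falses n) vs"
      using weighted_sweep_transpose[of vs "falses n"] by simp
    also have "\<dots> \<le> z ^ ones vs * exits hs vs"
      using sweep_mono_left[of hs vs] that(1) z by (intro mult_left_mono) auto
    finally show ?thesis .
  qed
  have bits_mono: "c \<le> bits_exp p k f" if "\<And>l. length l = k \<Longrightarrow> c \<le> f l" "0 \<le> p" "p \<le> 1" for c p k f
    using that
  proof (induction k arbitrary: f)
    case (Suc k)
    have "c \<le> bits_exp p k (\<lambda>bs. f (x # bs))" for x
      by (rule Suc.IH) (use Suc.prems in auto)
    from convex_bound_le[of "- bits_exp p k (\<lambda>bs. f (True # bs))" "- c" "- bits_exp p k (\<lambda>bs. f (False # bs))" p "1 - p"] this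
    show ?case using Suc.prems(2,3) by (simp add: coin_exp_def)
  qed simp
  show ?thesis
    unfolding two_sided_source[OF assms, symmetric]
    by (intro bits_mono a b 1)
qed

section \<open>Removal of the sources\<close>

definition sourced :: "real \<Rightarrow> bool list \<Rightarrow> nat \<Rightarrow> nat \<Rightarrow> real" where
  "sourced a hs j k = bits_exp a j (\<lambda>vs. z ^ ones vs *
     exits hs (vs @ falses k))"

text \<open>The rightmost remaining source is removed. The columns before it act only through the
  horizontal lines that they hand on; \<open>source_bound\<close> holds for all of these, and its
  droplet term does not depend on them. The weight of the earlier sources averages to
  \<open>(1 - a + z * a) ^ j\<close>.\<close>

lemma sourced_step:
  fixes M :: nat
  assumes a: "0 \<le> a" "a \<le> 1"
  defines "\<eta> \<equiv> (z - 1) / (1 - Q) * Q ^ M" and "C \<equiv> (z - 1) / (1 - Q) * z ^ M"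
  shows "sourced a hs (Suc j) k \<le>
    (1 + a * \<eta>) * sourced a hs j (Suc k) + a * C * (1 - a + z * a) ^ j * D k (length hs)"
proof -
  have app: "exits hs (vs @ ws) = sweep V hs vs (\<lambda>x. exits (fst x) ws)" for vs ws
    by (subst sweep_append_cols[of V, OF fexp_vtx[OF q' d']])
      (simp add: exit_weight_def case_prod_beta')
  have pt: "z * exits hs (vs @ True # falses k) \<le>
      (1 + \<eta>) * exits hs (vs @ falses (Suc k)) + C * D k (length hs)" for vs
  proof -
    have "z * exits hs (vs @ True # falses k) =
        sweep V hs vs (\<lambda>x. z * exits (fst x) (True # falses k))"
      unfolding app fexp_cmult[OF fs] ..
    also have "\<dots> \<le> sweep V hs vs (\<lambda>x. (1 + \<eta>) * exits (fst x) (falses (Suc k))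
        + C * D k (length hs))"
      by (rule sweep_mono) (metis \<eta>_def C_def source_bound fst_conv)
    also have "\<dots> = (1 + \<eta>) * exits hs (vs @ falses (Suc k)) + C * D k (length hs)"
      unfolding app fexp_add[OF fs] fexp_cmult[OF fs] fexp_const[OF fs] ..
    finally show ?thesis .
  qed
  have "sourced a hs (Suc j) k = bits_exp a j (\<lambda>vs. z ^ ones vs *
      (a * (z * exits hs (vs @ True # falses k)) +
       (1 - a) * exits hs (vs @ falses (Suc k))))"
    unfolding sourced_def bits_exp_snoc[OF a] coin_exp_def by (simp add: algebra_simps)
  also have "\<dots> \<le> bits_exp a j (\<lambda>vs. (1 + a * \<eta>) * (z ^ ones vs *
      exits hs (vs @ falses (Suc k))) +
      a * C * D k (length hs) * z ^ ones vs)"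
  proof (rule fexp_mono[OF fexp_bits[OF a]])
    fix vs
    have "z ^ ones vs * (a * (z * exits hs (vs @ True # falses k))) \<le>
      z ^ ones vs * (a * ((1 + \<eta>) * exits hs (vs @ falses (Suc k)) + C * D k (length hs)))"
      using pt a z by (intro mult_left_mono) auto
    then show "z ^ ones vs *
      (a * (z * exits hs (vs @ True # falses k)) +
       (1 - a) * exits hs (vs @ falses (Suc k))) \<le>
      (1 + a * \<eta>) * (z ^ ones vs * exits hs (vs @ falses (Suc k))) +
      a * C * D k (length hs) * z ^ ones vs"
      by (simp add: algebra_simps)
  qed
  also have "\<dots> = (1 + a * \<eta>) * sourced a hs j (Suc k) + a * C * (1 - a + z * a) ^ j * D k (length hs)"
    unfolding fexp_add[OF fexp_bits[OF a]] fexp_cmult[OF fexp_bits[OF a]] bits_exp_count[OF a] sourced_def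
    by (simp add: algebra_simps)
  finally show ?thesis .
qed

text \<open>A discrete Gronwall inequality; as the ratio is at least 1, its full power may also be
  put in front of the additive terms.\<close>

lemma sourced_bound:
  fixes M :: nat
  assumes a: "0 \<le> a" "a \<le> 1"
  defines "\<eta> \<equiv> (z - 1) / (1 - Q) * Q ^ M" and "C \<equiv> (z - 1) / (1 - Q) * z ^ M"
  shows "j \<le> m \<Longrightarrow> sourced a hs j (m - j) \<le> (1 + a * \<eta>) ^ j *
    (exits hs (falses m) +
     a * C * (\<Sum>i<j. (1 - a + z * a) ^ i * D (m - Suc i) (length hs)))"
proof (induction j)
  case 0
  then show ?case by (simp add: sourced_def)
next
  case (Suc j)
  let ?r = "1 + a * \<eta>" and ?y = "a * C * ((1 - a + z * a) ^ j * D (m - Suc j) (length hs))"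
  let ?S = "exits hs (falses m) +
     a * C * (\<Sum>i<j. (1 - a + z * a) ^ i * D (m - Suc i) (length hs))"
  have pos: "0 \<le> \<eta>" "0 \<le> C" "0 \<le> 1 - a + z * a"
    using z Q' Q(1) a by (auto simp: \<eta>_def C_def)
  then have r: "1 \<le> ?r" using a by simp
  have y: "0 \<le> ?y" using pos a D_nonneg by simp
  have "sourced a hs (Suc j) (m - Suc j) \<le> ?r * sourced a hs j (m - j) + ?y"
    using sourced_step[OF a, of hs j "m - Suc j" M] Suc.prems
    by (simp add: \<eta>_def C_def Suc_diff_Suc mult_ac)
  also have "\<dots> \<le> ?r * (?r ^ j * ?S) + ?r ^ Suc j * ?y"
    using Suc r y mult_right_mono[OF one_le_power[OF r] y, of "Suc j"]
    by (intro add_mono mult_left_mono) auto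
  also have "\<dots> = ?r ^ Suc j * (?S + ?y)" by (simp add: algebra_simps)
  also have "?S + ?y = exits hs (falses m) +
     a * C * (\<Sum>i<Suc j. (1 - a + z * a) ^ i * D (m - Suc i) (length hs))"
    by (simp add: algebra_simps)
  finally show ?case .
qed

text \<open>The sources below are removed first, with those on the left still present. A reflection
  then makes the left sources lower ones, with the right weight, and they are removed in the same
  way; hence the factor 2 and the exponent \<open>2 * n\<close>.\<close>

lemma droplet_lower:
  fixes M n :: nat
  assumes a: "0 \<le> a" "a \<le> 1" and bal: "z * a * a * (1 - q) = (1 - a) * (1 - a) * d"
  defines "\<eta> \<equiv> (z - 1) / (1 - Q) * Q ^ M" and "C \<equiv> (z - 1) / (1 - Q) * z ^ M"
  shows "(1 - a + z * a) ^ (2 * n) \<le> (1 + a * \<eta>) ^ (2 * n) *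
    (D n n + 2 * a * C * (\<Sum>i<n. (1 - a + z * a) ^ i * D (n - Suc i) n))"
proof -
  define T where "T = a * C * (\<Sum>i<n. (1 - a + z * a) ^ i * D (n - Suc i) n)"
  have pos: "0 \<le> \<eta>" "0 \<le> C" "0 \<le> 1 - a + z * a"
    using z Q' Q(1) a by (auto simp: \<eta>_def C_def)
  have T: "0 \<le> T" unfolding T_def using pos a D_nonneg by (intro mult_nonneg_nonneg sum_nonneg) auto
  have r: "1 \<le> (1 + a * \<eta>) ^ n" using pos a by (intro one_le_power) simp
  note fb = fexp_bits[OF a, of n]
  have len: "bits_exp a n f = bits_exp a n g" if "\<And>l. length l = n \<Longrightarrow> f l = g l" for f g
    using that
  proof (induction n arbitrary: f g)
    case (Suc n)
    have "bits_exp a n (\<lambda>bs. f (x # bs)) = bits_exp a n (\<lambda>bs. g (x # bs))" for x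
      by (rule Suc.IH) (use Suc.prems in auto)
    then show ?case by simp
  qed simp
  have "(1 - a + z * a) ^ (2 * n) = bits_exp a n (\<lambda>vs. bits_exp a n (\<lambda>hs. z ^ ones vs *
      exits hs vs))"
    by (subst two_sided_source[OF a a bal]) (simp add: power_add[symmetric] mult_2)
  also have "\<dots> = bits_exp a n (\<lambda>hs. sourced a hs n 0)"
    unfolding sourced_def append_Nil2 replicate.simps by (rule fexp_commute[OF fb fb])
  also have "\<dots> = bits_exp a n (\<lambda>hs. if length hs = n then sourced a hs n 0 else 0)"
    by (rule len) simp
  also have "\<dots> \<le> bits_exp a n (\<lambda>hs. (1 + a * \<eta>) ^ n *
      (exits hs (falses n) + T))"
  proof (rule fexp_mono[OF fb])
    fix hs :: "bool list"
    have "0 \<le> exits hs (falses n)"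
      by (intro fexp_nonneg[OF fs] exit_weight_nonneg)
    then show "(if length hs = n then sourced a hs n 0 else 0) \<le> (1 + a * \<eta>) ^ n *
      (exits hs (falses n) + T)"
      using sourced_bound[OF a order_refl, of hs n M, folded \<eta>_def C_def] T r
      by (auto simp: T_def)
  qed
  also have "\<dots> = (1 + a * \<eta>) ^ n * (bits_exp a n (\<lambda>hs. exits hs (falses n)) + T)"
    by (simp only: fexp_cmult[OF fb] fexp_add[OF fb] fexp_const[OF fb])
  finally have 1: "(1 - a + z * a) ^ (2 * n) \<le> (1 + a * \<eta>) ^ n *
      (bits_exp a n (\<lambda>hs. exits hs (falses n)) + T)" .
  have "bits_exp a n (\<lambda>hs. exits hs (falses n)) =
      sourced a (falses n) n 0"
    using weighted_sweep_transpose[of "falses n"] by (simp add: sourced_def)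
  also have "\<dots> \<le> (1 + a * \<eta>) ^ n * (D n n + T)"
    using sourced_bound[OF a order_refl, of "falses n" n M, folded \<eta>_def C_def]
    by (simp add: T_def droplet_def)
  finally have "bits_exp a n (\<lambda>hs. exits hs (falses n)) + T \<le>
      (1 + a * \<eta>) ^ n * (D n n + T) + T" by simp
  also have "\<dots> \<le> (1 + a * \<eta>) ^ n * (D n n + 2 * T)"
    using mult_right_mono[OF r T] by (simp add: algebra_simps)
  finally have "(1 - a + z * a) ^ (2 * n) \<le> (1 + a * \<eta>) ^ n * ((1 + a * \<eta>) ^ n * (D n n + 2 * T))"
    using r by (intro order_trans[OF 1] mult_left_mono) auto
  then have "(1 - a + z * a) ^ (2 * n) \<le> (1 + a * \<eta>) ^ (2 * n) * (D n n + 2 * T)"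
    by (simp only: mult_2 power_add mult.assoc)
  then show ?thesis by (simp only: T_def mult.assoc)
qed

text \<open>The additional column is put on the left, where it acts on the others as a random
  configuration of left sources.\<close>

lemma D_mono_Suc: "D k n \<le> D (Suc k) n"
proof -
  have "D k n \<le> sweep V (falses n) [False] (\<lambda>x. exits (fst x) (falses k))"
  proof -
    have "D k n = sweep V (falses n) [False] (\<lambda>x. D k n)"
      by (simp only: fexp_const[OF fs])
    also have "\<dots> \<le> sweep V (falses n) [False] (\<lambda>x. exits (fst x) (falses k))"
      by (rule sweep_mono) (use sweep_mono_left in \<open>fastforce simp: droplet_def\<close>)
    finally show ?thesis .
  qed
  also have "\<dots> = D (Suc k) n"
    unfolding droplet_def using sweep_append_cols[of V "falses n" "[False]" "falses k" "exit_weight z", OF fexp_vtx[OF q' d']]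
    by (simp add: exit_weight_def case_prod_beta')
  finally show ?thesis .
qed

lemma D_mono: "k \<le> m \<Longrightarrow> D k n \<le> D m n"
  using lift_Suc_mono_le[of "\<lambda>k. D k n"] D_mono_Suc by blast

end

section \<open>Growth rate\<close>

text \<open>The probability that a cell contains a point. Its sides are \<open>t / n\<close> in the
  coordinates \<open>u\<close> and \<open>v\<close>, hence its area is
  \<open>(t / n)\<^sup>2 / 2\<close>, and the intensity is \<open>2 * (1 - q)\<close>.\<close>

definition cell_prob :: "real \<Rightarrow> real \<Rightarrow> nat \<Rightarrow> real" where
  "cell_prob q t n = 1 - exp (- ((1 - q) * t\<^sup>2 / (real n)\<^sup>2))"

lemma tendsto_one_plus_pow:
  fixes x :: "nat \<Rightarrow> real"
  assumes lim: "(\<lambda>n. real n * x n) \<longlonglongrightarrow> s" and nn: "\<And>n. 0 \<le> x n"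
  shows "(\<lambda>n. (1 + x n) ^ n) \<longlonglongrightarrow> exp s"
proof -
  have x0: "x \<longlonglongrightarrow> 0"
  proof -
    have 1: "(\<lambda>n. real n * x n * inverse (real n)) \<longlonglongrightarrow> s * 0"
      by (intro tendsto_mult lim lim_inverse_n)
    have "eventually (\<lambda>n. real n * x n * inverse (real n) = x n) sequentially"
      using eventually_gt_at_top[of 0] by eventually_elim simp
    from Lim_transform_eventually[OF 1 this] show ?thesis by simp
  qed
  have "(\<lambda>n. real n * ln (1 + x n)) \<longlonglongrightarrow> s"
  proof (rule tendsto_sandwich[OF _ _ _ lim])
    have "(\<lambda>n. real n * x n / (1 + x n)) \<longlonglongrightarrow> s / (1 + 0)"
      by (intro tendsto_divide lim tendsto_add x0 tendsto_const) auto
    then show "(\<lambda>n. real n * x n / (1 + x n)) \<longlonglongrightarrow> s" by simp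
    show "eventually (\<lambda>n. real n * x n / (1 + x n) \<le> real n * ln (1 + x n)) sequentially"
    proof (intro always_eventually allI)
      fix n
      have "ln (1 / (1 + x n)) \<le> 1 / (1 + x n) - 1" using nn[of n] by (intro ln_le_minus_one) auto
      then have "x n / (1 + x n) \<le> ln (1 + x n)"
        using nn[of n] by (simp add: ln_div field_simps)
      then show "real n * x n / (1 + x n) \<le> real n * ln (1 + x n)"
        using mult_left_mono[of "x n / (1 + x n)" "ln (1 + x n)" "real n"] by simp
    qed
    show "eventually (\<lambda>n. real n * ln (1 + x n) \<le> real n * x n) sequentially"
      using nn by (intro always_eventually allI mult_left_mono ln_add_one_self_le_self) auto
  qed
  then have "(\<lambda>n. exp (real n * ln (1 + x n))) \<longlonglongrightarrow> exp s" by (rule tendsto_exp)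
  moreover have "exp (real n * ln (1 + x n)) = (1 + x n) ^ n" for n
    using nn[of n] by (subst exp_of_nat_mult) simp
  ultimately show ?thesis by simp
qed

context
  fixes q z :: real
  assumes q: "0 < q" "q < 1" and z: "1 < z"
begin

text \<open>The symmetric solution of the balance equation \<open>z * a * b = d / (1 - q)\<close>
  for odds.\<close>

definition odds :: "real \<Rightarrow> nat \<Rightarrow> real" where
  "odds t n = sqrt (cell_prob q t n / ((1 - q) * z))"

lemma cell_prob_nonneg: "0 \<le> cell_prob q t n" and cell_prob_less: "cell_prob q t n < 1"
  using q by (auto simp: cell_prob_def)

lemma odds_nonneg: "0 \<le> odds t n"
  using q z cell_prob_nonneg by (simp add: odds_def)

text \<open>The factor \<open>1 - q\<close> of the intensity cancels the one in the balance
  equation.\<close>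

lemma odds_lim:
  assumes "0 < t"
  shows "(\<lambda>n. real n * odds t n) \<longlonglongrightarrow> t / sqrt z"
proof -
  define c where "c = (1 - q) * t\<^sup>2"
  have c: "0 < c" using q assms by (simp add: c_def)
  have "(\<lambda>n. (real n)\<^sup>2 * (1 - exp (- (c / (real n)\<^sup>2)))) \<longlonglongrightarrow> c"
    using c by real_asymp
  then have "(\<lambda>n. sqrt ((real n)\<^sup>2 * (1 - exp (- (c / (real n)\<^sup>2))) / ((1 - q) * z))) \<longlonglongrightarrow> sqrt (c / ((1 - q) * z))"
    using q z by (intro tendsto_real_sqrt tendsto_divide tendsto_const) auto
  moreover have "sqrt (c / ((1 - q) * z)) = t / sqrt z"
    using q assms by (simp add: c_def real_sqrt_divide)
  moreover have "sqrt ((real n)\<^sup>2 * (1 - exp (- (c / (real n)\<^sup>2))) / ((1 - q) * z)) = real n * odds t n" for n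
    by (simp add: odds_def cell_prob_def c_def real_sqrt_mult real_sqrt_divide)
  ultimately show ?thesis by simp
qed

text \<open>The factor \<open>1 - a + z * a\<close> that one source position contributes to
  \<open>two_sided_source\<close>, in terms of the odds \<open>l * odds t n\<close>.\<close>

definition tilt :: "real \<Rightarrow> real \<Rightarrow> nat \<Rightarrow> real" where
  "tilt l t n = (1 + z * (l * odds t n)) / (1 + l * odds t n)"

lemma tilt_eq:
  fixes l t :: real and n :: nat
  assumes "0 \<le> l"
  defines "a \<equiv> l * odds t n / (1 + l * odds t n)"
  shows "0 \<le> a" "a \<le> 1" "1 - a + z * a = tilt l t n" "a \<le> l * odds t n"
proof -
  have o: "0 \<le> l * odds t n" using assms odds_nonneg by simp
  show "0 \<le> a" "a \<le> 1" "1 - a + z * a = tilt l t n"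
    using o by (auto simp: a_def tilt_def field_simps)
  show "a \<le> l * odds t n"
    using o mult_left_mono[of 1 "1 + l * odds t n" "l * odds t n"] by (simp add: a_def field_simps)
qed

lemma tilt_ge_1: "0 \<le> l \<Longrightarrow> 1 \<le> tilt l t n"
  using z odds_nonneg[of t n] mult_right_mono[of 1 z "l * odds t n"]
  by (simp add: tilt_def pos_le_divide_eq add_pos_nonneg)

lemma tilt_mono: "0 \<le> l \<Longrightarrow> l \<le> k \<Longrightarrow> tilt l t n \<le> tilt k t n"
proof -
  assume l: "0 \<le> l" "l \<le> k"
  then have o: "0 \<le> l * odds t n" "l * odds t n \<le> k * odds t n"
    using odds_nonneg[of t n] by (auto intro: mult_right_mono)
  have "tilt x t n = z - (z - 1) / (1 + x * odds t n)" if "0 \<le> x * odds t n" for x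
    using that by (simp add: tilt_def field_simps)
  moreover have "(z - 1) / (1 + k * odds t n) \<le> (z - 1) / (1 + l * odds t n)"
    using o z by (intro divide_left_mono mult_pos_pos) auto
  ultimately show ?thesis using o by simp
qed

definition speed :: real where
  "speed = (z - 1) / sqrt z"

lemma tilt_lim:
  assumes "0 < t" "0 \<le> l"
  shows "(\<lambda>n. tilt l t n ^ n) \<longlonglongrightarrow> exp (l * (speed * t))"
proof -
  have o: "(\<lambda>n. real n * (x * odds t n)) \<longlonglongrightarrow> x * (t / sqrt z)" for x
    using tendsto_mult[OF tendsto_const[of x] odds_lim[OF assms(1)]] by (simp add: mult_ac)
  have "(\<lambda>n. (1 + z * l * odds t n) ^ n / (1 + l * odds t n) ^ n) \<longlonglongrightarrow>
      exp (z * l * (t / sqrt z)) / exp (l * (t / sqrt z))"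
    using assms z odds_nonneg
    by (intro tendsto_divide tendsto_one_plus_pow o) auto
  also have "exp (z * l * (t / sqrt z)) / exp (l * (t / sqrt z)) = exp (l * (speed * t))"
    by (simp add: speed_def exp_diff[symmetric] left_diff_distrib right_diff_distrib diff_divide_distrib mult_ac)
  finally show ?thesis by (simp add: tilt_def power_divide mult_ac)
qed

text \<open>Only the product of the two odds is prescribed, so \<open>l\<close> is a free parameter
  that can be adapted to the shape of a rectangle.\<close>

lemma balance:
  assumes "0 < l"
  shows "z * (l * odds t n / (1 + l * odds t n)) * (1 / l * odds t n / (1 + 1 / l * odds t n)) * (1 - q) =
    (1 - l * odds t n / (1 + l * odds t n)) * (1 - 1 / l * odds t n / (1 + 1 / l * odds t n)) * cell_prob q t n"
proof -
  have sq: "odds t n * odds t n = cell_prob q t n / ((1 - q) * z)"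
    using cell_prob_nonneg q z by (simp add: odds_def)
  then have 1: "z * (odds t n * odds t n) * (1 - q) = cell_prob q t n" using q z by simp
  have p: "0 < 1 + l * odds t n" "0 < 1 + 1 / l * odds t n"
    using assms odds_nonneg[of t n] by (auto intro!: add_pos_nonneg)
  have "1 - k / (1 + k) = 1 / (1 + k)" if "0 < 1 + k" for k :: real
    using that by (simp add: field_simps)
  from this[OF p(1)] this[OF p(2)]
  have 2: "1 - l * odds t n / (1 + l * odds t n) = 1 / (1 + l * odds t n)"
     "1 - 1 / l * odds t n / (1 + 1 / l * odds t n) = 1 / (1 + 1 / l * odds t n)"
    by simp_all
  have "z * (l * odds t n / (1 + l * odds t n)) * (1 / l * odds t n / (1 + 1 / l * odds t n)) * (1 - q) =
    (z * (odds t n * odds t n) * (1 - q)) / ((1 + l * odds t n) * (1 + 1 / l * odds t n))"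
    using assms by simp
  then show ?thesis unfolding 1 2 by simp
qed

definition exchange_ratio :: "real \<Rightarrow> nat \<Rightarrow> real" where
  "exchange_ratio t n = q / (1 - cell_prob q t n)"

lemma exchange_ratio_lim: "0 < t \<Longrightarrow> exchange_ratio t \<longlonglongrightarrow> q"
  unfolding exchange_ratio_def cell_prob_def by real_asymp

text \<open>The exchange ratio tends to \<open>q\<close>; the midpoint between \<open>q\<close> and
  1 is a bound away from 1 that is uniform in \<open>n\<close>.\<close>

lemma eventually_grid:
  assumes "0 < t"
  shows "eventually (\<lambda>n. exchange_ratio t n < (1 + q) / 2 \<and> grid q (cell_prob q t n) z (exchange_ratio t n)) sequentially"
proof -
  have "eventually (\<lambda>n. exchange_ratio t n < (1 + q) / 2) sequentially"
    by (rule order_tendstoD(2)[OF exchange_ratio_lim[OF assms]]) (use q in simp)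
  then show ?thesis
  proof eventually_elim
    case (elim n)
    moreover have "exchange_ratio t n * (1 - cell_prob q t n) = q"
      using cell_prob_less[of t n] by (simp add: exchange_ratio_def)
    moreover have "exchange_ratio t n < 1" using elim q by simp
    ultimately show ?case
      using q z cell_prob_less[of t n] cell_prob_nonneg[of t n] by (simp add: grid_def)
  qed
qed

lemma droplet_tilt:
  assumes "grid q (cell_prob q t N) z (exchange_ratio t N)" "0 < l"
  shows "droplet q (cell_prob q t N) z m n \<le> tilt l t N ^ m * tilt (1 / l) t N ^ n"
proof -
  from assms(1) interpret grid q "cell_prob q t N" z "exchange_ratio t N" .
  have l: "0 \<le> l" "0 \<le> 1 / l" using assms(2) by auto
  show ?thesis
    using droplet_upper[OF tilt_eq(1,2)[OF l(1)] tilt_eq(1,2)[OF l(2)] balance[OF assms(2)]]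
    unfolding tilt_eq(3)[OF l(1)] tilt_eq(3)[OF l(2)] .
qed

abbreviation "mesh_droplet t m n \<equiv> droplet q (cell_prob q t n) z m n"

lemma limit_upper:
  assumes t: "0 < t" and lim: "(\<lambda>n. mesh_droplet t n n) \<longlonglongrightarrow> f"
  shows "f \<le> exp (2 * speed * t)"
proof (rule tendsto_le[OF _ _ lim])
  have "(\<lambda>n. tilt 1 t n ^ n * tilt 1 t n ^ n) \<longlonglongrightarrow> exp (1 * (speed * t)) * exp (1 * (speed * t))"
    by (intro tendsto_mult tilt_lim t) auto
  then show "(\<lambda>n. tilt 1 t n ^ n * tilt 1 t n ^ n) \<longlonglongrightarrow> exp (2 * speed * t)"
    by (simp add: exp_add[symmetric] algebra_simps)
  show "eventually (\<lambda>n. mesh_droplet t n n \<le> tilt 1 t n ^ n * tilt 1 t n ^ n) sequentially"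
    using eventually_grid[OF t]
  proof eventually_elim
    case (elim n)
    then show ?case using droplet_tilt[of t n 1 n n] by simp
  qed
qed simp

text \<open>The limit of \<open>droplet_lower\<close>. Since \<open>n * odds t n\<close> converges,
  a uniform bound on the terms of the sum over sources suffices. The number \<open>e\<close>
  separates the sources near the corner from the far ones; \<open>M\<close> regulates the loss
  \<open>\<eta>\<close> per source at the price of a larger \<open>C\<close>.\<close>

lemma limit_lower:
  assumes t: "0 < t" and lim: "(\<lambda>n. mesh_droplet t n n) \<longlonglongrightarrow> f"
    and e: "0 < e" and M: "(z - 1) / (1 - (1 + q) / 2) * ((1 + q) / 2) ^ M \<le> \<eta>"
  defines "C \<equiv> (z - 1) / (1 - (1 + q) / 2) * z ^ M"
  shows "exp (2 * speed * t) \<le> exp (2 * \<eta> / sqrt z * t) *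
    (f + 2 * (t / sqrt z) * C * (exp (e * speed * t) * f + exp ((2 - e\<^sup>2 / 4) * speed * t)))"
proof -
  define Q0 where "Q0 = (1 + q) / 2"
  have Q0: "0 < Q0" "Q0 < 1" using q by (auto simp: Q0_def)
  \<comment> \<open>The odds \<open>l\<close> times and \<open>1 / l\<close> times the symmetric ones beat the latter in the rectangles
    that are shorter by a fraction of at least \<open>e\<close>.\<close>
  define l where "l = 1 + e / 2"
  have l: "1 < l" "0 < 1 / l" using e by (auto simp: l_def)
  have C: "0 \<le> C" using z q by (simp add: C_def)
  have eta: "0 \<le> \<eta>"
  proof -
    have "0 \<le> (z - 1) / (1 - (1 + q) / 2) * ((1 + q) / 2) ^ M" using z q by simp
    then show ?thesis using M by linarith
  qed
  let ?a = "\<lambda>n. 1 * odds t n / (1 + 1 * odds t n)"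
  let ?w = "tilt 1 t" and ?wa = "tilt l t" and ?wb = "tilt (1 / l) t"
  \<comment> \<open>A bound for every term of the sum: the first summand is for
    \<open>i \<le> e * n\<close>, where the droplet is compared with the full square, the second for
    all other \<open>i\<close>.\<close>
  define X where "X = (\<lambda>n. (?w n ^ n) powr e * mesh_droplet t n n +
      ?wa n ^ n * ((?w n ^ n) / (?wa n ^ n)) powr e * ?wb n ^ n)"
  have w1: "1 \<le> ?w n" "1 \<le> ?wa n" "1 \<le> ?wb n" "?w n \<le> ?wa n" for n
    using l by (auto intro: tilt_ge_1 tilt_mono)
  have step: "eventually (\<lambda>n. ?w n ^ n * ?w n ^ n \<le> (1 + odds t n * \<eta>) ^ n * (1 + odds t n * \<eta>) ^ n *
      (mesh_droplet t n n + 2 * (real n * odds t n) * C * X n)) sequentially"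
    using eventually_grid[OF t]
  proof eventually_elim
    case (elim n)
    let ?Q = "exchange_ratio t n"
    from elim interpret grid q "cell_prob q t n" z ?Q by simp
    have QQ: "?Q \<le> Q0" using elim by (simp add: Q0_def)
    note a = tilt_eq[of 1 t n, OF zero_le_one]
    have frac: "(z - 1) / (1 - ?Q) \<le> (z - 1) / (1 - Q0)"
      using QQ Q0 z by (intro divide_left_mono mult_pos_pos) auto
    have eta': "(z - 1) / (1 - ?Q) * ?Q ^ M \<le> \<eta>" "0 \<le> (z - 1) / (1 - ?Q) * ?Q ^ M"
    proof -
      have "(z - 1) / (1 - ?Q) * ?Q ^ M \<le> (z - 1) / (1 - Q0) * Q0 ^ M"
        using frac QQ Q' z Q0 by (intro mult_mono power_mono) auto
      with M show "(z - 1) / (1 - ?Q) * ?Q ^ M \<le> \<eta>" by (simp add: Q0_def)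
      show "0 \<le> (z - 1) / (1 - ?Q) * ?Q ^ M" using z Q' Q(1) by simp
    qed
    have C': "(z - 1) / (1 - ?Q) * z ^ M \<le> C"
      unfolding C_def Q0_def[symmetric] using frac z by (intro mult_right_mono) auto
    have sum: "(\<Sum>i<n. ?w n ^ i * D (n - Suc i) n) \<le> real n * X n"
    proof -
      have "?w n ^ i * D (n - Suc i) n \<le> X n" if i: "i < n" for i
      proof (cases "real i \<le> e * real n")
        case True
        have "?w n ^ i = ?w n powr real i" using w1(1)[of n] by (simp add: powr_realpow)
        also have "\<dots> \<le> ?w n powr (e * real n)" using w1(1)[of n] True by (intro powr_mono) auto
        also have "\<dots> = (?w n ^ n) powr e"
          using w1(1)[of n] by (subst powr_realpow[symmetric]) (auto simp: powr_powr mult.commute)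
        finally have "?w n ^ i * D (n - Suc i) n \<le> (?w n ^ n) powr e * D n n"
          using D_mono[of "n - Suc i" n n] D_nonneg w1(1)[of n] by (intro mult_mono) auto
        moreover have "0 \<le> ?wa n ^ n * ((?w n ^ n) / (?wa n ^ n)) powr e * ?wb n ^ n"
          using w1[of n] by simp
        ultimately show ?thesis by (simp add: X_def)
      next
        case False
        \<comment> \<open>Apart from \<open>?wb n ^ n\<close> the resulting bound is
          \<open>?wa n ^ n * (?w n / ?wa n) ^ i\<close>. It decreases in \<open>i\<close>, because
          \<open>?w n \<le> ?wa n\<close>, so \<open>i = e * n\<close> is the worst case.\<close>
        have "D (n - Suc i) n \<le> ?wa n ^ (n - Suc i) * ?wb n ^ n"
          using droplet_tilt[of t n l "n - Suc i" n] elim l by simp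
        also have "\<dots> \<le> ?wa n ^ (n - i) * ?wb n ^ n"
          using w1[of n] by (intro mult_right_mono power_increasing) auto
        finally have "?w n ^ i * D (n - Suc i) n \<le> ?w n ^ i * (?wa n ^ (n - i) * ?wb n ^ n)"
          using w1(1)[of n] by (intro mult_left_mono) auto
        also have "\<dots> = ?wa n ^ n * (?w n / ?wa n) ^ i * ?wb n ^ n"
          using w1(2)[of n] i by (simp add: power_divide power_diff)
        also have "(?w n / ?wa n) ^ i \<le> ((?w n ^ n) / (?wa n ^ n)) powr e"
        proof -
          have r: "0 < ?w n / ?wa n" "?w n / ?wa n \<le> 1" using w1[of n] by auto
          have "(?w n / ?wa n) ^ i = (?w n / ?wa n) powr real i" using r by (simp add: powr_realpow)
          also have "\<dots> \<le> (?w n / ?wa n) powr (real n * e)" using r False by (intro powr_mono') (auto simp: mult.commute)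
          also have "\<dots> = ((?w n / ?wa n) ^ n) powr e"
            using r by (simp only: powr_powr[symmetric] powr_realpow)
          finally show ?thesis by (simp add: power_divide)
        qed
        finally have "?w n ^ i * D (n - Suc i) n \<le> ?wa n ^ n * ((?w n ^ n) / (?wa n ^ n)) powr e * ?wb n ^ n"
          using w1[of n] by (simp add: mult_left_mono mult_right_mono)
        moreover have "0 \<le> (?w n ^ n) powr e * D n n" using D_nonneg by simp
        ultimately show ?thesis by (simp add: X_def)
      qed
      then show ?thesis using sum_bounded_above[of "{..<n}" "\<lambda>i. ?w n ^ i * D (n - Suc i) n" "X n"] by simp
    qed
    have X0: "0 \<le> X n" unfolding X_def using w1[of n] D_nonneg by (intro add_nonneg_nonneg mult_nonneg_nonneg) auto
    have b: "z * ?a n * ?a n * (1 - q) = (1 - ?a n) * (1 - ?a n) * cell_prob q t n"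
      using balance[of 1 t n] by simp
    have "?w n ^ (2 * n) \<le> (1 + ?a n * ((z - 1) / (1 - ?Q) * ?Q ^ M)) ^ (2 * n) *
        (D n n + 2 * ?a n * ((z - 1) / (1 - ?Q) * z ^ M) * (\<Sum>i<n. ?w n ^ i * D (n - Suc i) n))"
      using droplet_lower[OF a(1,2) b, of n M] unfolding a(3) .
    also have "\<dots> \<le> (1 + odds t n * \<eta>) ^ (2 * n) * (D n n + 2 * odds t n * C * (real n * X n))"
      using a(1,2,4) eta' eta C' C sum X0 D_nonneg w1(1)[of n] odds_nonneg[of t n] z Q(1) Q'
      by (intro mult_mono power_mono add_mono add_nonneg_nonneg mult_nonneg_nonneg sum_nonneg order_refl) auto
    finally show ?case
      unfolding mult_2[of n] power_add by (simp only: mult.assoc mult.left_commute[of C] mult.left_commute[of "odds t n" "real n"])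
  qed
  have lims: "(\<lambda>n. ?w n ^ n) \<longlonglongrightarrow> exp (speed * t)" "(\<lambda>n. ?wa n ^ n) \<longlonglongrightarrow> exp (l * (speed * t))"
    "(\<lambda>n. ?wb n ^ n) \<longlonglongrightarrow> exp (1 / l * (speed * t))"
    using tilt_lim[OF t, of 1] tilt_lim[OF t, of l] tilt_lim[OF t, of "1 / l"] l by simp_all
  have "(\<lambda>n. (1 + odds t n * \<eta>) ^ n) \<longlonglongrightarrow> exp (t / sqrt z * \<eta>)"
    using tendsto_mult[OF odds_lim[OF t] tendsto_const[of \<eta>]] eta odds_nonneg
    by (intro tendsto_one_plus_pow) (auto simp: mult.assoc)
  note lims = lims this lim odds_lim[OF t]
  define Y where "Y = exp (speed * t) powr e * f + exp (l * (speed * t)) * (exp (speed * t) / exp (l * (speed * t))) powr e * exp (1 / l * (speed * t))"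
  have "X \<longlonglongrightarrow> Y"
    unfolding X_def Y_def by (intro tendsto_intros lims) auto
  then have "exp (speed * t) * exp (speed * t) \<le> exp (t / sqrt z * \<eta>) * exp (t / sqrt z * \<eta>) *
      (f + 2 * (t / sqrt z) * C * Y)"
    by (intro tendsto_le[OF _ _ _ step] tendsto_intros lims) auto
  moreover have "Y \<le> exp (e * speed * t) * f + exp ((2 - e\<^sup>2 / 4) * speed * t)"
  proof -
    \<comment> \<open>For \<open>l = 1 + e / 2\<close> this second-order bound gives
      \<open>l + 1 / l \<le> 2 + e\<^sup>2 / 4\<close>, while \<open>(1 - l) * e\<close> is
      \<open>- e\<^sup>2 / 2\<close>; together they leave the exponent
      \<open>2 - e\<^sup>2 / 4\<close>.\<close>
    have "1 / l \<le> 1 - (l - 1) + (l - 1)\<^sup>2"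
    proof -
      have "1 \<le> l * (1 - (l - 1) + (l - 1)\<^sup>2)"
      proof -
        have "l * (1 - (l - 1) + (l - 1)\<^sup>2) = 1 + (l - 1) ^ 3"
          by (simp add: algebra_simps power2_eq_square power3_eq_cube)
        then show ?thesis using l by simp
      qed
      then show ?thesis using l by (simp add: pos_divide_le_eq mult.commute)
    qed
    then have "l + (1 - l) * e + 1 / l \<le> 2 - e\<^sup>2 / 4"
      by (simp add: l_def power2_eq_square algebra_simps)
    moreover have "0 \<le> speed * t" using z t by (simp add: speed_def)
    ultimately have A: "(l + (1 - l) * e + 1 / l) * (speed * t) \<le> (2 - e\<^sup>2 / 4) * (speed * t)"
      by (rule mult_right_mono)
    have B: "exp (l * x) * (exp x / exp (l * x)) powr e * exp (1 / l * x) =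
        exp ((l + (1 - l) * e + 1 / l) * x)" for x :: real
      by (simp add: powr_def exp_diff[symmetric] exp_add[symmetric] algebra_simps)
    have "exp (speed * t) powr e = exp (e * (speed * t))" by (simp add: powr_def)
    with A show ?thesis
      unfolding Y_def B by (simp only: mult.assoc add_le_cancel_left exp_le_cancel_iff)
  qed
  then have "f + 2 * (t / sqrt z) * C * Y \<le>
      f + 2 * (t / sqrt z) * C * (exp (e * speed * t) * f + exp ((2 - e\<^sup>2 / 4) * speed * t))"
    using t z C by (intro add_left_mono mult_left_mono) auto
  moreover have "exp (speed * t) * exp (speed * t) = exp (2 * speed * t)"
    "exp (t / sqrt z * \<eta>) * exp (t / sqrt z * \<eta>) = exp (2 * \<eta> / sqrt z * t)"
    by (simp_all add: exp_add[symmetric] algebra_simps)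
  ultimately show ?thesis by (smt (verit) exp_gt_zero mult_left_mono)
qed

lemma growth_rate:
  assumes lim: "\<And>t. 0 < t \<Longrightarrow> (\<lambda>n. mesh_droplet t n n) \<longlonglongrightarrow> f t"
    and f1: "\<And>t. 0 < t \<Longrightarrow> 1 \<le> f t"
  shows "((\<lambda>t. 1 / t * ln (f t)) \<longlongrightarrow> 2 * speed) at_top"
proof (rule order_tendstoI)
  fix u assume u: "2 * speed < u"
  show "eventually (\<lambda>t. 1 / t * ln (f t) < u) at_top"
    using eventually_gt_at_top[of 0]
  proof eventually_elim
    case (elim t)
    have "ln (f t) \<le> 2 * speed * t"
      using limit_upper[OF elim lim[OF elim]] f1[OF elim] ln_mono[of "f t" "exp (2 * speed * t)"] by simp
    then have "1 / t * ln (f t) \<le> 2 * speed" using elim by (simp add: field_simps)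
    with u show ?case by linarith
  qed
next
  fix u assume u: "u < 2 * speed"
  have speed: "0 < speed" using z by (simp add: speed_def)
  \<comment> \<open>The exponent will lose \<open>e * speed * t\<close> three times: by the factors
    per source, by the sources near the corner and by the logarithmic terms. The fourth multiple
    makes the final inequality strict.\<close>
  define e where "e = min 1 ((2 * speed - u) / (4 * speed))"
  have e: "0 < e" "e \<le> 1" "4 * e * speed \<le> 2 * speed - u"
    using u speed by (auto simp: e_def min_def field_simps)
  \<comment> \<open>Half of the exponential gain of the far sources: one half compensates the
    prefactor \<open>exp (k * t)\<close>, the other makes their contribution negligible.\<close>
  define k where "k = speed * e\<^sup>2 / 8"
  define Q0 where "Q0 = (1 + q) / 2"
  define A where "A = (z - 1) / (1 - Q0)"
  have Q0: "0 < Q0" "Q0 < 1" and A: "0 < A" using q z by (auto simp: Q0_def A_def)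
  have k: "0 < k" using speed e by (simp add: k_def)
  \<comment> \<open>This \<open>M\<close> makes the combined factors of all removed sources at most
    \<open>exp (k * t)\<close> in the limit.\<close>
  obtain M where M: "Q0 ^ M < k * sqrt z / 2 / A"
    using real_arch_pow_inv[of "k * sqrt z / 2 / A" Q0] k A z Q0 by auto
  then have M': "A * Q0 ^ M \<le> k * sqrt z / 2" using A by (simp add: field_simps)
  define K where "K = 2 * (A * z ^ M) / sqrt z"
  have K: "0 < K" using A z by (simp add: K_def)
  have key: "exp (2 * speed * t) \<le> exp (k * t) * (f t + K * t * (exp (e * speed * t) * f t + exp ((2 - e\<^sup>2 / 4) * speed * t)))"
    if t: "0 < t" for t
    using limit_lower[OF t lim[OF t] e(1) M'[unfolded A_def Q0_def]] z
    unfolding K_def A_def Q0_def by (simp add: field_simps)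
  have "((\<lambda>t. K * (t * exp (- k * t))) \<longlongrightarrow> K * 0) at_top"
    using k by (intro tendsto_mult tendsto_const) real_asymp
  then have "eventually (\<lambda>t. K * (t * exp (- k * t)) < 1 / 2) at_top"
    by (rule order_tendstoD) simp
  moreover have "((\<lambda>t. (ln 2 + ln (1 + K * t)) / t) \<longlongrightarrow> 0) at_top"
    using K by real_asymp
  then have "eventually (\<lambda>t. (ln 2 + ln (1 + K * t)) / t < e * speed) at_top"
    by (rule order_tendstoD) (use e speed in simp)
  ultimately show "eventually (\<lambda>t. u < 1 / t * ln (f t)) at_top"
    using eventually_gt_at_top[of 0]
  proof eventually_elim
    case (elim t)
    then have t: "0 < t" by simp
    define x where "x = speed * t"
    have x: "0 < x" using speed t by (simp add: x_def)
    have kx: "k * t = e\<^sup>2 / 8 * x" by (simp add: k_def x_def)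
    have F: "1 \<le> f t" using f1 t by simp
    \<comment> \<open>For large \<open>t\<close> the far sources account for at most half of the
      left side of \<open>key\<close> and are absorbed there.\<close>
    have "exp (k * t) * (K * t * exp ((2 - e\<^sup>2 / 4) * speed * t)) = K * (t * exp (- k * t)) * exp (2 * speed * t)"
    proof -
      have "k * t + (2 - e\<^sup>2 / 4) * x = - k * t + 2 * x" using kx by (simp add: algebra_simps)
      then have "exp (k * t) * exp ((2 - e\<^sup>2 / 4) * x) = exp (- k * t) * exp (2 * x)"
        by (simp only: exp_add[symmetric])
      then show ?thesis by (simp add: x_def mult_ac)
    qed
    also have "\<dots> \<le> 1 / 2 * exp (2 * speed * t)" using elim(1) by (intro mult_right_mono) auto
    finally have "1 / 2 * exp (2 * speed * t) \<le> exp (k * t) * (f t + K * t * (exp (e * speed * t) * f t))"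
      using key[OF t] by (simp add: distrib_left)
    also have "f t + K * t * (exp (e * speed * t) * f t) \<le> exp (e * speed * t) * f t + K * t * (exp (e * speed * t) * f t)"
      using F e speed t mult_right_mono[of 1 "exp (e * speed * t)" "f t"] by simp
    also have "\<dots> = (1 + K * t) * (exp (e * speed * t) * f t)" by (simp add: algebra_simps)
    finally have "1 / 2 * exp (2 * speed * t) \<le> exp (k * t) * ((1 + K * t) * (exp (e * speed * t) * f t))"
      by (simp add: mult_left_mono)
    moreover have "0 < 1 + K * t" using K t by (simp add: add_pos_pos)
    ultimately have "ln (1 / 2 * exp (2 * speed * t)) \<le> ln (exp (k * t) * ((1 + K * t) * (exp (e * speed * t) * f t)))"
      using F by (subst ln_le_cancel_iff) (auto intro!: mult_pos_pos)
    then have "2 * speed * t - ln 2 \<le> k * t + ln (1 + K * t) + e * speed * t + ln (f t)"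
      using F \<open>0 < 1 + K * t\<close> by (simp add: ln_mult ln_div)
    moreover have "ln 2 + ln (1 + K * t) < e * speed * t" using elim(2) t by (simp add: field_simps)
    moreover have "k * t \<le> e * speed * t"
    proof -
      have "e\<^sup>2 / 8 \<le> e" using e(1,2) mult_left_le[of e e] by (simp add: power2_eq_square)
      then have "k \<le> e * speed" using speed mult_left_mono[of "e\<^sup>2 / 8" e speed] by (simp add: k_def mult_ac)
      then show ?thesis using t by (intro mult_right_mono) auto
    qed
    ultimately have "2 * speed * t - 3 * (e * speed * t) < ln (f t)" by linarith
    moreover have "(u + e * speed) * t \<le> (2 * speed - 3 * (e * speed)) * t" using e(3) t by (intro mult_right_mono) auto
    moreover have "0 < e * speed * t" using e speed t by simp
    ultimately have "u * t < ln (f t)" by (simp add: algebra_simps)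
    then show ?case using t by (simp add: field_simps)
  qed
qed

end

section \<open>Line configurations\<close>

text \<open>A sum over subsets, since the points and the coins provide the probability of each set
  of cells (\<open>prob_occ\<close> and \<open>coin_weight\<close>).\<close>

definition subset_exp :: "real \<Rightarrow> 'a set \<Rightarrow> ('a set \<Rightarrow> real) \<Rightarrow> real" where
  "subset_exp p A f = (\<Sum>S\<in>Pow A. p ^ card S * (1 - p) ^ card (A - S) * f S)"

lemma subset_exp_empty [simp]: "subset_exp p {} f = f {}"
  by (simp add: subset_exp_def)

lemma subset_exp_insert:
  assumes "finite A" "a \<notin> A"
  shows "subset_exp p (insert a A) f =
    coin_exp p (\<lambda>b. subset_exp p A (\<lambda>S. f (if b then insert a S else S)))"
proof -
  have inj: "inj_on (insert a) (Pow A)"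
    using assms(2) by (auto simp: inj_on_def)
  have 1: "(\<Sum>S\<in>insert a ` Pow A. p ^ card S * (1 - p) ^ card (insert a A - S) * f S) =
      p * subset_exp p A (\<lambda>S. f (insert a S))"
    unfolding subset_exp_def sum_distrib_left sum.reindex[OF inj] comp_def
  proof (rule sum.cong)
    fix S assume "S \<in> Pow A"
    then have "finite S" "a \<notin> S" using assms by (auto intro: finite_subset)
    then have "card (insert a S) = Suc (card S)" "insert a A - insert a S = A - S"
      using assms by auto
    then show "p ^ card (insert a S) * (1 - p) ^ card (insert a A - insert a S) * f (insert a S) =
        p * (p ^ card S * (1 - p) ^ card (A - S) * f (insert a S))" by simp
  qed simp
  have 2: "(\<Sum>S\<in>Pow A. p ^ card S * (1 - p) ^ card (insert a A - S) * f S) =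
      (1 - p) * subset_exp p A f"
    unfolding subset_exp_def sum_distrib_left
  proof (rule sum.cong)
    fix S assume "S \<in> Pow A"
    then have "insert a A - S = insert a (A - S)" "finite (A - S)" "a \<notin> A - S"
      using assms by auto
    then show "p ^ card S * (1 - p) ^ card (insert a A - S) * f S =
        (1 - p) * (p ^ card S * (1 - p) ^ card (A - S) * f S)" by simp
  qed simp
  have "subset_exp p (insert a A) f = p * subset_exp p A (\<lambda>S. f (insert a S)) + (1 - p) * subset_exp p A f"
    unfolding subset_exp_def[of p "insert a A"] Pow_insert
    by (subst sum.union_disjoint) (use assms 1 2 in \<open>auto simp: add.commute\<close>)
  then show ?thesis by (simp add: coin_exp_def)
qed

lemma fexp_subset_exp:
  assumes "0 \<le> p" "p \<le> 1" "finite A"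
  shows "fexp (subset_exp p A)"
  using assms(3)
proof induction
  case empty
  have "subset_exp p {} = (\<lambda>f. f {})" by auto
  then show ?case by (simp add: fexp_ret)
next
  case (insert a A)
  have "subset_exp p (insert a A) = (\<lambda>f. coin_exp p (\<lambda>b. subset_exp p A (\<lambda>S. f (if b then insert a S else S))))"
    using subset_exp_insert[OF insert(1,2)] by blast
  moreover have "fexp (\<lambda>f. coin_exp p (\<lambda>b. subset_exp p A (\<lambda>S. f (if b then insert a S else S))))"
    by (rule fexp_bind[OF fexp_coin[OF assms(1,2)]]) (rule fexp_map[OF insert(3)])
  ultimately show ?case by simp
qed

lemma subset_exp_cong:
  "(\<And>S. S \<subseteq> A \<Longrightarrow> f S = g S) \<Longrightarrow> subset_exp p A f = subset_exp p A g"
  unfolding subset_exp_def by (rule sum.cong) auto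

lemma subset_exp_union:
  assumes p: "0 \<le> p" "p \<le> 1" and "finite A" "finite B" "A \<inter> B = {}"
  shows "subset_exp p (A \<union> B) f = subset_exp p A (\<lambda>S. subset_exp p B (\<lambda>T. f (S \<union> T)))"
  using assms(3,5)
proof (induction arbitrary: f)
  case empty
  then show ?case by simp
next
  case (insert a A)
  have "subset_exp p (insert a A \<union> B) f = coin_exp p (\<lambda>b. subset_exp p (A \<union> B) (\<lambda>S. f (if b then insert a S else S)))"
    using insert assms(4) by (simp add: subset_exp_insert)
  also have "\<dots> = coin_exp p (\<lambda>b. subset_exp p A (\<lambda>S. subset_exp p B (\<lambda>T. f (if b then insert a (S \<union> T) else S \<union> T))))"
    using insert by simp
  also have "\<dots> = subset_exp p (insert a A) (\<lambda>S. subset_exp p B (\<lambda>T. f (S \<union> T)))"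
    using insert by (simp add: subset_exp_insert if_distrib[of "\<lambda>S. S \<union> _"] cong: if_cong)
  finally show ?case .
qed

text \<open>
  The lines for fixed randomness: \<open>N\<close> is the set of cells that emit lines, \<open>G\<close> the set of cells in
  which meeting lines cross. \<open>hline N G r c\<close> and \<open>vline N G r c\<close> refer to the left and the lower side
  of the cell in row \<open>r\<close> and column \<open>c\<close>.
\<close>

function hline :: "(nat \<times> nat) set \<Rightarrow> (nat \<times> nat) set \<Rightarrow> nat \<Rightarrow> nat \<Rightarrow> bool"
  and vline :: "(nat \<times> nat) set \<Rightarrow> (nat \<times> nat) set \<Rightarrow> nat \<Rightarrow> nat \<Rightarrow> bool" where
  "hline N G r 0 = False"
| "hline N G r (Suc c) = (if hline N G r c = vline N G r c
     then if hline N G r c then (r, c) \<in> G else (r, c) \<in> N else hline N G r c)"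
| "vline N G 0 c = False"
| "vline N G (Suc r) c = (if hline N G r c = vline N G r c
     then if hline N G r c then (r, c) \<in> G else (r, c) \<in> N else vline N G r c)"
  by pat_completeness auto
termination
  by (relation "Wellfounded.measure (case_sum (\<lambda>(N, G, r, c). r + c) (\<lambda>(N, G, r, c). r + c))") auto

text \<open>Causality. It allows cells to be added column by column without changing the lines
  already determined.\<close>

lemma hline_vline_cong:
  "((\<And>r' c'. r' \<le> r \<Longrightarrow> c' < c \<Longrightarrow> ((r', c') \<in> N \<longleftrightarrow> (r', c') \<in> N') \<and> ((r', c') \<in> G \<longleftrightarrow> (r', c') \<in> G')) \<Longrightarrow>
    hline N G r c = hline N' G' r c)"
  "((\<And>r' c'. r' < r \<Longrightarrow> c' \<le> c \<Longrightarrow> ((r', c') \<in> N \<longleftrightarrow> (r', c') \<in> N') \<and> ((r', c') \<in> G \<longleftrightarrow> (r', c') \<in> G')) \<Longrightarrow>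
    vline N G r c = vline N' G' r c)"
proof (induction N G r c and N G r c rule: hline_vline.induct)
  case (2 N G r c)
  have "hline N G r c = hline N' G' r c" "vline N G r c = vline N' G' r c"
    using "2.prems" by (intro "2.IH"; simp)+
  with "2.prems"[of r c] show ?case by simp
next
  case (4 N G r c)
  have "hline N G r c = hline N' G' r c" "vline N G r c = vline N' G' r c"
    using "4.prems" by (intro "4.IH"; simp)+
  with "4.prems"[of r c] show ?case by simp
qed simp_all

text \<open>Both coins are tossed in every cell although at most one is used; the randomness of a
  cell thus does not depend on the lines that reach it and can be drawn in advance.\<close>

lemma vtx_coins:
  "vtx q d v h f = coin_exp d (\<lambda>a. coin_exp q (\<lambda>b.
     f (if h = v then if h then b else a else v, if h = v then if h then b else a else h)))"
  by (cases v; cases h) (simp_all add: vtx_simps coin_exp_def algebra_simps)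

context
  fixes q d :: real
  assumes q: "0 \<le> q" "q \<le> 1" and d: "0 \<le> d" "d \<le> 1"
begin

lemma sweep_column:
  assumes "\<And>r c. (r, c) \<in> N \<union> G \<Longrightarrow> c < m"
  shows "sweep (vtx q d) (map (\<lambda>r. hline N G r m) [0..<n]) [False] f =
    subset_exp d ({..<n} \<times> {m}) (\<lambda>N'. subset_exp q ({..<n} \<times> {m}) (\<lambda>G'.
      f (map (\<lambda>r. hline (N \<union> N') (G \<union> G') r (Suc m)) [0..<n], [vline (N \<union> N') (G \<union> G') n m])))"
proof (induction n arbitrary: f)
  case 0
  then show ?case by simp
next
  case (Suc n)
  let ?F = "\<lambda>N' G'. f (map (\<lambda>r. hline (N \<union> N') (G \<union> G') r (Suc m)) [0..<Suc n],
    [vline (N \<union> N') (G \<union> G') (Suc n) m])"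
  let ?C = "{..<n} \<times> {m}"
  have ins: "{..<Suc n} \<times> {m} = insert (n, m) ?C" by auto
  have fin: "finite ?C" "(n, m) \<notin> ?C" by auto
  have "sweep (vtx q d) (map (\<lambda>r. hline N G r m) [0..<Suc n]) [False] f =
      sweep (vtx q d) (map (\<lambda>r. hline N G r m) [0..<n]) [False] (\<lambda>(hs', vs').
        sweep (vtx q d) [hline N G n m] vs' (\<lambda>(ks', vs''). f (hs' @ ks', vs'')))"
    by (simp add: sweep_append_rows)
  also have "\<dots> = subset_exp d ?C (\<lambda>N'. subset_exp q ?C (\<lambda>G'.
      vtx q d (vline (N \<union> N') (G \<union> G') n m) (hline N G n m) (\<lambda>(v', h').
        f (map (\<lambda>r. hline (N \<union> N') (G \<union> G') r (Suc m)) [0..<n] @ [h'], [v']))))"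
    by (simp add: Suc.IH case_prod_beta')
  also have "\<dots> = subset_exp d ?C (\<lambda>N'. subset_exp q ?C (\<lambda>G'. coin_exp d (\<lambda>a. coin_exp q (\<lambda>b.
      ?F (if a then insert (n, m) N' else N') (if b then insert (n, m) G' else G')))))"
  proof (intro subset_exp_cong)
    fix N' G' assume N': "N' \<subseteq> ?C" and G': "G' \<subseteq> ?C"
    have "f (map (\<lambda>r. hline (N \<union> N') (G \<union> G') r (Suc m)) [0..<n] @
          [if hline N G n m = vline (N \<union> N') (G \<union> G') n m then if hline N G n m then b else a else hline N G n m],
        [if hline N G n m = vline (N \<union> N') (G \<union> G') n m then if hline N G n m then b else a else vline (N \<union> N') (G \<union> G') n m]) =
      ?F (if a then insert (n, m) N' else N') (if b then insert (n, m) G' else G')" for a b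
    proof -
      define N2 where "N2 = N \<union> (if a then insert (n, m) N' else N')"
      define G2 where "G2 = G \<union> (if b then insert (n, m) G' else G')"
      have out: "(n, m) \<notin> N" "(n, m) \<notin> G" "(n, m) \<notin> N'" "(n, m) \<notin> G'"
        using assms[of n m] N' G' by auto
      have 1: "hline (N \<union> N') (G \<union> G') r (Suc m) = hline N2 G2 r (Suc m)" if "r < n" for r
        by (rule hline_vline_cong) (use that in \<open>auto simp: N2_def G2_def\<close>)
      have 2: "vline (N \<union> N') (G \<union> G') n m = vline N2 G2 n m"
        by (rule hline_vline_cong) (auto simp: N2_def G2_def)
      have 3: "hline N G n m = hline N2 G2 n m"
        by (rule hline_vline_cong) (use N' G' in \<open>auto simp: N2_def G2_def\<close>)
      have 4: "(n, m) \<in> N2 \<longleftrightarrow> a" "(n, m) \<in> G2 \<longleftrightarrow> b"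
        using out by (auto simp: N2_def G2_def)
      have 5: "map (\<lambda>r. hline (N \<union> N') (G \<union> G') r (Suc m)) [0..<n] = map (\<lambda>r. hline N2 G2 r (Suc m)) [0..<n]"
        using 1 by simp
      show ?thesis
        unfolding N2_def[symmetric] G2_def[symmetric] 5 2 3 by (simp add: 4)
    qed
    then show "vtx q d (vline (N \<union> N') (G \<union> G') n m) (hline N G n m) (\<lambda>(v', h').
        f (map (\<lambda>r. hline (N \<union> N') (G \<union> G') r (Suc m)) [0..<n] @ [h'], [v'])) =
      coin_exp d (\<lambda>a. coin_exp q (\<lambda>b.
      ?F (if a then insert (n, m) N' else N') (if b then insert (n, m) G' else G')))"
      unfolding vtx_coins prod.case by simp
  qed
  also have "\<dots> = subset_exp d ({..<Suc n} \<times> {m}) (\<lambda>N'. subset_exp q ({..<Suc n} \<times> {m}) (\<lambda>G'.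
      f (map (\<lambda>r. hline (N \<union> N') (G \<union> G') r (Suc m)) [0..<Suc n], [vline (N \<union> N') (G \<union> G') (Suc n) m])))"
    unfolding ins subset_exp_insert[OF fin]
    by (subst fexp_commute[OF fexp_subset_exp[OF q fin(1)] fexp_coin[OF d]],
        subst fexp_commute[OF fexp_subset_exp[OF q fin(1)] fexp_coin[OF q]],
        subst fexp_commute[OF fexp_subset_exp[OF d fin(1)] fexp_coin[OF d]]) (rule refl)
  finally show ?case .
qed

lemma sweep_eq_subset_exp:
  "sweep (vtx q d) (falses n) (falses m) f =
    subset_exp d ({..<n} \<times> {..<m}) (\<lambda>N. subset_exp q ({..<n} \<times> {..<m}) (\<lambda>G.
      f (map (\<lambda>r. hline N G r m) [0..<n], map (vline N G n) [0..<m])))"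
proof (induction m arbitrary: f)
  case 0
  have "sweep (vtx q d) hs [] f = f (hs, [])" for hs f
    by (induction hs arbitrary: f) auto
  moreover have "map (\<lambda>r. False) [0..<n] = falses n" by (simp add: map_replicate_const)
  ultimately show ?case by simp
next
  case (Suc m)
  let ?A = "{..<n} \<times> {..<m}" and ?C = "{..<n} \<times> {m}"
  have un: "{..<n} \<times> {..<Suc m} = ?A \<union> ?C" by auto
  have fin: "finite ?A" "finite ?C" "?A \<inter> ?C = {}" by auto
  have rep: "falses (Suc m) = falses m @ [False]"
    by (simp add: replicate_append_same)
  have "sweep (vtx q d) (falses n) (falses (Suc m)) f =
      subset_exp d ?A (\<lambda>N. subset_exp q ?A (\<lambda>G. sweep (vtx q d) (map (\<lambda>r. hline N G r m) [0..<n]) [False]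
        (\<lambda>(hs'', ws'). f (hs'', map (vline N G n) [0..<m] @ ws'))))"
    unfolding rep by (subst sweep_append_cols[of "vtx q d", OF fexp_vtx[OF q d]]) (simp add: Suc.IH)
  also have "\<dots> = subset_exp d ?A (\<lambda>N. subset_exp q ?A (\<lambda>G. subset_exp d ?C (\<lambda>N'. subset_exp q ?C (\<lambda>G'.
      f (map (\<lambda>r. hline (N \<union> N') (G \<union> G') r (Suc m)) [0..<n], map (vline (N \<union> N') (G \<union> G') n) [0..<Suc m])))))"
  proof (intro subset_exp_cong)
    fix N G assume NG: "N \<subseteq> ?A" "G \<subseteq> ?A"
    have "sweep (vtx q d) (map (\<lambda>r. hline N G r m) [0..<n]) [False]
        (\<lambda>(hs'', ws'). f (hs'', map (vline N G n) [0..<m] @ ws')) =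
      subset_exp d ?C (\<lambda>N'. subset_exp q ?C (\<lambda>G'.
      f (map (\<lambda>r. hline (N \<union> N') (G \<union> G') r (Suc m)) [0..<n], map (vline N G n) [0..<m] @ [vline (N \<union> N') (G \<union> G') n m])))"
      by (subst sweep_column) (use NG in auto)
    also have "\<dots> = subset_exp d ?C (\<lambda>N'. subset_exp q ?C (\<lambda>G'.
      f (map (\<lambda>r. hline (N \<union> N') (G \<union> G') r (Suc m)) [0..<n], map (vline (N \<union> N') (G \<union> G') n) [0..<Suc m])))"
    proof (intro subset_exp_cong)
      fix N' G' assume "N' \<subseteq> ?C" "G' \<subseteq> ?C"
      then have "vline N G n c = vline (N \<union> N') (G \<union> G') n c" if "c < m" for c
        by (intro hline_vline_cong) (use that in auto)
      then have E: "map (vline N G n) [0..<m] = map (vline (N \<union> N') (G \<union> G') n) [0..<m]" by simp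
      then show "f (map (\<lambda>r. hline (N \<union> N') (G \<union> G') r (Suc m)) [0..<n], map (vline N G n) [0..<m] @ [vline (N \<union> N') (G \<union> G') n m]) =
        f (map (\<lambda>r. hline (N \<union> N') (G \<union> G') r (Suc m)) [0..<n], map (vline (N \<union> N') (G \<union> G') n) [0..<Suc m])"
        unfolding E by (simp del: hline.simps vline.simps)
    qed
    finally show "sweep (vtx q d) (map (\<lambda>r. hline N G r m) [0..<n]) [False]
        (\<lambda>(hs'', ws'). f (hs'', map (vline N G n) [0..<m] @ ws')) = subset_exp d ?C (\<lambda>N'. subset_exp q ?C (\<lambda>G'.
      f (map (\<lambda>r. hline (N \<union> N') (G \<union> G') r (Suc m)) [0..<n], map (vline (N \<union> N') (G \<union> G') n) [0..<Suc m])))" .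
  qed
  also have "\<dots> = subset_exp d ({..<n} \<times> {..<Suc m}) (\<lambda>N. subset_exp q ({..<n} \<times> {..<Suc m}) (\<lambda>G.
      f (map (\<lambda>r. hline N G r (Suc m)) [0..<n], map (vline N G n) [0..<Suc m])))"
    unfolding un subset_exp_union[OF d fin] subset_exp_union[OF q fin]
    by (subst fexp_commute[OF fexp_subset_exp[OF q fin(1)] fexp_subset_exp[OF d fin(2)]]) (rule refl)
  finally show ?case .
qed

lemma droplet_eq_subset_exp:
  "droplet q d z m n = subset_exp d ({..<n} \<times> {..<m}) (\<lambda>N. subset_exp q ({..<n} \<times> {..<m}) (\<lambda>G.
      z ^ card {r. r < n \<and> hline N G r m}))"
proof -
  have "ones (map P [0..<n]) = card {r. r < n \<and> P r}" for P
  proof (induction n)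
    case (Suc n)
    have "{r. r < Suc n \<and> P r} = {r. r < n \<and> P r} \<union> (if P n then {n} else {})"
      by (auto simp: less_Suc_eq)
    with Suc show ?case by (simp add: card_insert_if)
  qed simp
  then show ?thesis
    unfolding droplet_def sweep_eq_subset_exp by (simp add: exit_weight_def)
qed

end

text \<open>Every cell changes its horizontal and its vertical line by the same amount. Summed over
  the lowest \<open>k\<close> cells of the column this telescopes, as no line enters from
  below.\<close>

lemma card_hline_Suc:
  "card {r. r < k \<and> hline N G r (Suc m)} = card {r. r < k \<and> hline N G r m} + of_bool (vline N G k m)"
proof (induction k)
  case (Suc k)
  have *: "card {r. r < Suc k \<and> P r} = card {r. r < k \<and> P r} + of_bool (P k)" for P
  proof -
    have "{r. r < Suc k \<and> P r} = {r. r < k \<and> P r} \<union> (if P k then {k} else {})"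
      by (auto simp: less_Suc_eq)
    then show ?thesis by (simp add: card_insert_if)
  qed
  show ?case unfolding * Suc by simp
qed simp

text \<open>There are as many right exits as upper exits, and a column without an emitting cell
  never carries a vertical line.\<close>

lemma card_hline_le:
  assumes "finite N"
  shows "card {r. r < n \<and> hline N G r m} \<le> card N"
proof -
  have "card {r. r < n \<and> hline N G r m} = card {c. c < m \<and> vline N G n c}"
  proof (induction m)
    case (Suc m)
    have "{c. c < Suc m \<and> vline N G n c} = {c. c < m \<and> vline N G n c} \<union> (if vline N G n m then {m} else {})"
      by (auto simp: less_Suc_eq)
    then show ?case unfolding card_hline_Suc Suc by (simp add: card_insert_if)
  qed simp
  also have "\<dots> \<le> card (snd ` N)"
  proof (rule card_mono)
    have "vline N G k c \<Longrightarrow> c \<in> snd ` N" for k c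
      by (induction k) (force split: if_splits)+
    then show "{c. c < m \<and> vline N G n c} \<subseteq> snd ` N" by auto
  qed (use assms in simp)
  also have "\<dots> \<le> card N" by (rule card_image_le[OF assms])
  finally show ?thesis .
qed

text \<open>The count moves from the right side to the staircase formed by the left and upper sides
  of the diagonal cells, the grid version of the axis on which the height counts rays.\<close>

lemma card_hline_diagonal:
  "card {r. r < n \<and> hline N G r n} = card {k. k < n \<and> hline N G k k} + card {k. k < n \<and> vline N G (Suc k) k}"
proof (induction n)
  case (Suc n)
  have *: "card {r. r < Suc k \<and> P r} = card {r. r < k \<and> P r} + of_bool (P k)" for P k
  proof -
    have "{r. r < Suc k \<and> P r} = {r. r < k \<and> P r} \<union> (if P k then {k} else {})"
      by (auto simp: less_Suc_eq)
    then show ?thesis by (simp add: card_insert_if)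
  qed
  show ?case unfolding card_hline_Suc[of "Suc n"] * using Suc by simp
qed simp

section \<open>From rays to lines\<close>

definition ucoord :: "real \<times> real \<Rightarrow> real" where "ucoord p = snd p + fst p"
definition vcoord :: "real \<times> real \<Rightarrow> real" where "vcoord p = snd p - fst p"

lemma rays_meet_iff: "rays_meet a b \<longleftrightarrow> ucoord a \<le> ucoord b \<and> vcoord b \<le> vcoord a"
proof
  assume "rays_meet a b"
  then obtain r s where "0 \<le> r" "0 \<le> s" "a + (r, r) = b + (- s, s)"
    by (auto simp: rays_meet_def)
  then show "ucoord a \<le> ucoord b \<and> vcoord b \<le> vcoord a"
    by (auto simp: ucoord_def vcoord_def prod_eq_iff)
next
  assume *: "ucoord a \<le> ucoord b \<and> vcoord b \<le> vcoord a"
  show "rays_meet a b"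
    unfolding rays_meet_def
    by (rule exI[of _ "(ucoord b - ucoord a) / 2"], use * in simp,
        rule exI[of _ "(vcoord a - vcoord b) / 2"])
      (use * in \<open>auto simp: ucoord_def vcoord_def prod_eq_iff field_simps\<close>)
qed

lemma meet_time_uv: "meet_time a b = (ucoord b + vcoord a) / 2"
  by (simp add: meet_time_def ucoord_def vcoord_def)

lemma cone_uv: "p \<in> forward_cone \<longleftrightarrow> 0 \<le> ucoord p \<and> 0 \<le> vcoord p"
  by (cases p) (auto simp: forward_cone_def ucoord_def vcoord_def)

lemma termination_rule_uv:
  "termination_rule x c K \<longleftrightarrow> (\<forall>i j. (i, j) \<in> K \<longleftrightarrow>
     i \<noteq> j \<and> ucoord (x i) \<le> ucoord (x j) \<and> vcoord (x j) \<le> vcoord (x i) \<and> \<not> c (i, j) \<and>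
     (\<forall>j'. (i, j') \<in> K \<longrightarrow> ucoord (x j) \<le> ucoord (x j')) \<and>
     (\<forall>i'. (i', j) \<in> K \<longrightarrow> vcoord (x i) \<le> vcoord (x i')))"
  by (simp add: termination_rule_def rays_meet_iff meet_time_uv field_simps)

lemma closed_segment_axis:
  fixes t :: real
  assumes "0 \<le> t"
  shows "closed_segment (0, t) (0 :: real, 0) = {p. fst p = 0 \<and> 0 \<le> snd p \<and> snd p \<le> t}"
proof -
  have 1: "closed_segment t 0 = {0..t}"
    using assms by (subst closed_segment_commute) (simp add: closed_segment_eq_real_ivl)
  have 2: "closed_segment (0, t) (0 :: real, 0) = {0} \<times> closed_segment t 0"
    by (auto simp: closed_segment_def algebra_simps)
  show ?thesis unfolding 1 2 by auto
qed

text \<open>A north-east ray keeps its \<open>vcoord\<close>, so it can meet the axis only at time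
  \<open>vcoord (x i)\<close>, and does so if it starts on the left of the axis and is not
  terminated before that time.\<close>

lemma trajectory_NE_hits:
  assumes "x i \<in> forward_cone" "0 \<le> t"
  shows "trajectory x c NE i \<inter> closed_segment (0, t) (0, 0) \<noteq> {} \<longleftrightarrow>
    ucoord (x i) \<le> vcoord (x i) \<and> vcoord (x i) \<le> t \<and>
    (\<forall>j. (i, j) \<in> terminations x c \<longrightarrow> vcoord (x i) \<le> ucoord (x j))"
proof
  assume "trajectory x c NE i \<inter> closed_segment (0, t) (0, 0) \<noteq> {}"
  then obtain p where p: "p \<in> trajectory x c NE i" "p \<in> closed_segment (0, t) (0, 0)" by blast
  from p(1) obtain r where r: "p = x i + (r, r)" "0 \<le> r"
    "\<And>j. (i, j) \<in> terminations x c \<Longrightarrow> snd p \<le> meet_time (x i) (x j)" by auto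
  have p0: "fst p = 0" "snd p \<le> t" using p(2) by (simp_all add: closed_segment_axis[OF assms(2)])
  then have v: "vcoord (x i) = snd p" "ucoord (x i) \<le> snd p" using r(1,2) by (auto simp: ucoord_def vcoord_def)
  have "snd p \<le> ucoord (x j)" if "(i, j) \<in> terminations x c" for j
    using r(3)[OF that] v(1) by (simp add: meet_time_uv)
  then show "ucoord (x i) \<le> vcoord (x i) \<and> vcoord (x i) \<le> t \<and>
    (\<forall>j. (i, j) \<in> terminations x c \<longrightarrow> vcoord (x i) \<le> ucoord (x j))"
    using v p0 by auto
next
  assume *: "ucoord (x i) \<le> vcoord (x i) \<and> vcoord (x i) \<le> t \<and>
    (\<forall>j. (i, j) \<in> terminations x c \<longrightarrow> vcoord (x i) \<le> ucoord (x j))"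
  have "(0, vcoord (x i)) \<in> trajectory x c NE i"
    using * by (auto intro!: exI[of _ "- fst (x i)"] simp: ucoord_def vcoord_def meet_time_def prod_eq_iff)
  moreover have "(0 :: real, vcoord (x i)) \<in> closed_segment (0, t) (0, 0)"
    unfolding closed_segment_axis[OF assms(2)] using * assms(1) by (simp add: cone_uv)
  ultimately show "trajectory x c NE i \<inter> closed_segment (0, t) (0, 0) \<noteq> {}" by blast
qed

lemma trajectory_NW_hits:
  assumes "x i \<in> forward_cone" "0 \<le> t"
  shows "trajectory x c NW i \<inter> closed_segment (0, t) (0, 0) \<noteq> {} \<longleftrightarrow>
    vcoord (x i) \<le> ucoord (x i) \<and> ucoord (x i) \<le> t \<and>
    (\<forall>j. (j, i) \<in> terminations x c \<longrightarrow> ucoord (x i) \<le> vcoord (x j))"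
proof
  assume "trajectory x c NW i \<inter> closed_segment (0, t) (0, 0) \<noteq> {}"
  then obtain p where p: "p \<in> trajectory x c NW i" "p \<in> closed_segment (0, t) (0, 0)" by blast
  from p(1) obtain r where r: "p = x i + (- r, r)" "0 \<le> r"
    "\<And>j. (j, i) \<in> terminations x c \<Longrightarrow> snd p \<le> meet_time (x j) (x i)" by auto
  have p0: "fst p = 0" "snd p \<le> t" using p(2) by (simp_all add: closed_segment_axis[OF assms(2)])
  then have v: "ucoord (x i) = snd p" "vcoord (x i) \<le> snd p" using r(1,2) by (auto simp: ucoord_def vcoord_def)
  have "snd p \<le> vcoord (x j)" if "(j, i) \<in> terminations x c" for j
    using r(3)[OF that] v(1) by (simp add: meet_time_uv)
  then show "vcoord (x i) \<le> ucoord (x i) \<and> ucoord (x i) \<le> t \<and>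
    (\<forall>j. (j, i) \<in> terminations x c \<longrightarrow> ucoord (x i) \<le> vcoord (x j))"
    using v p0 by auto
next
  assume *: "vcoord (x i) \<le> ucoord (x i) \<and> ucoord (x i) \<le> t \<and>
    (\<forall>j. (j, i) \<in> terminations x c \<longrightarrow> ucoord (x i) \<le> vcoord (x j))"
  have "(0, ucoord (x i)) \<in> trajectory x c NW i"
    using * by (auto intro!: exI[of _ "fst (x i)"] simp: ucoord_def vcoord_def meet_time_def prod_eq_iff)
  moreover have "(0 :: real, ucoord (x i)) \<in> closed_segment (0, t) (0, 0)"
    unfolding closed_segment_axis[OF assms(2)] using * assms(1) by (simp add: cone_uv)
  ultimately show "trajectory x c NW i \<inter> closed_segment (0, t) (0, 0) \<noteq> {}" by blast
qed

definition hits_NE :: "(nat \<Rightarrow> real \<times> real) \<Rightarrow> (nat \<times> nat \<Rightarrow> bool) \<Rightarrow> real \<Rightarrow> nat set" where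
  "hits_NE x c t = {i. ucoord (x i) \<le> vcoord (x i) \<and> vcoord (x i) \<le> t \<and>
     (\<forall>j. (i, j) \<in> terminations x c \<longrightarrow> vcoord (x i) \<le> ucoord (x j))}"

definition hits_NW :: "(nat \<Rightarrow> real \<times> real) \<Rightarrow> (nat \<times> nat \<Rightarrow> bool) \<Rightarrow> real \<Rightarrow> nat set" where
  "hits_NW x c t = {i. vcoord (x i) \<le> ucoord (x i) \<and> ucoord (x i) \<le> t \<and>
     (\<forall>j. (j, i) \<in> terminations x c \<longrightarrow> ucoord (x i) \<le> vcoord (x j))}"

definition diamond :: "real \<Rightarrow> (real \<times> real) set" where
  "diamond t = {p. 0 \<le> ucoord p \<and> ucoord p \<le> t \<and> 0 \<le> vcoord p \<and> vcoord p \<le> t}"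

lemma bounded_diamond: "bounded (diamond t)"
proof (rule bounded_subset)
  show "diamond t \<subseteq> {- t..t} \<times> {0..t}"
    by (auto simp: diamond_def ucoord_def vcoord_def)
qed (intro bounded_Times bounded_closed_interval)

locale configuration =
  fixes x :: "nat \<Rightarrow> real \<times> real" and c :: "nat \<times> nat \<Rightarrow> bool"
  assumes cone: "\<And>i. x i \<in> forward_cone"
    and lf: "\<And>A. bounded A \<Longrightarrow> finite {i. x i \<in> A}"
begin

abbreviation "u i \<equiv> ucoord (x i)"
abbreviation "v i \<equiv> vcoord (x i)"
abbreviation "K \<equiv> terminations x c"

lemma uv_nonneg: "0 \<le> u i" "0 \<le> v i"
  using cone by (simp_all add: cone_uv)

lemma K_rule: "termination_rule x c K"
  unfolding terminations_def using ex1_termination_rule[OF cone lf] by (rule theI')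

lemma K_iff: "(i, j) \<in> K \<longleftrightarrow> i \<noteq> j \<and> u i \<le> u j \<and> v j \<le> v i \<and> \<not> c (i, j) \<and>
     (\<forall>j'. (i, j') \<in> K \<longrightarrow> u j \<le> u j') \<and> (\<forall>i'. (i', j) \<in> K \<longrightarrow> v i \<le> v i')"
  using K_rule unfolding termination_rule_uv by blast

lemma hits_subset: "hits_NE x c t \<union> hits_NW x c t \<subseteq> {i. x i \<in> diamond t}"
  using uv_nonneg by (auto simp: hits_NE_def hits_NW_def diamond_def)

lemma finite_hits: "finite (hits_NE x c t)" "finite (hits_NW x c t)"
  using finite_subset[OF hits_subset lf[OF bounded_diamond]] by simp_all

lemma height_eq:
  assumes "0 \<le> t"
  shows "height x c (0, t) = ereal (real (card (hits_NE x c t) + card (hits_NW x c t)))"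
proof -
  have "{(d, i). trajectory x c d i \<inter> closed_segment (0, t) (0, 0) \<noteq> {}} =
      {NE} \<times> hits_NE x c t \<union> {NW} \<times> hits_NW x c t"
  proof (rule set_eqI, clarify)
    fix d i
    show "((d, i) \<in> {(d, i). trajectory x c d i \<inter> closed_segment (0, t) (0, 0) \<noteq> {}}) =
      ((d, i) \<in> {NE} \<times> hits_NE x c t \<union> {NW} \<times> hits_NW x c t)"
      using trajectory_NE_hits[of x i, OF cone assms] trajectory_NW_hits[of x i, OF cone assms]
      by (cases d) (auto simp only: hits_NE_def hits_NW_def mem_Collect_eq mem_Sigma_iff Un_iff
        case_prod_conv direction.distinct singleton_iff simp_thms)
  qed
  then have "card {(d, i). trajectory x c d i \<inter> closed_segment (0, t) (0, 0) \<noteq> {}} =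
      card (hits_NE x c t) + card (hits_NW x c t)"
    by (simp add: card_Un_disjoint finite_hits card_cartesian_product Times_Int_Times)
  then show ?thesis using assms by (simp add: height_def forward_cone_def)
qed

end

section \<open>Rays on a grid that separates the points\<close>

definition strip_index :: "real \<Rightarrow> nat \<Rightarrow> real \<Rightarrow> nat" where
  "strip_index t n s = nat \<lfloor>s * real n / t\<rfloor>"

lemma strip_index_mono: "0 < t \<Longrightarrow> a \<le> b \<Longrightarrow> strip_index t n a \<le> strip_index t n b"
  unfolding strip_index_def by (intro nat_mono floor_mono divide_right_mono mult_right_mono) auto

lemma strip_index_less: "0 < t \<Longrightarrow> strip_index t n a < strip_index t n b \<Longrightarrow> a < b"
  using strip_index_mono[of t b a n] by force

lemma strip_index_less_iff:
  assumes "0 < t" "0 < n" "0 \<le> a"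
  shows "strip_index t n a < k \<longleftrightarrow> a < real k * t / real n"
proof -
  have "strip_index t n a < k \<longleftrightarrow> a * real n / t < real k"
    using assms by (simp add: strip_index_def nat_less_iff floor_less_iff)
  also have "\<dots> \<longleftrightarrow> a < real k * t / real n"
    using assms by (simp add: field_simps)
  finally show ?thesis .
qed

text \<open>Columns are also compared with rows: otherwise a point, or a meeting of two rays, could
  lie in a diagonal cell, and the grid would not show its position relative to the axis. The
  condition \<open>edge\<close> excludes points on the closed upper sides of the diamond, which the
  half-open strips miss.\<close>

locale separated = configuration +
  fixes t :: real and n :: nat
  assumes t: "0 < t" and n: "0 < n"
    and edge: "\<And>i. u i \<le> t \<Longrightarrow> v i \<le> t \<Longrightarrow> u i < t \<and> v i < t"
    and sep: "\<And>i j. i \<noteq> j \<Longrightarrow> u i < t \<Longrightarrow> v i < t \<Longrightarrow> u j < t \<Longrightarrow> v j < t \<Longrightarrow>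
      strip_index t n (u i) \<noteq> strip_index t n (u j) \<and> strip_index t n (v i) \<noteq> strip_index t n (v j)
      \<and> strip_index t n (u i) \<noteq> strip_index t n (v j)"
    and diag: "\<And>i. u i < t \<Longrightarrow> v i < t \<Longrightarrow> strip_index t n (u i) \<noteq> strip_index t n (v i)"
begin

abbreviation "cl i \<equiv> strip_index t n (u i)"
abbreviation "rw i \<equiv> strip_index t n (v i)"

definition inside :: "nat \<Rightarrow> bool" where "inside i \<longleftrightarrow> u i < t \<and> v i < t"

lemma inside_iff: "inside i \<longleftrightarrow> cl i < n \<and> rw i < n"
  using strip_index_less_iff[OF t n, of _ n] uv_nonneg n by (simp add: inside_def)

lemma col_row_unique:
  "inside i \<Longrightarrow> inside j \<Longrightarrow> cl i = cl j \<Longrightarrow> i = j"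
  "inside i \<Longrightarrow> inside j \<Longrightarrow> rw i = rw j \<Longrightarrow> i = j"
  "inside i \<Longrightarrow> inside j \<Longrightarrow> cl i \<noteq> rw j"
  using sep diag unfolding inside_def by metis+

lemma K_D:
  assumes "(i, j) \<in> K"
  shows "i \<noteq> j" "cl i \<le> cl j" "rw j \<le> rw i"
    "inside i \<Longrightarrow> cl j < n \<Longrightarrow> inside j" "inside j \<Longrightarrow> rw i < n \<Longrightarrow> inside i"
    "(i, j') \<in> K \<Longrightarrow> cl j \<le> cl j'" "(i', j) \<in> K \<Longrightarrow> rw i \<le> rw i'"
proof -
  note * = assms[unfolded K_iff[of i j]]
  show "i \<noteq> j" "cl i \<le> cl j" "rw j \<le> rw i"
    using * by (auto intro: strip_index_mono t)
  then show "inside i \<Longrightarrow> cl j < n \<Longrightarrow> inside j" "inside j \<Longrightarrow> rw i < n \<Longrightarrow> inside i"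
    unfolding inside_iff by auto
  show "(i, j') \<in> K \<Longrightarrow> cl j \<le> cl j'" "(i', j) \<in> K \<Longrightarrow> rw i \<le> rw i'"
    using * by (auto intro: strip_index_mono t)
qed

text \<open>The line states as read off from the complete set of terminations;
  \<open>lines_eq\<close> identifies them with those of the local recursion.\<close>

definition HP :: "nat \<Rightarrow> nat \<Rightarrow> bool" where
  "HP r k \<longleftrightarrow> (\<exists>i. inside i \<and> rw i = r \<and> cl i < k \<and> (\<forall>j. (i, j) \<in> K \<longrightarrow> k \<le> cl j))"
definition VP :: "nat \<Rightarrow> nat \<Rightarrow> bool" where
  "VP r k \<longleftrightarrow> (\<exists>j. inside j \<and> cl j = k \<and> rw j < r \<and> (\<forall>i. (i, j) \<in> K \<longrightarrow> r \<le> rw i))"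

definition occupied :: "(nat \<times> nat) set" where
  "occupied = {(rw i, cl i) | i. inside i}"

lemma HP_I: "inside i \<Longrightarrow> rw i = r \<Longrightarrow> cl i < k \<Longrightarrow> (\<And>j. (i, j) \<in> K \<Longrightarrow> k \<le> cl j) \<Longrightarrow> HP r k"
  by (auto simp: HP_def)

lemma VP_I: "inside j \<Longrightarrow> cl j = k \<Longrightarrow> rw j < r \<Longrightarrow> (\<And>i. (i, j) \<in> K \<Longrightarrow> r \<le> rw i) \<Longrightarrow> VP r k"
  by (auto simp: VP_def)

lemma occupied_I: "inside i \<Longrightarrow> rw i = r \<Longrightarrow> cl i = k \<Longrightarrow> (r, k) \<in> occupied"
  by (auto simp: occupied_def)

context
  fixes G :: "(nat \<times> nat) set"
  assumes G: "\<And>i j. inside i \<Longrightarrow> inside j \<Longrightarrow> i \<noteq> j \<Longrightarrow> (rw i, cl j) \<in> G \<longleftrightarrow> c (i, j)"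
begin

text \<open>By separation at most one thing happens in a cell, either an emission or the meeting of
  one particular pair of rays.\<close>

lemma cell_step:
  assumes r: "r < n" and k: "k < n"
  shows "HP r (Suc k) = (if HP r k = VP r k then if HP r k then (r, k) \<in> G else (r, k) \<in> occupied else HP r k)" (is "_ = ?h")
    and "VP (Suc r) k = (if HP r k = VP r k then if HP r k then (r, k) \<in> G else (r, k) \<in> occupied else VP r k)" (is "_ = ?v")
proof -
  have noH: "\<not> HP r (Suc k)" if "\<not> HP r k" "(r, k) \<notin> occupied"
  proof
    assume "HP r (Suc k)"
    then obtain i where i: "inside i" "rw i = r" "cl i < Suc k" "\<And>j. (i, j) \<in> K \<Longrightarrow> Suc k \<le> cl j"
      by (auto simp: HP_def)
    then have "cl i \<noteq> k" using that(2) occupied_I by blast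
    with i have "HP r k" by (intro HP_I[of i]) (auto dest: i(4))
    with that show False by simp
  qed
  have noV: "\<not> VP (Suc r) k" if "\<not> VP r k" "(r, k) \<notin> occupied"
  proof
    assume "VP (Suc r) k"
    then obtain j where j: "inside j" "cl j = k" "rw j < Suc r" "\<And>i. (i, j) \<in> K \<Longrightarrow> Suc r \<le> rw i"
      by (auto simp: VP_def)
    then have "rw j \<noteq> r" using that(2) occupied_I by blast
    with j have "VP r k" by (intro VP_I[of j]) (auto dest: j(4))
    with that show False by simp
  qed
  have "HP r (Suc k) = ?h \<and> VP (Suc r) k = ?v"
  proof (cases "(r, k) \<in> occupied")
    case True
    then obtain i where i: "inside i" "rw i = r" "cl i = k" by (auto simp: occupied_def)
    have "\<not> HP r k" using i col_row_unique(2) by (fastforce simp: HP_def)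
    moreover have "\<not> VP r k" using i col_row_unique(1) by (fastforce simp: VP_def)
    moreover have "HP r (Suc k)"
    proof (rule HP_I[OF i(1,2)])
      fix j assume j: "(i, j) \<in> K"
      have "cl j \<noteq> k" using K_D(1,4)[OF j] i k col_row_unique(1)[of i j] by auto
      then show "Suc k \<le> cl j" using K_D(2)[OF j] i(3) by simp
    qed (use i in simp)
    moreover have "VP (Suc r) k"
    proof (rule VP_I[OF i(1,3)])
      fix j assume j: "(j, i) \<in> K"
      have "rw j \<noteq> r" using K_D(1,5)[OF j] i r col_row_unique(2)[of i j] by auto
      then show "Suc r \<le> rw j" using K_D(3)[OF j] i(2) by simp
    qed (use i in simp)
    ultimately show ?thesis using True by simp
  next
    case N: False
    show ?thesis
    proof (cases "HP r k")
      case H: True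
      then obtain i where i: "inside i" "rw i = r" "cl i < k" "\<And>j. (i, j) \<in> K \<Longrightarrow> k \<le> cl j"
        by (auto simp: HP_def)
      show ?thesis
      proof (cases "VP r k")
        case V: True
        then obtain j where j: "inside j" "cl j = k" "rw j < r" "\<And>i. (i, j) \<in> K \<Longrightarrow> r \<le> rw i"
          by (auto simp: VP_def)
        have ij: "i \<noteq> j" using i j by auto
        have uv: "u i < u j" "v j < v i"
          using i j by (auto intro!: strip_index_less[OF t, of n])
        have 1: "u j \<le> u j'" if "(i, j') \<in> K" for j'
        proof (cases "cl j' = k")
          case True
          then have "j' = j" using K_D(4)[OF that i(1)] k col_row_unique(1) j by auto
          then show ?thesis by simp
        next
          case False
          then have "cl j < cl j'" using i(4)[OF that] j by simp
          then show ?thesis using strip_index_less[OF t] less_imp_le by blast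
        qed
        have 2: "v i \<le> v i'" if "(i', j) \<in> K" for i'
        proof (cases "rw i' = r")
          case True
          then have "i' = i" using K_D(5)[OF that j(1)] r col_row_unique(2) i by auto
          then show ?thesis by simp
        next
          case False
          then have "rw i < rw i'" using j(4)[OF that] i by simp
          then show ?thesis using strip_index_less[OF t] less_imp_le by blast
        qed
        \<comment> \<open>Both rays reach this cell, so neither has an earlier termination. The
          minimality conditions of \<open>K_iff\<close> therefore hold, and the coin alone
          decides.\<close>
        have Kc: "(i, j) \<in> K \<longleftrightarrow> \<not> c (i, j)"
          unfolding K_iff[of i j] using ij uv 1 2 by auto
        have Gc: "(r, k) \<in> G \<longleftrightarrow> c (i, j)" using G[OF i(1) j(1) ij] i j by simp
        have "HP r (Suc k) \<longleftrightarrow> c (i, j)"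
        proof
          assume "HP r (Suc k)"
          then obtain i' where i': "inside i'" "rw i' = r" "\<And>j. (i', j) \<in> K \<Longrightarrow> Suc k \<le> cl j"
            by (auto simp: HP_def)
          then have "i' = i" using col_row_unique(2) i by auto
          then have "(i, j) \<notin> K" using i'(3)[of j] j(2) by auto
          then show "c (i, j)" using Kc by simp
        next
          assume cc: "c (i, j)"
          show "HP r (Suc k)"
          proof (rule HP_I[OF i(1,2)])
            fix j' assume j': "(i, j') \<in> K"
            have "cl j' \<noteq> k"
            proof
              assume e: "cl j' = k"
              then have "inside j'" using K_D(4)[OF j' i(1)] k by simp
              then have "j' = j" using col_row_unique(1)[of j' j] e j(1,2) by simp
              then show False using j' Kc cc by simp
            qed
            then show "Suc k \<le> cl j'" using i(4)[OF j'] by simp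
          qed (use i in simp)
        qed
        moreover have "VP (Suc r) k \<longleftrightarrow> c (i, j)"
        proof
          assume "VP (Suc r) k"
          then obtain j' where j': "inside j'" "cl j' = k" "\<And>i. (i, j') \<in> K \<Longrightarrow> Suc r \<le> rw i"
            by (auto simp: VP_def)
          then have "j' = j" using col_row_unique(1) j by auto
          then have "(i, j) \<notin> K" using j'(3)[of i] i(2) by auto
          then show "c (i, j)" using Kc by simp
        next
          assume cc: "c (i, j)"
          show "VP (Suc r) k"
          proof (rule VP_I[OF j(1,2)])
            fix i' assume i': "(i', j) \<in> K"
            have "rw i' \<noteq> r"
            proof
              assume e: "rw i' = r"
              then have "inside i'" using K_D(5)[OF i' j(1)] r by simp
              then have "i' = i" using col_row_unique(2)[of i' i] e i(1,2) by simp
              then show False using i' Kc cc by simp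
            qed
            then show "Suc r \<le> rw i'" using j(4)[OF i'] by simp
          qed (use j in simp)
        qed
        ultimately show ?thesis using H V Gc by simp
      next
        case V: False
        have "HP r (Suc k)"
        proof (rule HP_I[OF i(1,2)])
          fix j assume j: "(i, j) \<in> K"
          \<comment> \<open>A partner terminating the ray here would itself have survived up to this
            cell and would be its vertical line.\<close>
          have "cl j \<noteq> k"
          proof
            assume ck: "cl j = k"
            have ins: "inside j" using K_D(4)[OF j i(1)] ck k by simp
            have "rw j \<noteq> r" using col_row_unique(2)[OF ins i(1)] i(2) K_D(1)[OF j] by auto
            then have "rw j < r" using K_D(3)[OF j] i(2) by simp
            moreover have "r \<le> rw i'" if "(i', j) \<in> K" for i' using K_D(7)[OF j that] i(2) by simp
            ultimately have "VP r k" using ins ck by (intro VP_I) auto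
            with V show False by simp
          qed
          then show "Suc k \<le> cl j" using i(4)[OF j] by simp
        qed (use i in simp)
        then show ?thesis using H V noV[OF V N] by simp
      qed
    next
      case H: False
      show ?thesis
      proof (cases "VP r k")
        case V: True
        then obtain j where j: "inside j" "cl j = k" "rw j < r" "\<And>i. (i, j) \<in> K \<Longrightarrow> r \<le> rw i"
          by (auto simp: VP_def)
        have "VP (Suc r) k"
        proof (rule VP_I[OF j(1,2)])
          fix i assume i: "(i, j) \<in> K"
          have "rw i \<noteq> r"
          proof
            assume rr: "rw i = r"
            have ins: "inside i" using K_D(5)[OF i j(1)] rr r by simp
            have "cl i \<noteq> k" using col_row_unique(1)[OF ins j(1)] j(2) K_D(1)[OF i] by auto
            then have "cl i < k" using K_D(2)[OF i] j(2) by simp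
            moreover have "k \<le> cl j'" if "(i, j') \<in> K" for j' using K_D(6)[OF i that] j(2) by simp
            ultimately have "HP r k" using ins rr by (intro HP_I) auto
            with H show False by simp
          qed
          then show "Suc r \<le> rw i" using j(4)[OF i] by simp
        qed (use j in simp)
        then show ?thesis using H V noH[OF H N] by simp
      next
        case V: False
        then show ?thesis using H N noH[OF H N] noV[OF V N] by simp
      qed
    qed
  qed
  then show "HP r (Suc k) = ?h" "VP (Suc r) k = ?v" by blast+
qed

lemma lines_eq:
  "r < n \<Longrightarrow> k \<le> n \<Longrightarrow> hline occupied G r k = HP r k"
  "r \<le> n \<Longrightarrow> k < n \<Longrightarrow> vline occupied G r k = VP r k"
proof -
  have "(r < n \<longrightarrow> k \<le> n \<longrightarrow> hline occupied G r k = HP r k) \<and>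
      (r \<le> n \<longrightarrow> k < n \<longrightarrow> vline occupied G r k = VP r k)" if "r + k = s" for s r k
    using that
  proof (induction s arbitrary: r k)
    case 0
    then show ?case by (simp add: HP_def VP_def)
  next
    case (Suc s)
    have "hline occupied G r k = HP r k" if "r < n" "k \<le> n"
    proof (cases k)
      case (Suc k')
      with Suc.IH[of r k'] Suc.prems that cell_step(1)[of r k'] show ?thesis
        by (simp only: Suc hline.simps Suc_le_eq less_imp_le add_Suc_right nat.inject simp_thms)
    qed (simp add: HP_def)
    moreover have "vline occupied G r k = VP r k" if "r \<le> n" "k < n"
    proof (cases r)
      case (Suc r')
      with Suc.IH[of r' k] Suc.prems that cell_step(2)[of r' k] show ?thesis
        by (simp only: Suc vline.simps Suc_le_eq less_imp_le add_Suc nat.inject simp_thms)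
    qed (simp add: VP_def)
    ultimately show ?case by blast
  qed
  then show "r < n \<Longrightarrow> k \<le> n \<Longrightarrow> hline occupied G r k = HP r k"
    "r \<le> n \<Longrightarrow> k < n \<Longrightarrow> vline occupied G r k = VP r k" by blast+
qed

text \<open>On the staircase of \<open>card_hline_diagonal\<close> the horizontal lines are the
  north-east rays that reach the axis, and the vertical lines the north-west ones; empty diagonal
  cells make this exact.\<close>

lemma height_eq_lines:
  "height x c (0, t) = ereal (real (card {r. r < n \<and> hline occupied G r n}))"
proof -
  have A: "{k. k < n \<and> hline occupied G k k} = rw ` hits_NE x c t"
  proof (intro equalityI subsetI)
    fix k assume "k \<in> {k. k < n \<and> hline occupied G k k}"
    then have "HP k k" "k < n" using lines_eq(1)[of k k] by auto
    then obtain i where i: "inside i" "rw i = k" "cl i < k" "\<And>j. (i, j) \<in> K \<Longrightarrow> k \<le> cl j"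
      by (auto simp: HP_def)
    have "v i \<le> u j" if j: "(i, j) \<in> K" for j
    proof -
      have "cl j \<noteq> rw i"
        using K_D(4)[OF j i(1)] i(2) \<open>k < n\<close> col_row_unique(3)[of j i] i(1) by auto
      then have "rw i < cl j" using i(4)[OF j] i(2) by simp
      then show ?thesis using strip_index_less[OF t] less_imp_le by blast
    qed
    moreover have "u i \<le> v i" using i(2,3) strip_index_less[OF t, of n "u i" "v i"] by simp
    ultimately have "i \<in> hits_NE x c t" using i(1) by (simp add: hits_NE_def inside_def)
    then show "k \<in> rw ` hits_NE x c t" using i(2) by auto
  next
    fix k assume "k \<in> rw ` hits_NE x c t"
    then obtain i where i: "u i \<le> v i" "v i \<le> t" "\<And>j. (i, j) \<in> K \<Longrightarrow> v i \<le> u j" "k = rw i"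
      by (auto simp: hits_NE_def)
    then have ins: "inside i" using edge[of i] by (simp add: inside_def)
    moreover have "cl i < rw i"
      using strip_index_mono[OF t i(1), of n] col_row_unique(3)[OF ins ins] by simp
    ultimately have "HP k k"
      using i(4) by (intro HP_I) (auto intro!: strip_index_mono t i(3))
    then show "k \<in> {k. k < n \<and> hline occupied G k k}"
      using ins i(4) lines_eq(1)[of k k] by (simp add: inside_iff)
  qed
  have B: "{k. k < n \<and> vline occupied G (Suc k) k} = cl ` hits_NW x c t"
  proof (intro equalityI subsetI)
    fix k assume "k \<in> {k. k < n \<and> vline occupied G (Suc k) k}"
    then have "VP (Suc k) k" "k < n" using lines_eq(2)[of "Suc k" k] by auto
    then obtain i where i: "inside i" "cl i = k" "rw i < Suc k" "\<And>j. (j, i) \<in> K \<Longrightarrow> Suc k \<le> rw j"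
      by (auto simp: VP_def)
    have "u i \<le> v j" if j: "(j, i) \<in> K" for j
    proof -
      have "cl i < rw j" using i(4)[OF j] i(2) by simp
      then show ?thesis using strip_index_less[OF t] less_imp_le by blast
    qed
    moreover have "v i \<le> u i"
      using i(2,3) col_row_unique(3)[OF i(1,1)] strip_index_less[OF t, of n "v i" "u i"] by simp
    ultimately have "i \<in> hits_NW x c t" using i(1) by (simp add: hits_NW_def inside_def)
    then show "k \<in> cl ` hits_NW x c t" using i(2) by auto
  next
    fix k assume "k \<in> cl ` hits_NW x c t"
    then obtain i where i: "v i \<le> u i" "u i \<le> t" "\<And>j. (j, i) \<in> K \<Longrightarrow> u i \<le> v j" "k = cl i"
      by (auto simp: hits_NW_def)
    then have ins: "inside i" using edge[of i] by (simp add: inside_def)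
    then have kn: "k < n" using i(4) by (simp add: inside_iff)
    have "VP (Suc k) k"
    proof (rule VP_I[OF ins])
      show "rw i < Suc k" using strip_index_mono[OF t i(1), of n] i(4) by simp
      fix j assume j: "(j, i) \<in> K"
      have "cl i \<le> rw j" by (intro strip_index_mono t i(3) j)
      moreover have "rw j \<noteq> cl i"
        using K_D(5)[OF j ins] i(4) kn col_row_unique(3)[of i j] ins by auto
      ultimately show "Suc k \<le> rw j" using i(4) by simp
    qed (use i in simp)
    then show "k \<in> {k. k < n \<and> vline occupied G (Suc k) k}"
      using kn lines_eq(2)[of "Suc k" k] by simp
  qed
  have ins: "inside i" if "i \<in> hits_NE x c t \<union> hits_NW x c t" for i
    using that edge[of i] by (auto simp: hits_NE_def hits_NW_def inside_def)
  have "inj_on rw (hits_NE x c t)" "inj_on cl (hits_NW x c t)"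
    using ins col_row_unique(1,2) by (auto simp: inj_on_def)
  then show ?thesis
    using t by (simp add: height_eq card_hline_diagonal A B card_image del: hline.simps vline.simps)
qed

end

end

section \<open>Measurability and moments\<close>

lemma borel_measurable_uv [measurable]:
  "ucoord \<in> borel_measurable borel" "vcoord \<in> borel_measurable borel"
  unfolding ucoord_def[abs_def] vcoord_def[abs_def]
  by (intro borel_measurable_continuous_onI continuous_intros)+

text \<open>The change of coordinates has Jacobian 2. It is carried out by Fubini and two
  substitutions on the line, \<open>u = s + x\<close> for fixed \<open>s\<close> and then
  \<open>v = 2 * s - u\<close> for fixed \<open>u\<close>.\<close>

lemma emeasure_uv_box:
  assumes [measurable]: "I \<in> sets borel" "J \<in> sets borel"
  shows "emeasure lborel {p. ucoord p \<in> I \<and> vcoord p \<in> J} = emeasure lborel I * emeasure lborel J / 2"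
proof -
  let ?i = "indicator I :: real \<Rightarrow> ennreal" and ?j = "indicator J :: real \<Rightarrow> ennreal"
  let ?A = "{p :: real \<times> real. ucoord p \<in> I \<and> vcoord p \<in> J}"
  have A: "?A \<in> sets (lborel \<Otimes>\<^sub>M lborel)"
    unfolding lborel_prod by measurable
  have half: "(\<integral>\<^sup>+ s. ?j (2 * s - u) \<partial>lborel) = emeasure lborel J / 2" for u :: real
  proof -
    have "emeasure lborel J = (\<integral>\<^sup>+ s. ?j s \<partial>lborel)" by simp
    also have "\<dots> = ennreal \<bar>2\<bar> * (\<integral>\<^sup>+ s. ?j (- u + 2 * s) \<partial>lborel)"
      by (rule nn_integral_real_affine) auto
    also have "(\<integral>\<^sup>+ s. ?j (- u + 2 * s) \<partial>lborel) = (\<integral>\<^sup>+ s. ?j (2 * s - u) \<partial>lborel)"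
      by (simp add: algebra_simps)
    finally have "emeasure lborel J / 2 = 2 * (\<integral>\<^sup>+ s. ?j (2 * s - u) \<partial>lborel) / 2" by simp
    also have "\<dots> = (\<integral>\<^sup>+ s. ?j (2 * s - u) \<partial>lborel)"
      by (subst mult.commute) (rule mult_divide_eq_ennreal, simp_all)
    finally show ?thesis by simp
  qed
  have "emeasure lborel ?A = (\<integral>\<^sup>+ p. indicator ?A p \<partial>(lborel \<Otimes>\<^sub>M lborel))"
    using A by (simp add: lborel_prod)
  also have "\<dots> = (\<integral>\<^sup>+ s. \<integral>\<^sup>+ x. indicator ?A (x, s) \<partial>lborel \<partial>lborel)"
    by (rule lborel_pair.nn_integral_snd[symmetric]) (use A in measurable)
  also have "\<dots> = (\<integral>\<^sup>+ s. \<integral>\<^sup>+ u. ?i u * ?j (2 * s - u) \<partial>lborel \<partial>lborel)"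
  proof (rule nn_integral_cong)
    fix s :: real
    have "(\<integral>\<^sup>+ x. indicator ?A (x, s) \<partial>lborel) = (\<integral>\<^sup>+ x. ?i (s + x) * ?j (s - x) \<partial>lborel)"
      by (intro nn_integral_cong) (auto simp: ucoord_def vcoord_def indicator_def)
    also have "\<dots> = ennreal \<bar>1\<bar> * (\<integral>\<^sup>+ u. ?i (s + (- s + 1 * u)) * ?j (s - (- s + 1 * u)) \<partial>lborel)"
      by (rule nn_integral_real_affine[where t = "- s" and c = 1]) auto
    finally show "(\<integral>\<^sup>+ x. indicator ?A (x, s) \<partial>lborel) = (\<integral>\<^sup>+ u. ?i u * ?j (2 * s - u) \<partial>lborel)"
      by (simp add: algebra_simps)
  qed
  also have "\<dots> = (\<integral>\<^sup>+ u. \<integral>\<^sup>+ s. ?i u * ?j (2 * s - u) \<partial>lborel \<partial>lborel)"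
    by (rule lborel_pair.Fubini') measurable
  also have "\<dots> = (\<integral>\<^sup>+ u. ?i u * (emeasure lborel J / 2) \<partial>lborel)"
    by (simp add: nn_integral_cmult half)
  also have "\<dots> = emeasure lborel I * emeasure lborel J / 2"
    by (subst nn_integral_multc) (simp_all add: ennreal_times_divide)
  finally show ?thesis .
qed

lemma measure_uv_box:
  assumes "I \<in> sets borel" "J \<in> sets borel" "emeasure lborel I = ennreal a" "emeasure lborel J = ennreal b"
    "0 \<le> a" "0 \<le> b"
  shows "measure lborel {p. ucoord p \<in> I \<and> vcoord p \<in> J} = a * b / 2"
proof -
  have "emeasure lborel {p. ucoord p \<in> I \<and> vcoord p \<in> J} = ennreal (a * b / 2)"
    using assms emeasure_uv_box[OF assms(1,2)]
    by (simp add: ennreal_mult[symmetric] divide_ennreal[symmetric] ennreal_numeral[symmetric] del: ennreal_numeral)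
  then show ?thesis using assms by (simp add: measure_def)
qed

section \<open>Measurability of the dynamics and exponential moments of the height\<close>

context configuration
begin

definition meets :: "nat \<times> nat \<Rightarrow> bool" where
  "meets e \<longleftrightarrow> fst e \<noteq> snd e \<and> rays_meet (x (fst e)) (x (snd e)) \<and> \<not> c e"

abbreviation "\<tau> e \<equiv> meet_time (x (fst e)) (x (snd e))"
abbreviation (input) "conflict a e \<equiv> fst a = fst e \<or> snd a = snd e"

lemma finite_meets: "finite {e. meets e \<and> \<tau> e \<le> s}"
proof (rule finite_subset)
  show "{e. meets e \<and> \<tau> e \<le> s} \<subseteq> {i. snd (x i) \<le> s} \<times> {i. snd (x i) \<le> s}"
    using rays_meet_time by (fastforce simp: meets_def)
qed (intro finite_cartesian_product finite_early_points cone lf)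

lemma K_pair: "e \<in> K \<longleftrightarrow> meets e \<and> (\<forall>a\<in>K. conflict a e \<longrightarrow> \<tau> e \<le> \<tau> a)"
proof -
  obtain i j where e: "e = (i, j)" by (cases e)
  have "(i, j) \<in> K \<longleftrightarrow> i \<noteq> j \<and> rays_meet (x i) (x j) \<and> \<not> c (i, j) \<and>
        (\<forall>j'. (i, j') \<in> K \<longrightarrow> meet_time (x i) (x j) \<le> meet_time (x i) (x j')) \<and>
        (\<forall>i'. (i', j) \<in> K \<longrightarrow> meet_time (x i) (x j) \<le> meet_time (x i') (x j))"
    using K_rule unfolding termination_rule_def by blast
  then show ?thesis unfolding e by (auto simp: meets_def)
qed

text \<open>Membership of \<open>K\<close> in terms of countably many conditions, for measurability.\<close>

lemma K_finite_approx:
  "e0 \<in> K \<longleftrightarrow> (\<exists>as. e0 \<in> set as \<and>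
     (\<forall>e. \<tau> e \<le> \<tau> e0 \<longrightarrow> (e \<in> set as \<longleftrightarrow> meets e \<and> (\<forall>a\<in>set as. conflict a e \<longrightarrow> \<tau> e \<le> \<tau> a))))"
  (is "_ \<longleftrightarrow> ?ex")
proof
  assume e0: "e0 \<in> K"
  \<comment> \<open>The rule for a pair refers only to earlier terminations, so those up to the time
    \<open>\<tau> e0\<close> determine each other, and they are finitely many.\<close>
  let ?A = "{e \<in> K. \<tau> e \<le> \<tau> e0}"
  have "?A \<subseteq> {e. meets e \<and> \<tau> e \<le> \<tau> e0}" using K_pair by blast
  then have "finite ?A" using finite_meets finite_subset by blast
  moreover have "e \<in> ?A \<longleftrightarrow> meets e \<and> (\<forall>a\<in>?A. conflict a e \<longrightarrow> \<tau> e \<le> \<tau> a)" if e: "\<tau> e \<le> \<tau> e0" for e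
  proof -
    have "(\<forall>a\<in>K. conflict a e \<longrightarrow> \<tau> e \<le> \<tau> a) \<longleftrightarrow> (\<forall>a\<in>?A. conflict a e \<longrightarrow> \<tau> e \<le> \<tau> a)"
      using e by (smt (verit) mem_Collect_eq)
    then show ?thesis using e K_pair[of e] by simp
  qed
  moreover from calculation(1) obtain as where "set as = ?A" using finite_list by blast
  ultimately show ?ex
    using e0 by (intro exI[of _ as]) auto
next
  assume ?ex
  then obtain as where A: "e0 \<in> set as"
    "\<And>e. \<tau> e \<le> \<tau> e0 \<Longrightarrow> e \<in> set as \<longleftrightarrow> meets e \<and> (\<forall>a\<in>set as. conflict a e \<longrightarrow> \<tau> e \<le> \<tau> a)" by blast
  \<comment> \<open>The finite system of conditions has no solution other than \<open>K\<close> up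
    to this time, by induction on the number of possible earlier meetings.\<close>
  let ?m = "\<lambda>e. card {a. meets a \<and> \<tau> a < \<tau> e}"
  have "\<tau> e \<le> \<tau> e0 \<longrightarrow> (e \<in> set as \<longleftrightarrow> e \<in> K)" for e
  proof (induction e rule: measure_induct_rule[of ?m])
    case (less e)
    show ?case
    proof
      assume e: "\<tau> e \<le> \<tau> e0"
      have IH: "a \<in> set as \<longleftrightarrow> a \<in> K" if "meets a" "\<tau> a < \<tau> e" for a
      proof -
        have fin: "finite {b. meets b \<and> \<tau> b < \<tau> e}"
          by (rule finite_subset[OF _ finite_meets[of "\<tau> e"]]) auto
        have "?m a < ?m e"
          by (rule psubset_card_mono[OF fin]) (use that in auto)
        with less.IH[of a] that e show ?thesis by simp
      qed
      have "(\<forall>a\<in>set as. conflict a e \<longrightarrow> \<tau> e \<le> \<tau> a) \<longleftrightarrow> (\<forall>a\<in>K. conflict a e \<longrightarrow> \<tau> e \<le> \<tau> a)"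
      proof -
        have "meets a" if "a \<in> set as" "\<tau> a < \<tau> e" for a using A(2)[of a] that e by simp
        moreover have "meets a" if "a \<in> K" for a using K_pair that by blast
        ultimately show ?thesis using IH by (meson not_less)
      qed
      then show "e \<in> set as \<longleftrightarrow> e \<in> K" using A(2)[OF e] K_pair[of e] by simp
    qed
  qed
  then show "e0 \<in> K" using A(1) by blast
qed

end

locale png = q_png M q "2 * (1 - q)" X B for M q X B +
  fixes z :: real
  assumes z: "1 < z"
begin

lemma X_measurable [measurable]: "X i \<in> borel_measurable M"
  using points by (simp add: poisson_process_on_cone_def)

lemma B_measurable [measurable]: "B e \<in> measurable M (count_space UNIV)"
  using coins_indep by (cases e) (simp add: indep_vars_def2)

lemma config: "\<omega> \<in> space M \<Longrightarrow> configuration (\<lambda>i. X i \<omega>)"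
  using points by unfold_locales (auto simp: poisson_process_on_cone_def)

abbreviation "xs \<omega> \<equiv> \<lambda>i. X i \<omega>"
abbreviation "cs \<omega> \<equiv> \<lambda>e. B e \<omega>"

lemma termination_measurable [measurable]:
  "Measurable.pred M (\<lambda>\<omega>. e \<in> terminations (xs \<omega>) (cs \<omega>))"
proof -
  have [measurable]: "(\<lambda>\<omega>. meet_time (X i \<omega>) (X j \<omega>)) \<in> borel_measurable M" for i j
    unfolding meet_time_uv by measurable
  have [measurable]: "Measurable.pred M (\<lambda>\<omega>. rays_meet (X i \<omega>) (X j \<omega>))" for i j
    unfolding rays_meet_iff by measurable
  have "Measurable.pred M (\<lambda>\<omega>. \<exists>as. e \<in> set as \<and>
     (\<forall>e'. meet_time (X (fst e') \<omega>) (X (snd e') \<omega>) \<le> meet_time (X (fst e) \<omega>) (X (snd e) \<omega>) \<longrightarrow>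
       (e' \<in> set as \<longleftrightarrow> (fst e' \<noteq> snd e' \<and> rays_meet (X (fst e') \<omega>) (X (snd e') \<omega>) \<and> \<not> B e' \<omega>) \<and>
         (\<forall>a\<in>set as. fst a = fst e' \<or> snd a = snd e' \<longrightarrow>
           meet_time (X (fst e') \<omega>) (X (snd e') \<omega>) \<le> meet_time (X (fst a) \<omega>) (X (snd a) \<omega>)))))"
    by measurable
  then show ?thesis
    by (rule measurable_cong[THEN iffD2, rotated])
      (simp add: configuration.K_finite_approx[OF config] configuration.meets_def[OF config])
qed

definition H :: "real \<Rightarrow> 'a \<Rightarrow> nat" where
  "H t \<omega> = card (hits_NE (xs \<omega>) (cs \<omega>) t) + card (hits_NW (xs \<omega>) (cs \<omega>) t)"

lemma H_measurable [measurable]: "H t \<in> measurable M (count_space UNIV)"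
proof -
  have [measurable]: "Measurable.pred M (\<lambda>\<omega>. i \<in> hits_NE (xs \<omega>) (cs \<omega>) t)"
    "Measurable.pred M (\<lambda>\<omega>. i \<in> hits_NW (xs \<omega>) (cs \<omega>) t)" for i
    unfolding hits_NE_def hits_NW_def by measurable
  show ?thesis unfolding H_def[abs_def] by measurable
qed

lemma png_height_eq: "0 \<le> t \<Longrightarrow> \<omega> \<in> space M \<Longrightarrow> png_height X B (0, t) \<omega> = ereal (real (H t \<omega>))"
  unfolding png_height_def H_def by (rule configuration.height_eq[OF config])

lemma count_measurable [measurable]:
  assumes [measurable]: "A \<in> sets borel"
  shows "point_count X A \<in> measurable M (count_space UNIV)"
  unfolding point_count_def[abs_def] by measurable

lemma count_prob:
  assumes "A \<in> sets borel" "bounded A" "A \<subseteq> forward_cone"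
  shows "\<P>(\<omega> in M. point_count X A \<omega> = k) =
    (2 * (1 - q) * measure lborel A) ^ k / fact k * exp (- (2 * (1 - q) * measure lborel A))"
  using points assms by (simp add: poisson_process_on_cone_def Int_absorb2)

lemma integrable_power_count:
  fixes w :: real
  assumes A: "A \<in> sets borel" "bounded A" "A \<subseteq> forward_cone" and w: "0 \<le> w"
  shows "integrable M (\<lambda>\<omega>. w ^ point_count X A \<omega>)"
proof (rule integrableI_nonneg)
  note [measurable] = A(1)
  show "(\<lambda>\<omega>. w ^ point_count X A \<omega>) \<in> borel_measurable M" by measurable
  show "AE \<omega> in M. 0 \<le> w ^ point_count X A \<omega>" using w by simp
  let ?m = "2 * (1 - q) * measure lborel A"
  let ?E = "\<lambda>k. {\<omega>\<in>space M. point_count X A \<omega> = k}"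
  have m: "0 \<le> ?m" using q_less_1 by simp
  have "(\<integral>\<^sup>+ \<omega>. ennreal (w ^ point_count X A \<omega>) \<partial>M) =
      (\<integral>\<^sup>+ \<omega>. (\<Sum>k. ennreal (w ^ k) * indicator (?E k) \<omega>) \<partial>M)"
  proof (rule nn_integral_cong)
    fix \<omega> assume "\<omega> \<in> space M"
    then have "(\<Sum>k. ennreal (w ^ k) * indicator (?E k) \<omega>) =
        (\<Sum>k\<in>{point_count X A \<omega>}. ennreal (w ^ k) * indicator (?E k) \<omega>)"
      by (intro suminf_finite) auto
    then show "ennreal (w ^ point_count X A \<omega>) = (\<Sum>k. ennreal (w ^ k) * indicator (?E k) \<omega>)"
      using \<open>\<omega> \<in> space M\<close> by simp
  qed
  also have "\<dots> = (\<Sum>k. ennreal (w ^ k) * emeasure M (?E k))"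
    by (subst nn_integral_suminf) (auto simp: nn_integral_cmult_indicator)
  also have "\<dots> = (\<Sum>k. ennreal (exp (- ?m) * ((w * ?m) ^ k / fact k)))"
  proof (intro suminf_cong)
    fix k
    have "ennreal (w ^ k) * emeasure M (?E k) = ennreal (w ^ k) * ennreal (?m ^ k / fact k * exp (- ?m))"
      by (simp only: emeasure_eq_measure count_prob[OF A])
    also have "\<dots> = ennreal (w ^ k * (?m ^ k / fact k * exp (- ?m)))"
      by (subst ennreal_mult) (use w m in auto)
    also have "w ^ k * (?m ^ k / fact k * exp (- ?m)) = exp (- ?m) * ((w * ?m) ^ k / fact k)"
      by (simp add: power_mult_distrib)
    finally show "ennreal (w ^ k) * emeasure M (?E k) = ennreal (exp (- ?m) * ((w * ?m) ^ k / fact k))" .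
  qed
  also have "\<dots> < \<infinity>"
  proof -
    have "summable (\<lambda>k. exp (- ?m) * ((w * ?m) ^ k / fact k))"
      using summable_exp[of "w * ?m"] by (intro summable_mult) (simp add: field_simps)
    then have "(\<Sum>k. ennreal (exp (- ?m) * ((w * ?m) ^ k / fact k))) \<noteq> \<top>"
      by (rule ennreal_suminf_neq_top) (use w m in auto)
    then show ?thesis by (simp add: less_top)
  qed
  finally show "(\<integral>\<^sup>+ \<omega>. ennreal (w ^ point_count X A \<omega>) \<partial>M) < \<infinity>" .
qed

lemma diamond_borel [measurable]: "diamond t \<in> sets borel"
  unfolding diamond_def by measurable

lemma diamond_cone: "diamond t \<subseteq> forward_cone"
  by (auto simp: diamond_def cone_uv)

abbreviation "N t \<equiv> point_count X (diamond t)"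

lemma H_le:
  assumes "\<omega> \<in> space M"
  shows "H t \<omega> \<le> 2 * N t \<omega>"
proof -
  interpret configuration "xs \<omega>" "cs \<omega>" by (rule config[OF assms])
  have "card (hits_NE (xs \<omega>) (cs \<omega>) t) \<le> N t \<omega>" "card (hits_NW (xs \<omega>) (cs \<omega>) t) \<le> N t \<omega>"
    unfolding point_count_def using hits_subset lf[OF bounded_diamond]
    by (auto intro!: card_mono)
  then show ?thesis by (simp add: H_def)
qed

abbreviation "mgf t \<equiv> \<integral>\<omega>. z ^ H t \<omega> \<partial>M"

lemma integrable_H: "integrable M (\<lambda>\<omega>. z ^ H t \<omega>)"
proof (rule Bochner_Integration.integrable_bound)
  show "integrable M (\<lambda>\<omega>. (z\<^sup>2) ^ N t \<omega>)"
    using bounded_diamond diamond_cone by (intro integrable_power_count) auto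
  show "AE \<omega> in M. norm (z ^ H t \<omega>) \<le> norm ((z\<^sup>2) ^ N t \<omega>)"
    using z H_le by (intro AE_I2) (simp add: power_mult[symmetric] power_increasing)
qed measurable

end

section \<open>Discretization\<close>

definition strip :: "real \<Rightarrow> nat \<Rightarrow> nat \<Rightarrow> real set" where
  "strip t n k = {real k * t / real n ..< real (Suc k) * t / real n}"

definition cell :: "real \<Rightarrow> nat \<Rightarrow> nat \<times> nat \<Rightarrow> (real \<times> real) set" where
  "cell t n e = {p. ucoord p \<in> strip t n (snd e) \<and> vcoord p \<in> strip t n (fst e)}"

definition row_strip :: "real \<Rightarrow> nat \<Rightarrow> nat \<Rightarrow> (real \<times> real) set" where
  "row_strip t n k = {p. ucoord p \<in> {0..<t} \<and> vcoord p \<in> strip t n k}"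

definition col_strip :: "real \<Rightarrow> nat \<Rightarrow> nat \<Rightarrow> (real \<times> real) set" where
  "col_strip t n k = {p. ucoord p \<in> strip t n k \<and> vcoord p \<in> {0..<t}}"

definition upper_edges :: "real \<Rightarrow> (real \<times> real) set" where
  "upper_edges t = {p. ucoord p \<in> {t} \<and> vcoord p \<in> {0..t}} \<union> {p. ucoord p \<in> {0..t} \<and> vcoord p \<in> {t}}"

text \<open>The conditions of \<open>separated\<close> in terms of counts of points in fixed
  regions, to which the Poisson law applies. One count of the union of row and column
  \<open>k\<close> excludes a shared row, a shared column and a column equal to the row of another
  point.\<close>

definition good :: "real \<Rightarrow> nat \<Rightarrow> (nat \<Rightarrow> real \<times> real) \<Rightarrow> bool" where
  "good t n x \<longleftrightarrow> (\<forall>k<n. card {i. x i \<in> row_strip t n k \<union> col_strip t n k} \<le> 1) \<and>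
     (\<forall>k<n. card {i. x i \<in> cell t n (k, k)} = 0) \<and> card {i. x i \<in> upper_edges t} = 0"

definition occ :: "real \<Rightarrow> nat \<Rightarrow> (nat \<Rightarrow> real \<times> real) \<Rightarrow> (nat \<times> nat) set" where
  "occ t n x = {e \<in> {..<n} \<times> {..<n}. card {i. x i \<in> cell t n e} \<noteq> 0}"

text \<open>
  Indices of the points in the rows and columns. The empty ones get pairwise distinct indices of
  points outside the diamond, so that the coins of all cells are independent.
\<close>

definition past_diamond :: "real \<Rightarrow> (nat \<Rightarrow> real \<times> real) \<Rightarrow> nat" where
  "past_diamond t x = (LEAST m. \<forall>i. x i \<in> diamond t \<longrightarrow> i < m)"

definition row_point :: "real \<Rightarrow> nat \<Rightarrow> (nat \<Rightarrow> real \<times> real) \<Rightarrow> nat \<Rightarrow> nat" where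
  "row_point t n x r = (if \<exists>i. x i \<in> row_strip t n r then LEAST i. x i \<in> row_strip t n r
     else past_diamond t x + r)"

definition col_point :: "real \<Rightarrow> nat \<Rightarrow> (nat \<Rightarrow> real \<times> real) \<Rightarrow> nat \<Rightarrow> nat" where
  "col_point t n x k = (if \<exists>i. x i \<in> col_strip t n k then LEAST i. x i \<in> col_strip t n k
     else past_diamond t x + k)"

lemma strip_borel [measurable]: "strip t n k \<in> sets borel"
  unfolding strip_def by simp

lemma sets_borel [measurable]:
  "cell t n e \<in> sets borel" "row_strip t n k \<in> sets borel" "col_strip t n k \<in> sets borel"
  "upper_edges t \<in> sets borel"
  unfolding cell_def row_strip_def col_strip_def upper_edges_def by measurable

context
  fixes t :: real and n :: nat
  assumes t: "0 < t" and n: "0 < n"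
begin

lemma strip_index_iff: "0 \<le> a \<Longrightarrow> strip_index t n a = k \<longleftrightarrow> a \<in> strip t n k"
  using strip_index_less_iff[OF t n, of a k] strip_index_less_iff[OF t n, of a "Suc k"]
  by (auto simp: strip_def)

lemma strip_index_mem: "0 \<le> a \<Longrightarrow> a \<in> strip t n (strip_index t n a)"
  using strip_index_iff by blast

lemma cell_iff:
  "p \<in> forward_cone \<Longrightarrow> p \<in> cell t n e \<longleftrightarrow> e = (strip_index t n (vcoord p), strip_index t n (ucoord p))"
  using strip_index_iff[of "vcoord p" "fst e"] strip_index_iff[of "ucoord p" "snd e"]
  by (cases e) (auto simp: cell_def cone_uv)

lemma strip_sub: "k < n \<Longrightarrow> strip t n k \<subseteq> {0..<t}"
proof -
  assume "k < n"
  then have "real (Suc k) * t / real n \<le> t"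
    using t n by (simp add: field_simps del: of_nat_Suc)
  moreover have "0 \<le> real k * t / real n" using t by simp
  ultimately show ?thesis by (auto simp: strip_def simp del: of_nat_Suc)
qed

lemma emeasure_strip: "emeasure lborel (strip t n k) = ennreal (t / real n)"
  using t n by (simp add: strip_def divide_right_mono mult_right_mono diff_divide_distrib[symmetric] left_diff_distrib[symmetric])

lemma regions:
  assumes "k < n"
  shows "row_strip t n k \<subseteq> diamond t" "col_strip t n k \<subseteq> diamond t" "r < n \<Longrightarrow> cell t n (r, k) \<subseteq> diamond t"
    "upper_edges t \<subseteq> diamond t"
  using strip_sub[OF assms] strip_sub[of r] t
  by (fastforce simp: row_strip_def col_strip_def cell_def upper_edges_def diamond_def)+

lemma region_measure:
  "measure lborel (cell t n e) = (t / real n)\<^sup>2 / 2"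
  "measure lborel (row_strip t n k \<union> col_strip t n k) \<le> t\<^sup>2 / real n"
  "measure lborel (upper_edges t) = 0"
proof -
  have s: "0 \<le> t / real n" using t by simp
  show "measure lborel (cell t n e) = (t / real n)\<^sup>2 / 2"
    unfolding cell_def power2_eq_square
    by (rule measure_uv_box) (use s in \<open>auto simp: emeasure_strip\<close>)
  have "measure lborel (row_strip t n k) = t * (t / real n) / 2"
    unfolding row_strip_def by (rule measure_uv_box) (use s t in \<open>auto simp: emeasure_strip\<close>)
  moreover have "measure lborel (col_strip t n k) = t / real n * t / 2"
    unfolding col_strip_def by (rule measure_uv_box) (use s t in \<open>auto simp: emeasure_strip\<close>)
  moreover have "measure lborel (row_strip t n k \<union> col_strip t n k) \<le>
      measure lborel (row_strip t n k) + measure lborel (col_strip t n k)"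
    by (rule measure_Un_le) auto
  ultimately show "measure lborel (row_strip t n k \<union> col_strip t n k) \<le> t\<^sup>2 / real n"
    by (simp add: power2_eq_square)
  have "measure lborel {p. ucoord p \<in> {t} \<and> vcoord p \<in> {0..t}} = 0 * t / 2"
    by (rule measure_uv_box) (use t in auto)
  moreover have "measure lborel {p. ucoord p \<in> {0..t} \<and> vcoord p \<in> {t}} = t * 0 / 2"
    by (rule measure_uv_box) (use t in auto)
  moreover have "measure lborel (upper_edges t) \<le> measure lborel {p. ucoord p \<in> {t} \<and> vcoord p \<in> {0..t}} +
      measure lborel {p. ucoord p \<in> {0..t} \<and> vcoord p \<in> {t}}"
    unfolding upper_edges_def by (rule measure_Un_le; measurable)
  ultimately show "measure lborel (upper_edges t) = 0"
    using measure_nonneg[of lborel "upper_edges t"] by linarith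
qed

lemma good_separated:
  assumes "configuration x" "good t n x"
  shows "separated x t n"
proof -
  interpret configuration x undefined by (rule assms(1))
  have fin: "finite {i. x i \<in> A}" if "A \<subseteq> diamond t" for A
    by (rule lf[OF bounded_subset[OF bounded_diamond that]])
  have one: "i = j" if "x i \<in> row_strip t n k \<union> col_strip t n k"
      "x j \<in> row_strip t n k \<union> col_strip t n k" "k < n" for i j k
  proof -
    have "finite {i. x i \<in> row_strip t n k \<union> col_strip t n k}"
      by (rule fin) (use regions(1,2)[OF that(3)] in auto)
    moreover have "card {i. x i \<in> row_strip t n k \<union> col_strip t n k} \<le> Suc 0"
      using assms(2) that(3) by (simp add: good_def)
    ultimately show ?thesis using that by (simp only: card_le_Suc0_iff_eq) blast
  qed
  have idx: "strip_index t n (u i) < n" "strip_index t n (v i) < n"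
    "x i \<in> col_strip t n (strip_index t n (u i))" "x i \<in> row_strip t n (strip_index t n (v i))"
    if "u i < t" "v i < t" for i
    using that strip_index_less_iff[OF t n, of _ n] n uv_nonneg strip_index_mem
    by (auto simp: col_strip_def row_strip_def)
  show ?thesis
  proof unfold_locales
    fix i assume "u i \<le> t" "v i \<le> t"
    moreover have "x i \<notin> upper_edges t"
    proof -
      have "finite {i. x i \<in> upper_edges t}" by (rule fin) (rule regions(4)[OF n])
      then have "{i. x i \<in> upper_edges t} = {}" using assms(2) by (simp add: good_def)
      then show ?thesis by blast
    qed
    ultimately show "u i < t \<and> v i < t"
      using uv_nonneg[of i] by (auto simp: upper_edges_def)
  next
    fix i j assume ij: "i \<noteq> j" "u i < t" "v i < t" "u j < t" "v j < t"
    note I = idx[OF ij(2,3)] and J = idx[OF ij(4,5)]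
    show "strip_index t n (u i) \<noteq> strip_index t n (u j) \<and> strip_index t n (v i) \<noteq> strip_index t n (v j)
      \<and> strip_index t n (u i) \<noteq> strip_index t n (v j)"
      using ij(1) one[of i "strip_index t n (u i)" j] one[of i "strip_index t n (v i)" j] I J by auto
  next
    fix i assume i: "u i < t" "v i < t"
    show "strip_index t n (u i) \<noteq> strip_index t n (v i)"
    proof
      assume e: "strip_index t n (u i) = strip_index t n (v i)"
      let ?k = "strip_index t n (u i)"
      have k: "?k < n" using idx(1)[OF i] .
      have "finite {i. x i \<in> cell t n (?k, ?k)}" by (rule fin) (rule regions(3)[OF k k])
      moreover have "card {i. x i \<in> cell t n (?k, ?k)} = 0" using assms(2) k unfolding good_def by blast
      ultimately have "{i. x i \<in> cell t n (?k, ?k)} = {}" by (simp only: card_0_eq)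
      moreover have "x i \<in> cell t n (?k, ?k)"
        using e uv_nonneg[of i] strip_index_mem[of "u i"] strip_index_mem[of "v i"] by (simp add: cell_def)
      ultimately show False by blast
    qed
  qed (use t n in auto)
qed

lemma card_occ_le:
  assumes "configuration x"
  shows "card (occ t n x) \<le> card {i. x i \<in> diamond t}"
proof -
  interpret configuration x undefined by (rule assms(1))
  have fin: "finite {i. x i \<in> diamond t}" by (rule lf[OF bounded_diamond])
  have "occ t n x \<subseteq> (\<lambda>i. (strip_index t n (v i), strip_index t n (u i))) ` {i. x i \<in> diamond t}"
  proof
    fix e assume e: "e \<in> occ t n x"
    then have "{i. x i \<in> cell t n e} \<noteq> {}" by (auto simp: occ_def simp del: Collect_empty_eq)
    then obtain i where i: "x i \<in> cell t n e" by blast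
    have "x i \<in> diamond t" using e i regions(3)[of "snd e" "fst e"] by (auto simp: occ_def)
    moreover have "e = (strip_index t n (v i), strip_index t n (u i))"
      using i cell_iff[OF cone] by blast
    ultimately show "e \<in> (\<lambda>i. (strip_index t n (v i), strip_index t n (u i))) ` {i. x i \<in> diamond t}"
      by blast
  qed
  then show "card (occ t n x) \<le> card {i. x i \<in> diamond t}"
    by (rule surj_card_le[OF fin])
qed

lemma past_diamond:
  assumes "configuration x" "x i \<in> diamond t"
  shows "i < past_diamond t x"
proof -
  interpret configuration x undefined by (rule assms(1))
  have "finite {i. x i \<in> diamond t}" by (rule lf[OF bounded_diamond])
  then obtain m where "\<forall>i. x i \<in> diamond t \<longrightarrow> i < m"
    using finite_nat_set_iff_bounded by auto
  then have "\<forall>i. x i \<in> diamond t \<longrightarrow> i < past_diamond t x"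
    unfolding past_diamond_def by (rule LeastI)
  then show ?thesis using assms(2) by blast
qed

lemma strip_disjoint: "a \<in> strip t n k \<Longrightarrow> a \<in> strip t n k' \<Longrightarrow> 0 \<le> a \<Longrightarrow> k = k'"
  using strip_index_iff[of a k] strip_index_iff[of a k'] by simp

lemma strip_nonneg: "a \<in> strip t n k \<Longrightarrow> 0 \<le> a"
proof -
  have "0 \<le> real k * t / real n" using t by simp
  then show "a \<in> strip t n k \<Longrightarrow> 0 \<le> a" by (auto simp: strip_def)
qed

lemma inj_points:
  assumes "configuration x"
  shows "inj_on (row_point t n x) {..<n}" "inj_on (col_point t n x) {..<n}"
proof -
  have gen: "inj_on (\<lambda>k. if \<exists>i. x i \<in> A k then LEAST i. x i \<in> A k else past_diamond t x + k) {..<n}"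
    if sub: "\<And>k. k < n \<Longrightarrow> A k \<subseteq> diamond t" and disj: "\<And>k l p. p \<in> A k \<Longrightarrow> p \<in> A l \<Longrightarrow> k = l" for A
  proof -
    have L: "x (LEAST i. x i \<in> A k) \<in> A k" if "\<exists>i. x i \<in> A k" for k
      using LeastI_ex[OF that] .
    have lt: "(LEAST i. x i \<in> A k) < past_diamond t x" if "\<exists>i. x i \<in> A k" "k < n" for k
      using past_diamond[OF assms] L[OF that(1)] sub[OF that(2)] by blast
    show ?thesis
    proof (rule inj_onI)
      fix k l assume kl: "k \<in> {..<n}" "l \<in> {..<n}"
        "(if \<exists>i. x i \<in> A k then LEAST i. x i \<in> A k else past_diamond t x + k) =
         (if \<exists>i. x i \<in> A l then LEAST i. x i \<in> A l else past_diamond t x + l)"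
      show "k = l"
      proof (cases "\<exists>i. x i \<in> A k"; cases "\<exists>i. x i \<in> A l")
        assume a: "\<exists>i. x i \<in> A k" "\<exists>i. x i \<in> A l"
        then have "(LEAST i. x i \<in> A k) = (LEAST i. x i \<in> A l)" using kl(3) by (simp only: if_True)
        then show ?thesis using L[OF a(1)] L[OF a(2)] disj by metis
      next
        assume a: "\<exists>i. x i \<in> A k" "\<nexists>i. x i \<in> A l"
        then show ?thesis using lt[OF a(1)] kl by (simp only: if_True if_False) simp
      next
        assume a: "\<nexists>i. x i \<in> A k" "\<exists>i. x i \<in> A l"
        then have "past_diamond t x + k = (LEAST i. x i \<in> A l)" using kl(3) by (simp only: if_True if_False)
        then show ?thesis using lt[OF a(2)] kl by simp
      next
        assume a: "\<nexists>i. x i \<in> A k" "\<nexists>i. x i \<in> A l"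
        then show ?thesis using kl(3) by (simp only: if_False)
      qed
    qed
  qed
  show "inj_on (row_point t n x) {..<n}"
    unfolding row_point_def[abs_def]
    by (rule gen) (use regions(1) strip_disjoint strip_nonneg in \<open>auto simp: row_strip_def\<close>)
  show "inj_on (col_point t n x) {..<n}"
    unfolding col_point_def[abs_def]
    by (rule gen) (use regions(2) strip_disjoint strip_nonneg in \<open>auto simp: col_strip_def\<close>)
qed

text \<open>On a good configuration every occupied row and column has exactly one point, so
  \<open>row_point\<close> and \<open>col_point\<close> name the rays that can meet in a cell, and
  \<open>G\<close> consults their coin.\<close>

lemma height_good:
  fixes c :: "nat \<times> nat \<Rightarrow> bool"
  assumes "configuration x" "good t n x"
  defines "G \<equiv> {e \<in> {..<n} \<times> {..<n}. c (row_point t n x (fst e), col_point t n x (snd e))}"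
  shows "height x c (0, t) = ereal (real (card {r. r < n \<and> hline (occ t n x) G r n}))"
proof -
  interpret separated x c t n by (rule good_separated[OF assms(1,2)])
  have row: "x i \<in> row_strip t n r \<longleftrightarrow> inside i \<and> rw i = r" if "r < n" for i r
    using strip_index_iff[OF uv_nonneg(2)[of i]] strip_sub[OF that] uv_nonneg[of i]
    by (auto simp: row_strip_def inside_def)
  have col: "x i \<in> col_strip t n r \<longleftrightarrow> inside i \<and> cl i = r" if "r < n" for i r
    using strip_index_iff[OF uv_nonneg(1)[of i]] strip_sub[OF that] uv_nonneg[of i]
    by (auto simp: col_strip_def inside_def)
  have rp: "row_point t n x (rw i) = i" "col_point t n x (cl i) = i" if "inside i" for i
  proof -
    have n': "rw i < n" "cl i < n" using that by (auto simp: inside_iff)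
    have "x j \<in> row_strip t n (rw i) \<longleftrightarrow> j = i" "x j \<in> col_strip t n (cl i) \<longleftrightarrow> j = i" for j
      using row[OF n'(1)] col[OF n'(2)] that col_row_unique(1,2) by blast+
    moreover have "(LEAST j. j = i) = i" by (rule Least_equality) auto
    ultimately show "row_point t n x (rw i) = i" "col_point t n x (cl i) = i"
      by (simp_all add: row_point_def col_point_def)
  qed
  have "occ t n x = occupied"
  proof (intro equalityI subsetI)
    fix e assume e: "e \<in> occ t n x"
    then have "{i. x i \<in> cell t n e} \<noteq> {}" by (auto simp: occ_def simp del: Collect_empty_eq)
    then obtain i where i: "x i \<in> cell t n e" by blast
    have "e = (rw i, cl i)" using i cell_iff[OF cone] by blast
    then show "e \<in> occupied" using e by (auto simp: occ_def occupied_def inside_iff)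
  next
    fix e assume "e \<in> occupied"
    then obtain i where i: "inside i" "e = (rw i, cl i)" by (auto simp: occupied_def)
    then have e: "e \<in> {..<n} \<times> {..<n}" by (simp add: inside_iff)
    have "x i \<in> cell t n e" using i(2) uv_nonneg[of i] strip_index_mem by (simp add: cell_def)
    moreover have "finite {i. x i \<in> cell t n e}"
      using e regions(3)[of "snd e" "fst e"] by (intro lf bounded_subset[OF bounded_diamond]) auto
    ultimately have "card {i. x i \<in> cell t n e} \<noteq> 0" by (subst card_0_eq) blast+
    then show "e \<in> occ t n x" using e by (simp add: occ_def)
  qed
  moreover have "(rw i, cl j) \<in> G \<longleftrightarrow> c (i, j)" if "inside i" "inside j" for i j
    using that rp by (simp add: G_def inside_iff)
  ultimately show ?thesis using height_eq_lines[of G] by simp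
qed

end

section \<open>Law of the discretized process and error of the discretization\<close>

locale png_mesh = png +
  fixes t :: real and n :: nat
  assumes t: "0 < t" and n: "0 < n"
begin

abbreviation "cells \<equiv> {..<n} \<times> {..<n}"

definition coins :: "'a \<Rightarrow> (nat \<times> nat) set" where
  "coins \<omega> = {e \<in> cells. B (row_point t n (xs \<omega>) (fst e), col_point t n (xs \<omega>) (snd e)) \<omega>}"

text \<open>The points enter \<open>coins\<close> only through these labels. They take countably
  many values, and for a fixed value the cells consult a fixed family of coins.\<close>

definition labels :: "(nat \<Rightarrow> real \<times> real) \<Rightarrow> nat list \<times> nat list" where
  "labels x = (map (row_point t n x) [0..<n], map (col_point t n x) [0..<n])"

abbreviation "PX \<equiv> Pi\<^sub>M UNIV (\<lambda>_ :: nat. borel :: (real \<times> real) measure)"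

lemma good_measurable [measurable]: "Measurable.pred PX (good t n)"
  unfolding good_def[abs_def] by measurable

lemma occ_measurable [measurable]: "Measurable.pred PX (\<lambda>x. occ t n x = W)"
  unfolding set_eq_iff occ_def by measurable

lemma past_diamond_measurable [measurable]: "past_diamond t \<in> measurable PX (count_space UNIV)"
  unfolding past_diamond_def[abs_def] by measurable

lemma row_point_measurable [measurable]: "(\<lambda>x. row_point t n x r) \<in> measurable PX (count_space UNIV)"
  unfolding row_point_def by measurable

lemma col_point_measurable [measurable]: "(\<lambda>x. col_point t n x r) \<in> measurable PX (count_space UNIV)"
  unfolding col_point_def by measurable

lemma labels_measurable [measurable]: "Measurable.pred PX (\<lambda>x. labels x = l)"
proof -
  have "(labels x = l) = (length (fst l) = n \<and> length (snd l) = n \<and>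
      (\<forall>r\<in>{..<n}. row_point t n x r = fst l ! r) \<and> (\<forall>r\<in>{..<n}. col_point t n x r = snd l ! r))" for x
    by (cases l) (auto simp: labels_def list_eq_iff_nth_eq)
  then show ?thesis by simp
qed

lemma xs_measurable [measurable]: "xs \<in> measurable M PX"
  by (rule measurable_PiM_single') auto

lemma B_False: "\<P>(\<omega> in M. \<not> B e \<omega>) = 1 - q"
proof -
  have "{\<omega>\<in>space M. \<not> B e \<omega>} = space M - {\<omega>\<in>space M. B e \<omega>}" by auto
  then show ?thesis using coins_prob[of e] by (simp add: prob_compl)
qed

lemma prod_if_power:
  assumes "finite A" "T \<subseteq> A"
  shows "(\<Prod>e\<in>A. if e \<in> T then a else b) = a ^ card T * (b :: real) ^ card (A - T)"
  using assms by (simp add: prod.If_cases Int_absorb1 Diff_eq[symmetric])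

definition coin_weight :: "(nat \<times> nat) set \<Rightarrow> real" where
  "coin_weight T = q ^ card T * (1 - q) ^ card (cells - T)"

lemma prob_coin_pattern:
  assumes "inj_on f cells" "T \<subseteq> cells"
  shows "\<P>(\<omega> in M. \<forall>e\<in>cells. B (f e) \<omega> = (e \<in> T)) = coin_weight T"
proof -
  have ne: "f ` cells \<noteq> {}" "finite (f ` cells)" using n by auto
  let ?A = "\<lambda>j. {inv_into cells f j \<in> T}"
  have "{\<omega>\<in>space M. \<forall>e\<in>cells. B (f e) \<omega> = (e \<in> T)} = (\<Inter>j\<in>f ` cells. B j -` ?A j \<inter> space M)"
    using assms(1) n by (auto simp: inv_into_f_f)
  also have "prob \<dots> = (\<Prod>j\<in>f ` cells. prob (B j -` ?A j \<inter> space M))"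
    by (rule indep_varsD[OF coins_indep ne]) auto
  also have "\<dots> = (\<Prod>e\<in>cells. prob (B (f e) -` {e \<in> T} \<inter> space M))"
    by (subst prod.reindex[OF assms(1)]) (auto intro!: prod.cong simp: inv_into_f_f[OF assms(1)])
  also have "\<dots> = (\<Prod>e\<in>cells. if e \<in> T then q else 1 - q)"
  proof (rule prod.cong)
    fix e
    have "B (f e) -` {True} \<inter> space M = {\<omega>\<in>space M. B (f e) \<omega>}"
      "B (f e) -` {False} \<inter> space M = {\<omega>\<in>space M. \<not> B (f e) \<omega>}" by auto
    then show "prob (B (f e) -` {e \<in> T} \<inter> space M) = (if e \<in> T then q else 1 - q)"
      by (simp add: coins_prob B_False)
  qed simp
  also have "\<dots> = coin_weight T"
    unfolding coin_weight_def by (rule prod_if_power) (use assms in auto)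
  finally show ?thesis .
qed

lemma indep_points_coins:
  assumes "Measurable.pred PX Q" "Measurable.pred (Pi\<^sub>M UNIV (\<lambda>_. count_space UNIV)) R"
  shows "\<P>(\<omega> in M. Q (xs \<omega>) \<and> R (cs \<omega>)) =
    \<P>(\<omega> in M. Q (xs \<omega>)) * \<P>(\<omega> in M. R (cs \<omega>))"
proof -
  have 1: "{x. Q x} \<in> sets PX" using assms(1) by (simp add: pred_def space_PiM)
  have 2: "{b. R b} \<in> sets (Pi\<^sub>M UNIV (\<lambda>_. count_space UNIV))" using assms(2) by (simp add: pred_def space_PiM)
  have "prob (((\<lambda>\<omega> i. X i \<omega>) -` {x. Q x} \<inter> space M) \<inter> ((\<lambda>\<omega> e. B e \<omega>) -` {b. R b} \<inter> space M)) =
     prob ((\<lambda>\<omega> i. X i \<omega>) -` {x. Q x} \<inter> space M) * prob ((\<lambda>\<omega> e. B e \<omega>) -` {b. R b} \<inter> space M)"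
    by (rule indep_setD[OF coins_indep_points]) (use 1 2 in blast)+
  moreover have "((\<lambda>\<omega> i. X i \<omega>) -` {x. Q x} \<inter> space M) \<inter> ((\<lambda>\<omega> e. B e \<omega>) -` {b. R b} \<inter> space M) =
      {\<omega>\<in>space M. Q (xs \<omega>) \<and> R (cs \<omega>)}"
    "(\<lambda>\<omega> i. X i \<omega>) -` {x. Q x} \<inter> space M = {\<omega>\<in>space M. Q (xs \<omega>)}"
    "(\<lambda>\<omega> e. B e \<omega>) -` {b. R b} \<inter> space M = {\<omega>\<in>space M. R (cs \<omega>)}" by auto
  ultimately show ?thesis by simp
qed

lemma coins_eq:
  assumes "labels (xs \<omega>) = (a, b)" "T \<subseteq> cells"
  shows "coins \<omega> = T \<longleftrightarrow> (\<forall>e\<in>cells. B (a ! fst e, b ! snd e) \<omega> = (e \<in> T))"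
proof -
  have "a ! r = row_point t n (xs \<omega>) r" "b ! r = col_point t n (xs \<omega>) r" if "r < n" for r
    using assms(1) that by (auto simp: labels_def)
  then have "B (a ! fst e, b ! snd e) \<omega> \<longleftrightarrow> e \<in> coins \<omega>" if "e \<in> cells" for e
    using that by (cases e) (auto simp: coins_def)
  then show ?thesis using assms(2) by (auto simp: coins_def)
qed

lemma coins_measurable [measurable]: "Measurable.pred M (\<lambda>\<omega>. coins \<omega> = T)"
proof -
  have [measurable]: "Measurable.pred M (\<lambda>\<omega>. labels (xs \<omega>) = l)" for l by measurable
  have eq: "(coins \<omega> = T) = (T \<subseteq> cells \<and> (\<exists>l. labels (xs \<omega>) = l \<and>
      (\<forall>e\<in>cells. B (fst l ! fst e, snd l ! snd e) \<omega> = (e \<in> T))))" for \<omega>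
  proof (cases "T \<subseteq> cells")
    case True
    then show ?thesis using coins_eq[of \<omega> "fst (labels (xs \<omega>))" "snd (labels (xs \<omega>))"] by auto
  qed (auto simp: coins_def)
  show ?thesis unfolding eq by measurable
qed

text \<open>Conditioning on \<open>labels\<close>: for each value the coins consulted are fixed,
  distinct and independent of the points, so their pattern has the law \<open>coin_weight\<close>
  whatever the points do.\<close>

lemma prob_points_coins:
  assumes Q: "Measurable.pred PX Q" and T: "T \<subseteq> cells"
  shows "\<P>(\<omega> in M. Q (xs \<omega>) \<and> coins \<omega> = T) = coin_weight T * \<P>(\<omega> in M. Q (xs \<omega>))"
proof -
  note [measurable] = Q
  let ?E = "\<lambda>l. {\<omega>\<in>space M. Q (xs \<omega>) \<and> labels (xs \<omega>) = l}"
  let ?A = "\<lambda>l. {\<omega>\<in>space M. (Q (xs \<omega>) \<and> labels (xs \<omega>) = l) \<and> coins \<omega> = T}"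
  have w: "0 \<le> coin_weight T" using q_pos q_less_1 by (simp add: coin_weight_def)
  have each: "emeasure M (?A l) = ennreal (coin_weight T) * emeasure M (?E l)" for l
  proof (cases "?E l = {}")
    case True
    then have "?A l = {}" by blast
    then show ?thesis using True by (simp only: emeasure_empty mult_zero_right)
  next
    case False
    obtain a b where l: "l = (a, b)" by (cases l)
    \<comment> \<open>The indices of the coins are known to be distinct only for labels that come
      from some realisation; this is why empty events are treated separately.\<close>
    from False obtain \<omega>0 where w0: "\<omega>0 \<in> space M" "labels (xs \<omega>0) = (a, b)" unfolding l by blast
    have ab: "a ! r = row_point t n (xs \<omega>0) r" "b ! r = col_point t n (xs \<omega>0) r" if "r < n" for r
      using w0(2) that by (auto simp: labels_def)
    have inj: "inj_on (\<lambda>e. (a ! fst e, b ! snd e)) cells"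
      using inj_points[OF t n config[OF w0(1)]] ab by (auto simp: inj_on_def)
    have "?A l = {\<omega>\<in>space M. (Q (xs \<omega>) \<and> labels (xs \<omega>) = l) \<and> (\<forall>e\<in>cells. B (a ! fst e, b ! snd e) \<omega> = (e \<in> T))}"
    proof (rule Collect_cong)
      fix \<omega>
      show "(\<omega> \<in> space M \<and> (Q (xs \<omega>) \<and> labels (xs \<omega>) = l) \<and> coins \<omega> = T) \<longleftrightarrow>
          (\<omega> \<in> space M \<and> (Q (xs \<omega>) \<and> labels (xs \<omega>) = l) \<and> (\<forall>e\<in>cells. B (a ! fst e, b ! snd e) \<omega> = (e \<in> T)))"
        using coins_eq[of \<omega> a b, OF _ T] l by blast
    qed
    also have "prob \<dots> = prob (?E l) * \<P>(\<omega> in M. \<forall>e\<in>cells. B (a ! fst e, b ! snd e) \<omega> = (e \<in> T))"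
      by (rule indep_points_coins) measurable
    finally have "prob (?A l) = coin_weight T * prob (?E l)"
      by (simp only: prob_coin_pattern[OF inj T] mult.commute)
    then show ?thesis using w by (simp only: emeasure_eq_measure ennreal_mult measure_nonneg)
  qed
  have "{\<omega>\<in>space M. Q (xs \<omega>) \<and> coins \<omega> = T} = (\<Union>l. ?A l)" by auto
  then have "emeasure M {\<omega>\<in>space M. Q (xs \<omega>) \<and> coins \<omega> = T} = (\<integral>\<^sup>+l. emeasure M (?A l) \<partial>count_space UNIV)"
    by (simp only:) (rule emeasure_UN_countable, auto simp: disjoint_family_on_def)
  also have "\<dots> = ennreal (coin_weight T) * (\<integral>\<^sup>+l. emeasure M (?E l) \<partial>count_space UNIV)"
    unfolding each by (rule nn_integral_cmult) simp
  also have "(\<integral>\<^sup>+l. emeasure M (?E l) \<partial>count_space UNIV) = emeasure M (\<Union>l. ?E l)"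
    by (rule emeasure_UN_countable[symmetric]) (auto simp: disjoint_family_on_def)
  also have "(\<Union>l. ?E l) = {\<omega>\<in>space M. Q (xs \<omega>)}" by auto
  finally show ?thesis
    using w by (simp add: emeasure_eq_measure ennreal_mult[symmetric])
qed

lemma cell_subset: "e \<in> cells \<Longrightarrow> cell t n e \<subseteq> diamond t"
  using regions(3)[OF t n, of "snd e" "fst e"] by auto

lemma cell_bounded: "e \<in> cells \<Longrightarrow> bounded (cell t n e)"
  by (rule bounded_subset[OF bounded_diamond cell_subset])

lemma prob_cell_empty:
  assumes "e \<in> cells"
  shows "\<P>(\<omega> in M. point_count X (cell t n e) \<omega> = 0) = 1 - cell_prob q t n"
proof -
  have "\<P>(\<omega> in M. point_count X (cell t n e) \<omega> = 0) = exp (- (2 * (1 - q) * ((t / real n)\<^sup>2 / 2)))"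
    using cell_subset[OF assms] diamond_cone bounded_subset[OF bounded_diamond]
    by (subst count_prob) (auto simp: region_measure(1)[OF t n])
  also have "2 * (1 - q) * ((t / real n)\<^sup>2 / 2) = (1 - q) * t\<^sup>2 / (real n)\<^sup>2"
  proof -
    have "2 * c * (y / 2) = c * y" for c y :: real by simp
    from this[of "1 - q"] show ?thesis by (simp only:) (simp add: power_divide)
  qed
  finally show ?thesis by (simp add: cell_prob_def)
qed

lemma prob_occ:
  assumes W: "W \<subseteq> cells"
  shows "\<P>(\<omega> in M. occ t n (xs \<omega>) = W) =
    cell_prob q t n ^ card W * (1 - cell_prob q t n) ^ card (cells - W)"
proof -
  \<comment> \<open>Independence of counts is assumed for families of regions indexed by natural
    numbers, hence the encoding of cells.\<close>
  let ?A = "\<lambda>m. cell t n (prod_decode m)" and ?I = "prod_encode ` cells"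
  let ?Y = "\<lambda>m. point_count X (?A m)"
  let ?D = "\<lambda>m. if prod_decode m \<in> W then - {0} else {0 :: nat}"
  have "disjoint_family_on ?A ?I"
  unfolding disjoint_family_on_def
  proof (intro ballI impI)
    fix m k :: nat assume "m \<noteq> k"
    then have "prod_decode m \<noteq> prod_decode k" by (metis prod_decode_inverse)
    then show "?A m \<inter> ?A k = {}"
      using strip_disjoint[OF t n] strip_nonneg[OF t n] by (fastforce simp: cell_def prod_eq_iff)
  qed
  moreover have "\<forall>m\<in>?I. ?A m \<in> sets borel \<and> bounded (?A m)"
    by (auto intro!: cell_bounded)
  ultimately have ind: "indep_vars (\<lambda>_. count_space UNIV) ?Y ?I"
    using points unfolding poisson_process_on_cone_def by blast
  have ne: "?I \<noteq> {}" "finite ?I" using n by auto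
  have "{\<omega>\<in>space M. occ t n (xs \<omega>) = W} = (\<Inter>m\<in>?I. ?Y m -` ?D m \<inter> space M)"
  proof (rule set_eqI)
    fix \<omega>
    have "occ t n (xs \<omega>) = W \<longleftrightarrow> (\<forall>e\<in>cells. (point_count X (cell t n e) \<omega> \<noteq> 0) = (e \<in> W))"
      using W by (auto simp: occ_def point_count_def)
    moreover have "(point_count X (cell t n e) \<omega> \<noteq> 0) = (e \<in> W) \<longleftrightarrow> ?Y (prod_encode e) \<omega> \<in> ?D (prod_encode e)" for e
      by simp
    ultimately show "\<omega> \<in> {\<omega>\<in>space M. occ t n (xs \<omega>) = W} \<longleftrightarrow> \<omega> \<in> (\<Inter>m\<in>?I. ?Y m -` ?D m \<inter> space M)"
      using n by (auto simp only: INT_iff ball_simps vimage_eq Int_iff mem_Collect_eq) auto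
  qed
  also have "prob \<dots> = (\<Prod>m\<in>?I. prob (?Y m -` ?D m \<inter> space M))"
    by (rule indep_varsD[OF ind ne]) auto
  also have "\<dots> = (\<Prod>e\<in>cells. if e \<in> W then cell_prob q t n else 1 - cell_prob q t n)"
  proof (subst prod.reindex)
    show "inj_on prod_encode cells" by (rule inj_prod_encode)
    show "(\<Prod>e\<in>cells. ((\<lambda>m. prob (?Y m -` ?D m \<inter> space M)) \<circ> prod_encode) e) =
      (\<Prod>e\<in>cells. if e \<in> W then cell_prob q t n else 1 - cell_prob q t n)"
    proof (rule prod.cong)
      fix e assume e: "e \<in> cells"
      let ?Z = "{\<omega>\<in>space M. point_count X (cell t n e) \<omega> = 0}"
      have Z: "prob ?Z = 1 - cell_prob q t n" by (rule prob_cell_empty[OF e])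
      have "prob (space M - ?Z) = cell_prob q t n" using Z by (subst prob_compl) auto
      moreover have "space M - ?Z = point_count X (cell t n e) -` (- {0}) \<inter> space M"
        "?Z = point_count X (cell t n e) -` {0} \<inter> space M" by auto
      ultimately show "((\<lambda>m. prob (?Y m -` ?D m \<inter> space M)) \<circ> prod_encode) e =
          (if e \<in> W then cell_prob q t n else 1 - cell_prob q t n)"
        using Z by simp
    qed simp
  qed
  also have "\<dots> = cell_prob q t n ^ card W * (1 - cell_prob q t n) ^ card (cells - W)"
    by (rule prod_if_power) (use W in auto)
  finally show ?thesis .
qed

lemma prob_count_pos:
  assumes A: "A \<in> sets borel" "A \<subseteq> diamond t"
  shows "\<P>(\<omega> in M. point_count X A \<omega> \<noteq> 0) \<le> 2 * (1 - q) * measure lborel A"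
    and "\<P>(\<omega> in M. \<not> point_count X A \<omega> \<le> 1) \<le> (2 * (1 - q) * measure lborel A)\<^sup>2"
proof -
  note [measurable] = A(1)
  let ?m = "2 * (1 - q) * measure lborel A"
  have m: "0 \<le> ?m" using q_less_1 by simp
  have A': "A \<in> sets borel" "bounded A" "A \<subseteq> forward_cone"
    using A bounded_subset[OF bounded_diamond] diamond_cone by blast+
  have 0: "\<P>(\<omega> in M. point_count X A \<omega> = 0) = exp (- ?m)"
    by (subst count_prob[OF A']) simp
  have 1: "\<P>(\<omega> in M. point_count X A \<omega> = 1) = ?m * exp (- ?m)"
    by (subst count_prob[OF A']) simp
  have e: "1 - ?m \<le> exp (- ?m)" using exp_ge_add_one_self[of "- ?m"] by simp
  have "{\<omega>\<in>space M. point_count X A \<omega> \<noteq> 0} = space M - {\<omega>\<in>space M. point_count X A \<omega> = 0}" by auto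
  then have "\<P>(\<omega> in M. point_count X A \<omega> \<noteq> 0) = 1 - exp (- ?m)"
    by (simp add: prob_compl 0)
  then show "\<P>(\<omega> in M. point_count X A \<omega> \<noteq> 0) \<le> ?m" using e by linarith
  have "{\<omega>\<in>space M. \<not> point_count X A \<omega> \<le> 1} =
      space M - ({\<omega>\<in>space M. point_count X A \<omega> = 0} \<union> {\<omega>\<in>space M. point_count X A \<omega> = 1})" by auto
  moreover have "prob ({\<omega>\<in>space M. point_count X A \<omega> = 0} \<union> {\<omega>\<in>space M. point_count X A \<omega> = 1}) =
      exp (- ?m) + ?m * exp (- ?m)"
    using 0 1 by (subst finite_measure_Union) auto
  ultimately have "\<P>(\<omega> in M. \<not> point_count X A \<omega> \<le> 1) = 1 - (1 + ?m) * exp (- ?m)"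
    by (simp add: prob_compl distrib_right)
  moreover have "(1 + ?m) * (1 - ?m) \<le> (1 + ?m) * exp (- ?m)"
    using m e by (intro mult_left_mono) auto
  ultimately show "\<P>(\<omega> in M. \<not> point_count X A \<omega> \<le> 1) \<le> ?m\<^sup>2"
    by (simp add: algebra_simps power2_eq_square)
qed

definition bad :: "'a set" where
  "bad = {\<omega>\<in>space M. \<not> good t n (xs \<omega>)}"

abbreviation "bad_mgf \<equiv> \<integral>\<omega>. z ^ (2 * N t \<omega>) * indicator bad \<omega> \<partial>M"

lemma bad_measurable [measurable]: "bad \<in> sets M"
  unfolding bad_def by measurable

text \<open>A union bound. Two points in a cross of area of order \<open>1 / n\<close>, or one in a
  diagonal cell of area of order \<open>1 / n\<^sup>2\<close>, have probability of order
  \<open>1 / n\<^sup>2\<close>; there are \<open>n\<close> of each kind, and the edges are null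
  sets.\<close>

lemma prob_bad: "prob bad \<le> ((2 * (1 - q) * t\<^sup>2)\<^sup>2 + (1 - q) * t\<^sup>2) / real n"
proof -
  let ?a = "\<lambda>k. {\<omega>\<in>space M. \<not> point_count X (row_strip t n k \<union> col_strip t n k) \<omega> \<le> 1}"
  let ?b = "\<lambda>k. {\<omega>\<in>space M. point_count X (cell t n (k, k)) \<omega> \<noteq> 0}"
  let ?c = "{\<omega>\<in>space M. point_count X (upper_edges t) \<omega> \<noteq> 0}"
  have q1: "0 \<le> 1 - q" using q_less_1 by simp
  have good_iff: "good t n (xs \<omega>) \<longleftrightarrow> (\<forall>k<n. point_count X (row_strip t n k \<union> col_strip t n k) \<omega> \<le> 1) \<and>
      (\<forall>k<n. point_count X (cell t n (k, k)) \<omega> = 0) \<and> point_count X (upper_edges t) \<omega> = 0" for \<omega>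
    by (simp only: good_def point_count_def)
  have m: "(\<Union>k<n. ?a k) \<in> events" "(\<Union>k<n. ?b k) \<in> events" "?c \<in> events" by measurable
  from good_iff have bad_eq: "bad = (\<Union>k<n. ?a k) \<union> (\<Union>k<n. ?b k) \<union> ?c"
    unfolding bad_def by auto
  have 1: "prob bad \<le> prob (\<Union>k<n. ?a k) + prob (\<Union>k<n. ?b k) + prob ?c"
    unfolding bad_eq by (rule order_trans[OF measure_Un_le[OF sets.Un[OF m(1,2)] m(3)]
      add_right_mono[OF measure_Un_le[OF m(1,2)]]])
  have "prob (\<Union>k<n. ?a k) \<le> (\<Sum>k<n. prob (?a k))"
    by (rule finite_measure_subadditive_finite) auto
  also have "\<dots> \<le> (\<Sum>k<n. (2 * (1 - q) * (t\<^sup>2 / real n))\<^sup>2)"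
  proof (rule sum_mono)
    fix k assume "k \<in> {..<n}"
    then have "prob (?a k) \<le> (2 * (1 - q) * measure lborel (row_strip t n k \<union> col_strip t n k))\<^sup>2"
      using regions(1,2)[OF t n, of k] by (intro prob_count_pos(2)) auto
    also have "\<dots> \<le> (2 * (1 - q) * (t\<^sup>2 / real n))\<^sup>2"
      using region_measure(2)[OF t n, of k] q1 by (intro power_mono mult_left_mono) auto
    finally show "prob (?a k) \<le> (2 * (1 - q) * (t\<^sup>2 / real n))\<^sup>2" .
  qed
  also have "\<dots> = (2 * (1 - q) * t\<^sup>2)\<^sup>2 / real n"
    using n by (simp add: power2_eq_square)
  finally have 2: "prob (\<Union>k<n. ?a k) \<le> (2 * (1 - q) * t\<^sup>2)\<^sup>2 / real n" .
  have "prob (\<Union>k<n. ?b k) \<le> (\<Sum>k<n. prob (?b k))"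
    by (rule finite_measure_subadditive_finite) auto
  also have "\<dots> \<le> (\<Sum>k<n. 2 * (1 - q) * ((t / real n)\<^sup>2 / 2))"
  proof (rule sum_mono)
    fix k assume "k \<in> {..<n}"
    then show "prob (?b k) \<le> 2 * (1 - q) * ((t / real n)\<^sup>2 / 2)"
      using prob_count_pos(1)[of "cell t n (k, k)"] cell_subset[of "(k, k)"]
      unfolding region_measure(1)[OF t n] by auto
  qed
  also have "\<dots> = (1 - q) * t\<^sup>2 / real n"
  proof -
    have "real n * (2 * c * ((t / real n)\<^sup>2 / 2)) = c * t\<^sup>2 / real n" for c
      using n by (simp add: power2_eq_square)
    from this[of "1 - q"] show ?thesis by simp
  qed
  finally have 3: "prob (\<Union>k<n. ?b k) \<le> (1 - q) * t\<^sup>2 / real n" .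
  have 4: "prob ?c \<le> 0"
    using prob_count_pos(1)[of "upper_edges t"] regions(4)[OF t n n] by (simp add: region_measure(3)[OF t n])
  show ?thesis
    using order_trans[OF 1 add_mono[OF add_mono[OF 2 3] 4]] by (simp only: add_divide_distrib add_0_right)
qed

lemma integrable_N: "integrable M (\<lambda>\<omega>. (z ^ k) ^ N t \<omega>)"
  using z bounded_diamond diamond_cone by (intro integrable_power_count) auto

lemma H_good:
  assumes "\<omega> \<in> space M" "good t n (xs \<omega>)"
  shows "H t \<omega> = card {r. r < n \<and> hline (occ t n (xs \<omega>)) (coins \<omega>) r n}"
proof -
  have "ereal (real (H t \<omega>)) = height (xs \<omega>) (cs \<omega>) (0, t)"
    using png_height_eq[of t \<omega>] t assms(1) by (simp add: png_height_def)
  also have "\<dots> = ereal (real (card {r. r < n \<and> hline (occ t n (xs \<omega>)) (coins \<omega>) r n}))"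
    unfolding coins_def by (rule height_good[OF t n config[OF assms(1)] assms(2)])
  finally show ?thesis by simp
qed

lemma integral_const_indicator: "A \<in> events \<Longrightarrow> (\<integral>\<omega>. a * indicator A \<omega> \<partial>M) = a * prob A" for a :: real
  by simp

text \<open>On the good event both models have the same height, and the points and coins have the
  law of the vertex model. On the bad event either height is at most \<open>2 * N t\<close>. Both
  remainders lie between 0 and \<open>bad_mgf\<close>, hence so does the absolute value of their
  difference.\<close>

lemma discretization_error:
  "\<bar>mgf t - droplet q (cell_prob q t n) z n n\<bar> \<le>
    bad_mgf"
proof -
  let ?d = "cell_prob q t n"
  define lines where "lines = (\<lambda>W T. card {r. r < n \<and> hline W T r n})"
  define g where "g = (\<lambda>W. subset_exp q cells (\<lambda>T. z ^ lines W T))"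
  define P where "P = (\<lambda>W. \<P>(\<omega> in M. good t n (xs \<omega>) \<and> occ t n (xs \<omega>) = W))"
  let ?F = "\<lambda>W. {\<omega>\<in>space M. \<not> good t n (xs \<omega>) \<and> occ t n (xs \<omega>) = W}"
  let ?G = "\<lambda>W T. {\<omega>\<in>space M. (good t n (xs \<omega>) \<and> occ t n (xs \<omega>) = W) \<and> coins \<omega> = T}"
  have z0: "0 < z" "1 \<le> z" using z by auto
  have fin: "finite (Pow cells)" by simp
  have d: "0 \<le> ?d" "?d \<le> 1" using q_pos q_less_1 by (auto simp: cell_prob_def)
  have q01: "0 \<le> q" "q \<le> 1" using q_pos q_less_1 by auto
  have int2N: "integrable M (\<lambda>\<omega>. z ^ (2 * N t \<omega>))"
    using integrable_N[of 2] by (simp add: power_mult)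
  note [measurable] = diamond_borel
  have drop: "droplet q ?d z n n = (\<Sum>W\<in>Pow cells. \<P>(\<omega> in M. occ t n (xs \<omega>) = W) * g W)"
    unfolding droplet_eq_subset_exp[OF q01 d] g_def lines_def subset_exp_def[of ?d]
    by (rule sum.cong) (auto simp: prob_occ)
  have split: "\<P>(\<omega> in M. occ t n (xs \<omega>) = W) = P W + prob (?F W)" for W
    unfolding P_def by (subst finite_measure_Union[symmetric]) (auto intro!: arg_cong[of _ _ prob])
  have g_nonneg: "0 \<le> g W" for W
    unfolding g_def using z0 by (intro fexp_nonneg[OF fexp_subset_exp[OF q01]]) auto
  have g_le: "g W \<le> z ^ card W" if "W \<in> Pow cells" for W
  proof -
    have "finite W" using that finite_subset[of W cells] by auto
    then have "g W \<le> subset_exp q cells (\<lambda>T. z ^ card W)"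
      unfolding g_def lines_def using z0
      by (intro fexp_mono[OF fexp_subset_exp[OF q01]] power_increasing card_hline_le) auto
    then show ?thesis by (simp add: fexp_const[OF fexp_subset_exp[OF q01]])
  qed
  have good_part: "mgf t = (\<Sum>W\<in>Pow cells. P W * g W) + (\<integral>\<omega>. z ^ H t \<omega> * indicator bad \<omega> \<partial>M)"
  proof -
    have pt: "z ^ H t \<omega> = (\<Sum>W\<in>Pow cells. \<Sum>T\<in>Pow cells. z ^ lines W T * indicator (?G W T) \<omega>) +
        z ^ H t \<omega> * indicator bad \<omega>" if w: "\<omega> \<in> space M" for \<omega>
    proof (cases "good t n (xs \<omega>)")
      case True
      let ?W = "occ t n (xs \<omega>)" and ?T = "coins \<omega>"
      have in_cells: "?W \<in> Pow cells" "?T \<in> Pow cells" by (auto simp: occ_def coins_def)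
      have "(\<Sum>W\<in>Pow cells. \<Sum>T\<in>Pow cells. z ^ lines W T * indicator (?G W T) \<omega>) =
          (\<Sum>W\<in>Pow cells. \<Sum>T\<in>Pow cells. if T = ?T then if W = ?W then z ^ lines W T else 0 else 0)"
        using True w by (intro sum.cong refl) (auto simp: indicator_def)
      also have "\<dots> = z ^ lines ?W ?T"
        using in_cells fin by (simp only: sum.delta if_True)
      finally show ?thesis using True w H_good[OF w True] by (simp add: bad_def lines_def)
    next
      case False
      then show ?thesis using w by (simp add: bad_def)
    qed
    have intH: "integrable M (\<lambda>\<omega>. z ^ H t \<omega> * indicator bad \<omega>)"
      by (rule integrable_real_mult_indicator[OF bad_measurable integrable_H])
    have intG: "integrable M (\<lambda>\<omega>. z ^ lines W T * indicator (?G W T) \<omega>)" for W T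
      by (intro integrable_mult_right integrable_real_indicator) (auto simp: emeasure_eq_measure)
    have "mgf t = (\<integral>\<omega>. (\<Sum>W\<in>Pow cells. \<Sum>T\<in>Pow cells. z ^ lines W T * indicator (?G W T) \<omega>) +
        z ^ H t \<omega> * indicator bad \<omega> \<partial>M)"
      by (rule Bochner_Integration.integral_cong[OF refl pt])
    also have "\<dots> = (\<Sum>W\<in>Pow cells. \<Sum>T\<in>Pow cells. z ^ lines W T * prob (?G W T)) + (\<integral>\<omega>. z ^ H t \<omega> * indicator bad \<omega> \<partial>M)"
    proof -
      have G: "?G W T \<in> events" for W T by measurable
      have intD: "integrable M (\<lambda>\<omega>. \<Sum>T\<in>Pow cells. z ^ lines W T * indicator (?G W T) \<omega>)" for W
        by (intro Bochner_Integration.integrable_sum intG)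
      have intE: "integrable M (\<lambda>\<omega>. \<Sum>W\<in>Pow cells. \<Sum>T\<in>Pow cells. z ^ lines W T * indicator (?G W T) \<omega>)"
        by (intro Bochner_Integration.integrable_sum intD)
      show ?thesis
        unfolding Bochner_Integration.integral_add[OF intE intH] Bochner_Integration.integral_sum[OF intD]
          Bochner_Integration.integral_sum[OF intG] integral_const_indicator[OF G] ..
    qed
    also have "(\<Sum>W\<in>Pow cells. \<Sum>T\<in>Pow cells. z ^ lines W T * prob (?G W T)) = (\<Sum>W\<in>Pow cells. P W * g W)"
    proof (rule sum.cong[OF refl])
      fix W
      have "prob (?G W T) = coin_weight T * P W" if "T \<in> Pow cells" for T
        unfolding P_def using that by (intro prob_points_coins) auto
      then have "(\<Sum>T\<in>Pow cells. z ^ lines W T * prob (?G W T)) = (\<Sum>T\<in>Pow cells. P W * (coin_weight T * z ^ lines W T))"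
        by (intro sum.cong) auto
      then show "(\<Sum>T\<in>Pow cells. z ^ lines W T * prob (?G W T)) = P W * g W"
        by (simp add: g_def subset_exp_def coin_weight_def sum_distrib_left)
    qed
    finally show ?thesis .
  qed
  have bad1: "0 \<le> (\<integral>\<omega>. z ^ H t \<omega> * indicator bad \<omega> \<partial>M)"
    using z0 by (intro Bochner_Integration.integral_nonneg) simp
  have intb: "integrable M (\<lambda>\<omega>. z ^ (2 * N t \<omega>) * indicator bad \<omega>)"
    by (rule integrable_real_mult_indicator[OF bad_measurable int2N])
  have bad2: "(\<integral>\<omega>. z ^ H t \<omega> * indicator bad \<omega> \<partial>M) \<le> bad_mgf"
    using z0 H_le
    by (intro integral_mono integrable_real_mult_indicator[OF bad_measurable integrable_H] intb mult_right_mono power_increasing) auto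
  have "(\<Sum>W\<in>Pow cells. prob (?F W) * g W) \<le> (\<Sum>W\<in>Pow cells. \<integral>\<omega>. z ^ (2 * N t \<omega>) * indicator (?F W) \<omega> \<partial>M)"
  proof (rule sum_mono)
    fix W assume W: "W \<in> Pow cells"
    have F: "?F W \<in> sets M" by measurable
    have "prob (?F W) * g W \<le> prob (?F W) * z ^ card W"
      using g_le[OF W] by (intro mult_left_mono) auto
    also have "\<dots> = (\<integral>\<omega>. z ^ card W * indicator (?F W) \<omega> \<partial>M)"
      by (subst integral_const_indicator[OF F]) (rule mult.commute)
    also have "\<dots> \<le> (\<integral>\<omega>. z ^ (2 * N t \<omega>) * indicator (?F W) \<omega> \<partial>M)"
    proof (rule integral_mono)
      show "integrable M (\<lambda>\<omega>. z ^ card W * indicator (?F W) \<omega>)"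
        using F by (intro integrable_mult_right integrable_real_indicator) (auto simp: emeasure_eq_measure)
      show "integrable M (\<lambda>\<omega>. z ^ (2 * N t \<omega>) * indicator (?F W) \<omega>)"
        by (rule integrable_real_mult_indicator[OF F int2N])
      fix \<omega> assume w: "\<omega> \<in> space M"
      have "card (occ t n (xs \<omega>)) \<le> 2 * N t \<omega>"
        using card_occ_le[OF t n config[OF w]] by (simp add: point_count_def)
      then have "occ t n (xs \<omega>) = W \<Longrightarrow> z ^ card W \<le> z ^ (2 * N t \<omega>)"
        using z0 by (intro power_increasing) auto
      then show "z ^ card W * indicator (?F W) \<omega> \<le> z ^ (2 * N t \<omega>) * indicator (?F W) \<omega>"
        by (auto simp: indicator_def)
    qed
    finally show "prob (?F W) * g W \<le> (\<integral>\<omega>. z ^ (2 * N t \<omega>) * indicator (?F W) \<omega> \<partial>M)" .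
  qed
  also have "\<dots> = (\<integral>\<omega>. (\<Sum>W\<in>Pow cells. z ^ (2 * N t \<omega>) * indicator (?F W) \<omega>) \<partial>M)"
    by (rule Bochner_Integration.integral_sum[symmetric]) (intro integrable_real_mult_indicator int2N, measurable)
  also have "\<dots> = bad_mgf"
  proof (rule Bochner_Integration.integral_cong[OF refl])
    fix \<omega> assume w: "\<omega> \<in> space M"
    have "(\<Sum>W\<in>Pow cells. z ^ (2 * N t \<omega>) * indicator (?F W) \<omega>) =
        (\<Sum>W\<in>Pow cells. if W = occ t n (xs \<omega>) then z ^ (2 * N t \<omega>) * indicator bad \<omega> else 0)"
      using w by (intro sum.cong) (auto simp: indicator_def bad_def)
    also have "\<dots> = z ^ (2 * N t \<omega>) * indicator bad \<omega>"
    proof -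
      have "occ t n (xs \<omega>) \<in> Pow cells" by (auto simp: occ_def)
      then show ?thesis using fin by (simp only: sum.delta' sum.delta if_True)
    qed
    finally show "(\<Sum>W\<in>Pow cells. z ^ (2 * N t \<omega>) * indicator (?F W) \<omega>) = z ^ (2 * N t \<omega>) * indicator bad \<omega>" .
  qed
  finally have bad3: "(\<Sum>W\<in>Pow cells. prob (?F W) * g W) \<le> bad_mgf" .
  have "0 \<le> (\<Sum>W\<in>Pow cells. prob (?F W) * g W)"
    using g_nonneg by (intro sum_nonneg mult_nonneg_nonneg) auto
  moreover have "droplet q ?d z n n = (\<Sum>W\<in>Pow cells. P W * g W) + (\<Sum>W\<in>Pow cells. prob (?F W) * g W)"
    unfolding drop split by (simp add: distrib_right sum.distrib)
  ultimately show ?thesis using good_part bad1 bad2 bad3 by linarith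
qed

text \<open>In place of the Cauchy-Schwarz inequality,
  \<open>y * i \<le> y\<^sup>2 / k + k * i\<close> for an indicator \<open>i\<close>. As the bad
  event has probability of order \<open>1 / n\<close>, the choice \<open>k = sqrt (real n)\<close>
  makes both terms of order \<open>1 / k\<close>.\<close>

lemma bad_moment:
  "bad_mgf \<le>
    ((\<integral>\<omega>. (z ^ 4) ^ N t \<omega> \<partial>M) + ((2 * (1 - q) * t\<^sup>2)\<^sup>2 + (1 - q) * t\<^sup>2)) / sqrt (real n)"
proof -
  let ?c = "(2 * (1 - q) * t\<^sup>2)\<^sup>2 + (1 - q) * t\<^sup>2"
  define k where "k = sqrt (real n)"
  have k: "0 < k" "k * k = real n" using n by (auto simp: k_def)
  have am: "y * i \<le> y\<^sup>2 / k + k * i" if "i = 0 \<or> i = 1" "0 \<le> y" for y i :: real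
  proof -
    have "0 \<le> (y - k)\<^sup>2 + y * k" using that k by simp
    then have "y * k \<le> y\<^sup>2 + k * k" by (simp add: power2_eq_square algebra_simps)
    then have "y \<le> y\<^sup>2 / k + k" using k by (simp add: field_simps)
    then show ?thesis using that k by auto
  qed
  have int2N: "integrable M (\<lambda>\<omega>. z ^ (2 * N t \<omega>))"
    using integrable_N[of 2] by (simp add: power_mult)
  have "bad_mgf \<le> (\<integral>\<omega>. (z ^ 4) ^ N t \<omega> / k + k * indicator bad \<omega> \<partial>M)"
  proof (rule integral_mono)
    show "integrable M (\<lambda>\<omega>. z ^ (2 * N t \<omega>) * indicator bad \<omega>)"
      by (rule integrable_real_mult_indicator[OF bad_measurable int2N])
    show "integrable M (\<lambda>\<omega>. (z ^ 4) ^ N t \<omega> / k + k * indicator bad \<omega>)"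
      by (intro Bochner_Integration.integrable_add integrable_divide integrable_N integrable_mult_right integrable_real_indicator)
        (auto simp: emeasure_eq_measure)
    fix \<omega>
    have "(z ^ (2 * N t \<omega>))\<^sup>2 = (z ^ 4) ^ N t \<omega>"
      by (simp add: power_mult[symmetric])
    then show "z ^ (2 * N t \<omega>) * indicator bad \<omega> \<le> (z ^ 4) ^ N t \<omega> / k + k * indicator bad \<omega>"
      using am[of "indicator bad \<omega>" "z ^ (2 * N t \<omega>)"] z by (auto simp: indicator_def)
  qed
  also have "\<dots> = (\<integral>\<omega>. (z ^ 4) ^ N t \<omega> \<partial>M) / k + k * prob bad"
    using integrable_N[of 4] by (subst Bochner_Integration.integral_add) (auto simp: emeasure_eq_measure)
  also have "\<dots> \<le> (\<integral>\<omega>. (z ^ 4) ^ N t \<omega> \<partial>M) / k + k * (?c / real n)"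
    using prob_bad k by (intro add_left_mono mult_left_mono) auto
  also have "k * (?c / real n) = ?c / k"
    unfolding k(2)[symmetric] using k(1) by simp
  finally show ?thesis by (simp add: k_def add_divide_distrib)
qed

end

lemma (in png) droplet_tendsto:
  assumes t: "0 < t"
  shows "(\<lambda>n. droplet q (cell_prob q t n) z n n) \<longlonglongrightarrow> mgf t"
proof (rule LIM_zero_cancel, rule tendsto_0_le)
  define C where "C = (\<integral>\<omega>. (z ^ 4) ^ N t \<omega> \<partial>M) + ((2 * (1 - q) * t\<^sup>2)\<^sup>2 + (1 - q) * t\<^sup>2)"
  show "(\<lambda>n. C / sqrt (real n)) \<longlonglongrightarrow> 0" by real_asymp
  show "eventually (\<lambda>n. norm (droplet q (cell_prob q t n) z n n - mgf t) \<le>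
      norm (C / sqrt (real n)) * 1) sequentially"
    using eventually_gt_at_top[of 0]
  proof eventually_elim
    case (elim n)
    then interpret png_mesh M q X B z t n using t by unfold_locales auto
    have "norm (droplet q (cell_prob q t n) z n n - mgf t) \<le> C / sqrt (real n)"
      using discretization_error bad_moment unfolding C_def by (simp add: abs_minus_commute)
    then show ?case
      unfolding real_norm_def mult_1_right using abs_ge_self[of "C / sqrt (real n)"] by linarith
  qed
qed

theorem theorem3p1:
  fixes M :: "'w measure" and q p :: real
    and X :: "nat \<Rightarrow> 'w \<Rightarrow> real \<times> real" and B :: "nat \<times> nat \<Rightarrow> 'w \<Rightarrow> bool"
  assumes "0 < q" and "q < 1" and "0 < p"
    and "q_png M q (2 * (1 - q)) X B"
  shows "(\<forall>t\<ge>0. integrable M (\<lambda>\<omega>. exp (p * real_of_ereal (png_height X B (0, t) \<omega>)))) \<and>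
    ((\<lambda>t. 1 / t * ln (integral\<^sup>L M (\<lambda>\<omega>. exp (p * real_of_ereal (png_height X B (0, t) \<omega>)))))
      \<longlongrightarrow> 4 * sinh (p / 2)) at_top"
proof -
  define z where "z = exp p"
  have z: "1 < z" using assms(3) by (simp add: z_def)
  interpret png M q X B z
    using assms(4) z by (simp add: png_def png_axioms_def)
  have eq: "exp (p * real_of_ereal (png_height X B (0, t) \<omega>)) = z ^ H t \<omega>" if "0 \<le> t" "\<omega> \<in> space M" for t \<omega>
    using png_height_eq[OF that] by (simp add: z_def exp_of_nat2_mult[symmetric] mult.commute)
  have int: "integrable M (\<lambda>\<omega>. exp (p * real_of_ereal (png_height X B (0, t) \<omega>)))" if "0 \<le> t" for t
    using integrable_H[of t] eq[OF that] by (subst Bochner_Integration.integrable_cong[OF refl]) auto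
  define f where "f = (\<lambda>t. \<integral>\<omega>. z ^ H t \<omega> \<partial>M)"
  have "1 \<le> f t" for t
  proof -
    have "(\<integral>\<omega>. 1 \<partial>M) \<le> f t"
      unfolding f_def using z by (intro integral_mono integrable_H) (auto simp: one_le_power)
    then show ?thesis by (simp add: prob_space)
  qed
  then have lim: "((\<lambda>t. 1 / t * ln (f t)) \<longlongrightarrow> 2 * speed z) at_top"
    using growth_rate[OF q_pos q_less_1 z, of f] droplet_tendsto by (simp add: f_def)
  have "2 * speed z = 4 * sinh (p / 2)"
  proof -
    have "sqrt z = exp (p / 2)" by (simp add: z_def real_sqrt_unique power2_eq_square exp_add[symmetric])
    moreover have "z = exp (p / 2) * exp (p / 2)" by (simp add: z_def exp_add[symmetric])
    ultimately show ?thesis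
      using z unfolding speed_def[OF q_pos q_less_1 z]
      by (simp add: sinh_def exp_minus field_simps)
  qed
  moreover have "((\<lambda>t. 1 / t * ln (integral\<^sup>L M (\<lambda>\<omega>. exp (p * real_of_ereal (png_height X B (0, t) \<omega>)))))
      \<longlongrightarrow> 2 * speed z) at_top"
  proof (rule Lim_transform_eventually[OF lim])
    show "eventually (\<lambda>t. 1 / t * ln (f t) =
        1 / t * ln (integral\<^sup>L M (\<lambda>\<omega>. exp (p * real_of_ereal (png_height X B (0, t) \<omega>))))) at_top"
      using eventually_ge_at_top[of 0]
    proof eventually_elim
      case (elim t)
      then show ?case
        unfolding f_def using eq[OF elim] by (simp cong: Bochner_Integration.integral_cong)
    qed
  qed
  ultimately show ?thesis using int by auto
qed

end
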